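(* Let $0<\gamma\le\infty$, let $\varphi$ be an Orlicz $N$-function and $w$ a decreasing weight function on $I=[0,\gamma)$ such that $W(\infty)=\infty$ if $\gamma=\infty$. Then the Orlicz-Lorentz space $\Lambda_{\varphi,w}$ has the Radon-Nikodým property if and only if $\varphi$ satisfies the $\Delta_2$ condition if $\gamma=\infty$, and $\varphi$ satisfies the $\Delta_2^\infty$ condition if $\gamma<\infty$.
   Context: Decreasing means non-increasing. $L^0=L^0(I)$ is the set of all (classes of a.e. equal) Lebesgue measurable functions $x:I\to\mathbb{R}$; $m$ is Lebesgue measure. For $x\in L^0$, $d_x(\lambda)=m\{t\in I:|x(t)|>\lambda\}$, $\lambda\ge 0$, and $x^*(t)=\inf\{\lambda\ge 0: d_x(\lambda)\le t\}$, $t\ge 0$, is the decreasing rearrangement (values in $[0,\infty]$, $\inf\emptyset=\infty$). A weight function is a decreasing function $w:I\to(0,\infty)$ that is locally integrable: $W(t)=\int_0^t w<\infty$ for all $t\in I$; if $\gamma=\infty$, $W(\infty)=\int_0^\infty w$. An Orlicz function is a convex $\varphi:[0,\infty)\to[0,\infty)$ with $\varphi(0)=0$ and $\varphi(u)>0$ for $u>0$ (and $\varphi(\infty)=\infty$). It is an Orlicz $N$-function if moreover $\lim_{u\to 0^+}\varphi(u)/u=0$ and $\lim_{u\to\infty}\varphi(u)/u=\infty$. $\varphi$ satisfies $\Delta_2$ if there is $K>0$ with $\varphi(2u)\le K\varphi(u)$ for all $u\ge 0$; it satisfies $\Delta_2^\infty$ if there are $K>0$, $u_0\ge 0$ with $\varphi(2u)\le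 K\varphi(u)$ for all $u\ge u_0$. For $x\in L^0$ let $\rho(x)=\int_0^\gamma\varphi(x^*(t))w(t)\,dt$. The Orlicz-Lorentz space is $\Lambda_{\varphi,w}=\{x\in L^0:\rho(\lambda x)<\infty\text{ for some }\lambda>0\}$, a real Banach space with the Luxemburg norm $\|x\|=\inf\{\epsilon>0:\rho(x/\epsilon)\le 1\}$. *)

theory Defs
  imports "HOL-Analysis.Analysis"
begin

quotient_type L0 = "real \<Rightarrow> real" / partial:
  "\<lambda>f g. f \<in> borel_measurable lebesgue \<and> g \<in> borel_measurable lebesgue \<and>
     (AE t in lebesgue. f t = g t)"
proof (rule part_equivpI)
  show "\<exists>f::real \<Rightarrow> real. f \<in> borel_measurable lebesgue \<and> f \<in> borel_measurable lebesgue \<and>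
      (AE t in lebesgue. f t = f t)"
    by (rule exI[of _ "\<lambda>_. 0"]) simp
  show "symp (\<lambda>(f::real \<Rightarrow> real) g. f \<in> borel_measurable lebesgue \<and>
      g \<in> borel_measurable lebesgue \<and> (AE t in lebesgue. f t = g t))"
    by (auto simp: symp_def)
  show "transp (\<lambda>(f::real \<Rightarrow> real) g. f \<in> borel_measurable lebesgue \<and>
      g \<in> borel_measurable lebesgue \<and> (AE t in lebesgue. f t = g t))"
    by (auto simp: transp_def)
qed

instantiation L0 :: real_vector
begin

lift_definition zero_L0 :: L0 is "\<lambda>_. 0" by simp

lift_definition plus_L0 :: "L0 \<Rightarrow> L0 \<Rightarrow> L0" is "\<lambda>f g t. f t + g t"
  by auto

lift_definition minus_L0 :: "L0 \<Rightarrow> L0 \<Rightarrow> L0" is "\<lambda>f g t. f t - g t"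
  by auto

lift_definition uminus_L0 :: "L0 \<Rightarrow> L0" is "\<lambda>f t. - f t"
  by auto

lift_definition scaleR_L0 :: "real \<Rightarrow> L0 \<Rightarrow> L0" is "\<lambda>c f t. c * f t"
  by auto

instance
  by standard (transfer; auto simp: algebra_simps)+

end

definition interval_I :: "ennreal \<Rightarrow> real set" where
  "interval_I \<gamma> = {t. 0 \<le> t \<and> ennreal t < \<gamma>}"

text \<open>Types cannot depend on \<open>\<gamma>\<close>, so a class of functions on \<open>[0,\<gamma>)\<close> is identified with the
  class of their extensions by zero to the real line.\<close>

lift_definition vanishes_off :: "L0 \<Rightarrow> real set \<Rightarrow> bool" is
  "\<lambda>f A. AE t in lebesgue. t \<notin> A \<longrightarrow> f t = 0"
proof -
  fix f g :: "real \<Rightarrow> real"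
  assume "f \<in> borel_measurable lebesgue \<and> g \<in> borel_measurable lebesgue \<and>
    (AE t in lebesgue. f t = g t)"
  then have ae: "AE t in lebesgue. f t = g t" by blast
  show "(\<lambda>A. AE t in lebesgue. t \<notin> A \<longrightarrow> f t = 0) = (\<lambda>A. AE t in lebesgue. t \<notin> A \<longrightarrow> g t = 0)"
  proof
    fix A
    show "(AE t in lebesgue. t \<notin> A \<longrightarrow> f t = 0) = (AE t in lebesgue. t \<notin> A \<longrightarrow> g t = 0)"
      by (rule eventually_subst) (use ae in \<open>eventually_elim, simp\<close>)
  qed
qed

definition L0_on :: "ennreal \<Rightarrow> L0 set" where
  "L0_on \<gamma> = {x. vanishes_off x (interval_I \<gamma>)}"

lemma interval_I_lebesgue: "interval_I \<gamma> \<in> sets lebesgue"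
proof -
  have "interval_I \<gamma> = {0..} \<inter> (ennreal -` {..<\<gamma>} \<inter> space borel)"
    by (auto simp: interval_I_def)
  also have "\<dots> \<in> sets borel"
    by (intro sets.Int measurable_sets[OF measurable_ennreal]) auto
  finally show ?thesis
    by simp
qed

lift_definition distribution :: "ennreal \<Rightarrow> L0 \<Rightarrow> real \<Rightarrow> ennreal" is
  "\<lambda>\<gamma> f l. emeasure lebesgue {t \<in> interval_I \<gamma>. \<bar>f t\<bar> > l}"
proof -
  fix \<gamma> and f g :: "real \<Rightarrow> real"
  assume *: "f \<in> borel_measurable lebesgue \<and> g \<in> borel_measurable lebesgue \<and>
    (AE t in lebesgue. f t = g t)"
  have meas: "{t \<in> interval_I \<gamma>. \<bar>h t\<bar> > l} \<in> sets lebesgue"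
    if [measurable]: "h \<in> borel_measurable lebesgue" for h :: "real \<Rightarrow> real" and l
  proof -
    have "{t \<in> interval_I \<gamma>. \<bar>h t\<bar> > l} = interval_I \<gamma> \<inter> {t \<in> space lebesgue. \<bar>h t\<bar> > l}"
      by auto
    also have "\<dots> \<in> sets lebesgue"
      by (intro sets.Int interval_I_lebesgue) measurable
    finally show ?thesis .
  qed
  show "(\<lambda>l. emeasure lebesgue {t \<in> interval_I \<gamma>. \<bar>f t\<bar> > l}) =
        (\<lambda>l. emeasure lebesgue {t \<in> interval_I \<gamma>. \<bar>g t\<bar> > l})"
  proof
    fix l
    from * have ae: "AE t in lebesgue. f t = g t" by blast
    show "emeasure lebesgue {t \<in> interval_I \<gamma>. \<bar>f t\<bar> > l} =
        emeasure lebesgue {t \<in> interval_I \<gamma>. \<bar>g t\<bar> > l}"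
    proof (rule emeasure_eq_AE)
      show "AE t in lebesgue. (t \<in> {t \<in> interval_I \<gamma>. \<bar>f t\<bar> > l}) =
          (t \<in> {t \<in> interval_I \<gamma>. \<bar>g t\<bar> > l})"
        using ae by eventually_elim simp
    qed (use * meas in blast)+
  qed
qed

definition rearrangement :: "ennreal \<Rightarrow> L0 \<Rightarrow> real \<Rightarrow> ennreal" where
  "rearrangement \<gamma> x t = Inf {ennreal l | l. 0 \<le> l \<and> distribution \<gamma> x l \<le> ennreal t}"

text \<open>An Orlicz function is only ever evaluated on \<open>[0,\<infinity>)\<close>; its values at negative arguments are
  irrelevant.\<close>

definition orlicz_function :: "(real \<Rightarrow> real) \<Rightarrow> bool" where
  "orlicz_function \<phi> \<longleftrightarrow> convex_on {0..} \<phi> \<and> \<phi> 0 = 0 \<and> (\<forall>u>0. \<phi> u > 0)"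

definition orlicz_N_function :: "(real \<Rightarrow> real) \<Rightarrow> bool" where
  "orlicz_N_function \<phi> \<longleftrightarrow> orlicz_function \<phi> \<and>
     ((\<lambda>u. \<phi> u / u) \<longlongrightarrow> 0) (at_right 0) \<and> filterlim (\<lambda>u. \<phi> u / u) at_top at_top"

definition Delta2 :: "(real \<Rightarrow> real) \<Rightarrow> bool" where
  "Delta2 \<phi> \<longleftrightarrow> (\<exists>K>0. \<forall>u\<ge>0. \<phi> (2 * u) \<le> K * \<phi> u)"

definition Delta2_infinity :: "(real \<Rightarrow> real) \<Rightarrow> bool" where
  "Delta2_infinity \<phi> \<longleftrightarrow> (\<exists>K>0. \<exists>u0\<ge>0. \<forall>u\<ge>u0. \<phi> (2 * u) \<le> K * \<phi> u)"

definition orlicz_ext :: "(real \<Rightarrow> real) \<Rightarrow> ennreal \<Rightarrow> ennreal" where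
  "orlicz_ext \<phi> u = (if u = \<infinity> then \<infinity> else ennreal (\<phi> (enn2real u)))"

definition weight_primitive :: "(real \<Rightarrow> real) \<Rightarrow> ennreal \<Rightarrow> ennreal" where
  "weight_primitive w \<tau> = (\<integral>\<^sup>+ s\<in>interval_I \<tau>. ennreal (w s) \<partial>lebesgue)"

text \<open>Positivity and monotonicity are imposed on the open interval \<open>(0,\<gamma>)\<close>, so that weights
  unbounded near \<open>0\<close>, such as \<open>1 / sqrt t\<close>, are covered (a real value at \<open>0\<close> together with
  monotonicity there would force boundedness). The value at \<open>0\<close> affects no integral.\<close>

definition decreasing_weight :: "ennreal \<Rightarrow> (real \<Rightarrow> real) \<Rightarrow> bool" where
  "decreasing_weight \<gamma> w \<longleftrightarrow>
     (\<forall>t\<in>interval_I \<gamma> - {0}. 0 < w t) \<and>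
     (\<forall>s\<in>interval_I \<gamma> - {0}. \<forall>t\<in>interval_I \<gamma> - {0}. s \<le> t \<longrightarrow> w t \<le> w s) \<and>
     (\<forall>t\<in>interval_I \<gamma>. weight_primitive w (ennreal t) < \<infinity>)"

definition modular :: "ennreal \<Rightarrow> (real \<Rightarrow> real) \<Rightarrow> (real \<Rightarrow> real) \<Rightarrow> L0 \<Rightarrow> ennreal" where
  "modular \<gamma> \<phi> w x =
     (\<integral>\<^sup>+ t\<in>interval_I \<gamma>. orlicz_ext \<phi> (rearrangement \<gamma> x t) * ennreal (w t) \<partial>lebesgue)"

definition orlicz_lorentz :: "ennreal \<Rightarrow> (real \<Rightarrow> real) \<Rightarrow> (real \<Rightarrow> real) \<Rightarrow> L0 set" where
  "orlicz_lorentz \<gamma> \<phi> w = {x \<in> L0_on \<gamma>. \<exists>l>0. modular \<gamma> \<phi> w (l *\<^sub>R x) < \<infinity>}"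

definition luxemburg_norm :: "ennreal \<Rightarrow> (real \<Rightarrow> real) \<Rightarrow> (real \<Rightarrow> real) \<Rightarrow> L0 \<Rightarrow> real" where
  "luxemburg_norm \<gamma> \<phi> w x = Inf {e. 0 < e \<and> modular \<gamma> \<phi> w (x /\<^sub>R e) \<le> 1}"

text \<open>The norm of the Orlicz--Lorentz space depends on term parameters, so the space is not an
  instance of the class \<open>banach\<close>. The notions below are those of Diestel and Uhl, for a linear
  subspace \<open>V\<close> of a real vector space, normed by \<open>N\<close>.\<close>

definition vector_measure ::
  "'v::real_vector set \<Rightarrow> ('v \<Rightarrow> real) \<Rightarrow> 'b measure \<Rightarrow> ('b set \<Rightarrow> 'v) \<Rightarrow> bool" where
  "vector_measure V N M G \<longleftrightarrow>
     (\<forall>E\<in>sets M. G E \<in> V) \<and>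
     (\<forall>A::nat \<Rightarrow> 'b set. range A \<subseteq> sets M \<and> disjoint_family A \<longrightarrow>
        (\<lambda>n. N ((\<Sum>i<n. G (A i)) - G (\<Union>i. A i))) \<longlonglongrightarrow> 0)"

definition continuous_wrt :: "('v \<Rightarrow> real) \<Rightarrow> 'b measure \<Rightarrow> ('b set \<Rightarrow> 'v) \<Rightarrow> bool" where
  "continuous_wrt N M G \<longleftrightarrow>
     (\<forall>e>0. \<exists>d>0. \<forall>E\<in>sets M. measure M E < d \<longrightarrow> N (G E) < e)"

definition bounded_variation :: "('v \<Rightarrow> real) \<Rightarrow> 'b measure \<Rightarrow> ('b set \<Rightarrow> 'v) \<Rightarrow> bool" where
  "bounded_variation N M G \<longleftrightarrow>
     (\<exists>C. \<forall>P. finite P \<and> P \<subseteq> sets M \<and> partition_on (space M) P \<longrightarrow> (\<Sum>E\<in>P. N (G E)) \<le> C)"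

definition simple_into :: "'v set \<Rightarrow> 'b measure \<Rightarrow> ('b \<Rightarrow> 'v) \<Rightarrow> bool" where
  "simple_into V M s \<longleftrightarrow> simple_function M s \<and> s ` space M \<subseteq> V"

definition simple_vector_integral ::
  "'b measure \<Rightarrow> 'b set \<Rightarrow> ('b \<Rightarrow> 'v::real_vector) \<Rightarrow> 'v" where
  "simple_vector_integral M E s = (\<Sum>v\<in>s ` space M. measure M (s -` {v} \<inter> E) *\<^sub>R v)"

definition strongly_measurable ::
  "'v::real_vector set \<Rightarrow> ('v \<Rightarrow> real) \<Rightarrow> 'b measure \<Rightarrow> ('b \<Rightarrow> 'v) \<Rightarrow> bool" where
  "strongly_measurable V N M g \<longleftrightarrow>
     g ` space M \<subseteq> V \<and>
     (\<exists>s. (\<forall>n::nat. simple_into V M (s n)) \<and>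
          (AE \<omega> in M. (\<lambda>n. N (s n \<omega> - g \<omega>)) \<longlonglongrightarrow> 0))"

definition bochner_approximation ::
  "'v::real_vector set \<Rightarrow> ('v \<Rightarrow> real) \<Rightarrow> 'b measure \<Rightarrow> ('b \<Rightarrow> 'v) \<Rightarrow> (nat \<Rightarrow> 'b \<Rightarrow> 'v) \<Rightarrow> bool" where
  "bochner_approximation V N M g s \<longleftrightarrow>
     (\<forall>n. simple_into V M (s n)) \<and>
     (\<lambda>n. \<integral>\<^sup>+ \<omega>. ennreal (N (s n \<omega> - g \<omega>)) \<partial>M) \<longlonglongrightarrow> 0"

definition bochner_integrable ::
  "'v::real_vector set \<Rightarrow> ('v \<Rightarrow> real) \<Rightarrow> 'b measure \<Rightarrow> ('b \<Rightarrow> 'v) \<Rightarrow> bool" where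
  "bochner_integrable V N M g \<longleftrightarrow>
     strongly_measurable V N M g \<and> (\<exists>s. bochner_approximation V N M g s)"

definition has_bochner_integral_on ::
  "'v::real_vector set \<Rightarrow> ('v \<Rightarrow> real) \<Rightarrow> 'b measure \<Rightarrow> ('b \<Rightarrow> 'v) \<Rightarrow> 'b set \<Rightarrow> 'v \<Rightarrow> bool" where
  "has_bochner_integral_on V N M g E v \<longleftrightarrow>
     strongly_measurable V N M g \<and> v \<in> V \<and>
     (\<exists>s. bochner_approximation V N M g s \<and>
          (\<lambda>n. N (simple_vector_integral M E (s n) - v)) \<longlonglongrightarrow> 0)"

text \<open>The property is asserted for all finite measure spaces with points in the type \<open>'b\<close>, since a
  formula cannot quantify over types. It gets stronger as \<open>'b\<close> grows, and for countable \<open>'b\<close> it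
  is trivial for Banach spaces. Once \<open>'b\<close> has at least the cardinality of the continuum it is the
  usual Radon--Nikodym property, because Lebesgue measure on \<open>[0,1]\<close> is then included.\<close>

definition radon_nikodym_property ::
  "'b itself \<Rightarrow> 'v::real_vector set \<Rightarrow> ('v \<Rightarrow> real) \<Rightarrow> bool" where
  "radon_nikodym_property T V N \<longleftrightarrow>
     (\<forall>M::'b measure. finite_measure M \<longrightarrow>
        (\<forall>G. vector_measure V N M G \<and> continuous_wrt N M G \<and> bounded_variation N M G \<longrightarrow>
           (\<exists>g. bochner_integrable V N M g \<and>
                (\<forall>E\<in>sets M. has_bochner_integral_on V N M g E (G E)))))"

end

theory Submission
  imports Defs
begin

text \<open>Since \<open>w\<close> is decreasing, the modular is the Choquet integral of \<open>\<phi> \<circ> \<bar>x\<bar>\<close> with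
  respect to a concave function of Lebesgue measure. This integral is subadditive, because \<open>w\<close> is a
  mixture of indicators of initial intervals and
  \<open>\<integral>\<^sub>0\<^sup>s y\<^sup>* = min\<^sub>c (c s + \<integral> (y - c)\<^sup>+)\<close>.

  Suppose that the doubling condition holds. Then the norm is order continuous. For a vector measure \<open>G\<close> of
  bounded variation consider the averages \<open>G E / \<mu> E\<close> over the members \<open>E\<close> of finite partitions.
  As \<open>\<phi>\<close> is superlinear, they are uniformly integrable over the product of \<open>\<mu>\<close> with a finite
  measure equivalent to Lebesgue measure. A bounded convex energy of the averages increases under
  refinement, so along suitable partitions the averages converge almost everywhere. The limit is a density: by the Fatou property it takes
  values in the space, and by order continuity it is the norm limit of its truncations, which are strongly measurable.

  If the doubling condition fails, there are disjointly supported functions of norm at least \<open>1/2\<close> whose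
  combinations with coefficients bounded by \<open>1\<close> have norm at most \<open>1\<close>. The measure whose \<open>n\<close>-th
  coordinate is \<open>\<integral>\<^sub>E r\<^sub>n\<close> with the Rademacher functions \<open>r\<^sub>n\<close> has no density: on a set where a density is almost
  constant, the sets \<open>{r\<^sub>n = 1}\<close> and \<open>{r\<^sub>n = -1}\<close> are asymptotically of equal measure,
  whereas \<open>G\<close> separates them.\<close>

section \<open>Representatives and layer-cake formulas\<close>

text \<open>The Luxemburg norm is awkward to integrate, so most limits are taken in a weaker norm,
  that of L^1 for a finite measure \<open>eta\<close>; the Luxemburg norm is recovered at the end
  from its lower semicontinuity under almost everywhere convergence. The measure space carrying
  \<open>G\<close> is arbitrary, and no increasing sequence of partitions need generate its sets.
  The partitions are therefore chosen to nearly maximise the energy. This controls all their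
  refinements at once, in particular the one by any given set \<open>E\<close>, and so the limit is
  recognised as a density on every \<open>E\<close>. A plain quadratic energy could be infinite on
  L^1, hence one with linear growth. The divergence of the weight for infinite \<gamma> enters
  through the fact that a finite primitive forces finite measure; dominated convergence for
  distribution functions rests on it. In the converse direction the bound 1/2 is the doubling
  itself: the building blocks have small modular, but modular above 1 once they are multiplied by
  2.\<close>

lemma sigma_finite_lebesgue: "sigma_finite_measure (lebesgue :: real measure)"
proof
  obtain A :: "real set set" where A: "countable A" "A \<subseteq> sets lborel" "\<Union>A = space lborel"
    "\<forall>a\<in>A. emeasure lborel a \<noteq> \<infinity>"
    using lborel.sigma_finite_countable by blast
  have "A \<subseteq> sets lebesgue \<and> \<Union> A = space lebesgue \<and> (\<forall>a\<in>A. emeasure lebesgue a \<noteq> \<infinity>)"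
    using A by (auto simp: subset_eq)
  then show "\<exists>A :: real set set. countable A \<and> A \<subseteq> sets lebesgue \<and> \<Union> A = space lebesgue \<and>
      (\<forall>a\<in>A. emeasure lebesgue a \<noteq> \<infinity>)"
    using A(1) by blast
qed

interpretation lebesgue: sigma_finite_measure "lebesgue :: real measure"
  by (rule sigma_finite_lebesgue)

interpretation lebesgue_lborel: pair_sigma_finite "lebesgue :: real measure" "lborel :: real measure" ..

lemma rep_L0_measurable [measurable]: "rep_L0 x \<in> borel_measurable lebesgue"
  using Quotient_rep_reflp[OF Quotient_L0] by blast

lemma abs_rep_L0 [simp]: "abs_L0 (rep_L0 x) = x"
  by (rule Quotient_abs_rep[OF Quotient_L0])

lemma abs_L0_eq:
  assumes "f \<in> borel_measurable lebesgue" "g \<in> borel_measurable lebesgue" "AE t in lebesgue. f t = g t"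
  shows "abs_L0 f = abs_L0 g"
  using Quotient_rel[OF Quotient_L0, of f g] assms by auto

lemma rep_abs_L0:
  assumes "f \<in> borel_measurable lebesgue"
  shows "AE t in lebesgue. rep_L0 (abs_L0 f) t = f t"
  using Quotient_rep_abs[OF Quotient_L0, of f] assms by auto

lemma L0_eqI:
  assumes "AE t in lebesgue. rep_L0 x t = rep_L0 y t"
  shows "x = y"
  using abs_L0_eq[OF rep_L0_measurable rep_L0_measurable assms] by simp

lemma rep_L0_add: "AE t in lebesgue. rep_L0 (x + y) t = rep_L0 x t + rep_L0 y t"
proof -
  have "x + y = abs_L0 (\<lambda>t. rep_L0 x t + rep_L0 y t)"
    using plus_L0.abs_eq[of "rep_L0 x" "rep_L0 y"] by simp
  then show ?thesis
    using rep_abs_L0[of "\<lambda>t. rep_L0 x t + rep_L0 y t"] by simp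
qed

lemma rep_L0_diff: "AE t in lebesgue. rep_L0 (x - y) t = rep_L0 x t - rep_L0 y t"
proof -
  have "x - y = abs_L0 (\<lambda>t. rep_L0 x t - rep_L0 y t)"
    using minus_L0.abs_eq[of "rep_L0 x" "rep_L0 y"] by simp
  then show ?thesis
    using rep_abs_L0[of "\<lambda>t. rep_L0 x t - rep_L0 y t"] by simp
qed

lemma rep_L0_scaleR: "AE t in lebesgue. rep_L0 (c *\<^sub>R x) t = c * rep_L0 x t"
proof -
  have "c *\<^sub>R x = abs_L0 (\<lambda>t. c * rep_L0 x t)"
    using scaleR_L0.abs_eq[of "rep_L0 x" c] by simp
  then show ?thesis
    using rep_abs_L0[of "\<lambda>t. c * rep_L0 x t"] by simp
qed

lemma rep_L0_zero: "AE t in lebesgue. rep_L0 0 t = 0"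
proof -
  have "0 = abs_L0 (\<lambda>t. 0)"
    by (simp add: zero_L0_def)
  then show ?thesis
    using rep_abs_L0[of "\<lambda>t. 0"] by simp
qed

lemma distribution_rep: "distribution \<gamma> x l = emeasure lebesgue {t \<in> interval_I \<gamma>. l < \<bar>rep_L0 x t\<bar>}"
  using distribution.abs_eq[of "rep_L0 x" \<gamma>] by simp

lemma L0_on_iff: "x \<in> L0_on \<gamma> \<longleftrightarrow> (AE t in lebesgue. t \<notin> interval_I \<gamma> \<longrightarrow> rep_L0 x t = 0)"
  using vanishes_off.abs_eq[of "rep_L0 x"] by (simp add: L0_on_def)

lemma emeasure_interval_below:
  fixes a :: ennreal
  shows "emeasure lebesgue {t::real. 0 \<le> t \<and> ennreal t < a} = a"
proof (cases a)
  case (real r)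
  then have "{t::real. 0 \<le> t \<and> ennreal t < a} = {0..<r}"
    by (auto simp: ennreal_less_iff)
  then show ?thesis using real by simp
next
  case top
  then have "{t::real. 0 \<le> t \<and> ennreal t < a} = {0..}" by auto
  moreover have "emeasure lebesgue {0::real..} = top"
  proof (rule ccontr)
    assume "emeasure lebesgue {0::real..} \<noteq> top"
    then obtain r where r: "emeasure lebesgue {0::real..} = ennreal r" "0 \<le> r"
      by (cases "emeasure lebesgue {0::real..}") auto
    have "emeasure lebesgue {0..r + 1} \<le> emeasure lebesgue {0::real..}"
      by (intro emeasure_mono) auto
    with r show False by (simp add: ennreal_le_iff)
  qed
  ultimately show ?thesis using top by simp
qed

text \<open>An extended value written as the length of the set of levels below it; integrating this
  identity in another variable gives the layer-cake formula, also when the value is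
  infinite.\<close>

lemma nn_integral_indicator_interval_below:
  fixes a :: ennreal
  shows "(\<integral>\<^sup>+ u. indicator {u. ennreal u < a} u * indicator {0..} u \<partial>lborel) = a"
proof -
  have "(\<integral>\<^sup>+ u. indicator {u. ennreal u < a} u * indicator {0..} u \<partial>lborel)
      = (\<integral>\<^sup>+ u. indicator {u::real. 0 \<le> u \<and> ennreal u < a} u \<partial>lborel)"
    by (intro nn_integral_cong) (auto simp: indicator_def)
  also have "\<dots> = emeasure lborel {u::real. 0 \<le> u \<and> ennreal u < a}"
    by (intro nn_integral_indicator) measurable
  also have "\<dots> = emeasure lebesgue {u::real. 0 \<le> u \<and> ennreal u < a}"
    by (simp add: emeasure_completion)
  finally show ?thesis by (simp add: emeasure_interval_below)
qed

text \<open>Tonelli for the region below the graph of \<open>y\<close>. The kernel \<open>k\<close>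
  will be an indicator, a product of indicators or an exponential density. Levels live in
  \<open>lborel\<close> and points in \<open>lebesgue\<close>, because \<open>y\<close> is only
  Lebesgue measurable.\<close>

lemma layer_cake:
  fixes k y :: "real \<Rightarrow> ennreal"
  assumes [measurable]: "k \<in> borel_measurable lebesgue" "y \<in> borel_measurable lebesgue"
  shows "(\<integral>\<^sup>+ t. k t * y t \<partial>lebesgue) =
    (\<integral>\<^sup>+ u. (\<integral>\<^sup>+ t. k t * indicator {t. ennreal u < y t} t \<partial>lebesgue) * indicator {0..} u \<partial>lborel)"
proof -
  have "(\<integral>\<^sup>+ t. k t * y t \<partial>lebesgue) =
      (\<integral>\<^sup>+ t. (\<integral>\<^sup>+ u. k t * (indicator {u. ennreal u < y t} u * indicator {0..} u) \<partial>lborel) \<partial>lebesgue)"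
    by (subst nn_integral_cmult) (simp_all add: nn_integral_indicator_interval_below)
  also have "\<dots> = (\<integral>\<^sup>+ u. (\<integral>\<^sup>+ t. k t * (indicator {u. ennreal u < y t} u * indicator {0..} u) \<partial>lebesgue) \<partial>lborel)"
    by (rule lebesgue_lborel.Fubini'[symmetric]) measurable
  also have "\<dots> = (\<integral>\<^sup>+ u. (\<integral>\<^sup>+ t. (k t * indicator {t. ennreal u < y t} t) * indicator {0..} u \<partial>lebesgue) \<partial>lborel)"
    by (intro nn_integral_cong) (auto simp: indicator_def)
  also have "\<dots> = (\<integral>\<^sup>+ u. (\<integral>\<^sup>+ t. k t * indicator {t. ennreal u < y t} t \<partial>lebesgue) * indicator {0..} u \<partial>lborel)"
    by (intro nn_integral_cong nn_integral_multc) measurable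
  finally show ?thesis .
qed

lemma ennreal_lebesgue_measurable [measurable]: "(\<lambda>t. ennreal t) \<in> borel_measurable lebesgue"
  by (rule measurable_completion) simp

section \<open>The Choquet integral of a decreasing weight\<close>

locale lorentz_weight =
  fixes \<gamma> :: ennreal and w :: "real \<Rightarrow> real"
  assumes gamma_pos: "0 < \<gamma>"
    and weight: "decreasing_weight \<gamma> w"
    and weight_infinity: "\<gamma> = \<infinity> \<Longrightarrow> weight_primitive w \<infinity> = \<infinity>"
begin

abbreviation I :: "real set" where "I \<equiv> interval_I \<gamma>"

lemma I_measurable [measurable]: "I \<in> sets lebesgue"
  by (rule interval_I_lebesgue)

lemma emeasure_I: "emeasure lebesgue I = \<gamma>"
  by (simp add: interval_I_def emeasure_interval_below)

text \<open>A monotone function on a Borel set is Borel. The weight is monotone on the open interval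
  only, so the point 0 is put back as a separate summand, and the factor \<open>indicator I\<close>
  discards the arbitrary values elsewhere.\<close>

lemma weight_measurable: "(\<lambda>t. ennreal (w t) * indicator I t) \<in> borel_measurable lebesgue"
proof -
  have "mono_on (I - {0}) (\<lambda>t. - w t)"
    using weight by (auto simp: decreasing_weight_def mono_on_def)
  then have m: "(\<lambda>t. - w t) \<in> borel_measurable (restrict_space borel (I - {0}))"
    by (rule borel_measurable_mono_on_fnc)
  have I: "I \<in> sets borel"
  proof -
    have "I = {0..} \<inter> (ennreal -` {..<\<gamma>} \<inter> space borel)"
      by (auto simp: interval_I_def)
    also have "\<dots> \<in> sets borel"
      by (intro sets.Int measurable_sets[OF measurable_ennreal]) auto
    finally show ?thesis .
  qed
  have "(\<lambda>t. indicator (I - {0}) t *\<^sub>R (- w t)) \<in> borel_measurable borel"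
    using m I by (subst (asm) borel_measurable_restrict_space_iff) auto
  moreover define f where "f = (\<lambda>t. indicator (I - {0}) t *\<^sub>R (- w t))"
  ultimately have [measurable]: "f \<in> borel_measurable borel" by simp
  have [measurable]: "{0} \<inter> I \<in> sets borel" using I by auto
  have "(\<lambda>t. ennreal (- f t) + ennreal (w 0) * indicator ({0} \<inter> I) t) \<in> borel_measurable lborel"
    by measurable
  then have "(\<lambda>t. ennreal (- f t) + ennreal (w 0) * indicator ({0} \<inter> I) t) \<in> borel_measurable lebesgue"
    by (rule measurable_completion)
  also have "(\<lambda>t. ennreal (- f t) + ennreal (w 0) * indicator ({0} \<inter> I) t)
      = (\<lambda>t. ennreal (w t) * indicator I t)"
    by (auto simp: indicator_def fun_eq_iff f_def)
  finally show ?thesis .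
qed

section \<open>Distribution functions, the primitive of the weight and the Choquet integral\<close>

definition wI :: "real \<Rightarrow> ennreal" where
  "wI t = ennreal (w t) * indicator I t"

lemma wI_measurable [measurable]: "wI \<in> borel_measurable lebesgue"
  unfolding wI_def[abs_def] by (rule weight_measurable)

definition superlevel :: "(real \<Rightarrow> ennreal) \<Rightarrow> real \<Rightarrow> ennreal" where
  "superlevel y u = emeasure lebesgue {t \<in> I. ennreal u < y t}"

definition Wt :: "ennreal \<Rightarrow> ennreal" where
  "Wt s = (\<integral>\<^sup>+ t. wI t * indicator {t. ennreal t < s} t \<partial>lebesgue)"

text \<open>The integral of the decreasing rearrangement of \<open>y\<close> against
  \<open>w\<close>, rewritten by the layer-cake formula: \<open>superlevel y\<close> is the
  distribution function of \<open>y\<close>, and \<open>Wt\<close> is the primitive of the weight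
  with extended arguments. In this form no rearrangement occurs, and limits can be taken level by
  level.\<close>

definition choquet :: "(real \<Rightarrow> ennreal) \<Rightarrow> ennreal" where
  "choquet y = (\<integral>\<^sup>+ u. Wt (superlevel y u) * indicator {0..} u \<partial>lborel)"

lemma Wt_mono: "s \<le> t \<Longrightarrow> Wt s \<le> Wt t"
  unfolding Wt_def by (intro nn_integral_mono) (auto simp: indicator_def)

lemma Wt_measurable [measurable]: "Wt \<in> borel_measurable borel"
proof -
  show ?thesis unfolding Wt_def[abs_def] by measurable
qed

lemma superlevel_eq_nn_integral:
  assumes [measurable]: "y \<in> borel_measurable lebesgue"
  shows "superlevel y u = (\<integral>\<^sup>+ t. indicator I t * indicator {t. ennreal u < y t} t \<partial>lebesgue)"
proof -
  have "{t \<in> I. ennreal u < y t} = I \<inter> {t \<in> space lebesgue. ennreal u < y t}" by auto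
  also have "\<dots> \<in> sets lebesgue" by measurable
  finally have "superlevel y u = (\<integral>\<^sup>+ t. indicator {t \<in> I. ennreal u < y t} t \<partial>lebesgue)"
    by (simp add: superlevel_def)
  then show ?thesis by (auto simp: indicator_def intro!: nn_integral_cong)
qed

lemma superlevel_measurable [measurable]:
  assumes [measurable]: "y \<in> borel_measurable lebesgue"
  shows "superlevel y \<in> borel_measurable borel"
proof -
  have "superlevel y = (\<lambda>u. \<integral>\<^sup>+ t. indicator I t * indicator {t. ennreal u < y t} t \<partial>lebesgue)"
    by (simp add: fun_eq_iff superlevel_eq_nn_integral)
  also have "\<dots> \<in> borel_measurable borel" by measurable
  finally show ?thesis .
qed

lemma level_set [measurable]:
  "y \<in> borel_measurable lebesgue \<Longrightarrow> {t \<in> I. (a::ennreal) < y t} \<in> sets lebesgue"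
proof -
  assume [measurable]: "y \<in> borel_measurable lebesgue"
  have "{t \<in> I. a < y t} = I \<inter> {t \<in> space lebesgue. a < y t}" by auto
  also have "\<dots> \<in> sets lebesgue" by measurable
  finally show ?thesis .
qed

lemma superlevel_le_gamma: "superlevel y u \<le> \<gamma>"
proof -
  have "superlevel y u \<le> emeasure lebesgue I"
    unfolding superlevel_def by (intro emeasure_mono) auto
  then show ?thesis by (simp only: emeasure_I)
qed

lemma superlevel_mono_AE:
  assumes "y \<in> borel_measurable lebesgue" "z \<in> borel_measurable lebesgue"
    and "AE t in lebesgue. t \<in> I \<longrightarrow> y t \<le> z t"
  shows "superlevel y u \<le> superlevel z u"
  unfolding superlevel_def
proof (intro emeasure_mono_AE level_set assms(2))
  show "AE t in lebesgue. t \<in> {t \<in> I. ennreal u < y t} \<longrightarrow> t \<in> {t \<in> I. ennreal u < z t}"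
    using assms(3) by eventually_elim (auto intro: less_le_trans)
qed

lemma choquet_mono_AE:
  assumes "y \<in> borel_measurable lebesgue" "z \<in> borel_measurable lebesgue"
    and "AE t in lebesgue. t \<in> I \<longrightarrow> y t \<le> z t"
  shows "choquet y \<le> choquet z"
  unfolding choquet_def
  by (intro nn_integral_mono mult_right_mono Wt_mono superlevel_mono_AE assms) auto

text \<open>The strict inequality \<open>ennreal t < s\<close> makes the domain of integration for a
  supremum the union of the domains, so monotone convergence applies.\<close>

lemma Wt_SUP:
  assumes "incseq s"
  shows "Wt (SUP n. s n) = (SUP n. Wt (s n))"
proof -
  have "Wt (SUP n. s n) = (\<integral>\<^sup>+ t. (SUP n. wI t * indicator {t. ennreal t < s n} t) \<partial>lebesgue)"
    unfolding Wt_def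
  proof (intro nn_integral_cong)
    fix t :: real
    show "wI t * indicator {t. ennreal t < (SUP n. s n)} t = (SUP n. wI t * indicator {t. ennreal t < s n} t)"
    proof (cases "ennreal t < (SUP n. s n)")
      case True
      then obtain n where "ennreal t < s n" by (auto simp: less_SUP_iff)
      then have "wI t \<le> (SUP n. wI t * indicator {t. ennreal t < s n} t)"
        by (intro SUP_upper2[of n]) auto
      then show ?thesis using True
        by (auto intro!: antisym SUP_least simp: indicator_def)
    next
      case False
      then have "\<not> ennreal t < s n" for n by (auto simp: less_SUP_iff)
      then show ?thesis using False by simp
    qed
  qed
  also have "\<dots> = (SUP n. Wt (s n))"
    unfolding Wt_def
    by (intro nn_integral_monotone_convergence_SUP)
       (auto simp: incseq_def le_fun_def indicator_def intro: less_le_trans dest: incseqD[OF assms])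
  finally show ?thesis .
qed

text \<open>Strict superlevel sets of a supremum are unions. Three passages to the supremum then
  follow one another: in the measure of the level sets, in \<open>Wt\<close>, and in the integral
  over levels.\<close>

lemma choquet_SUP:
  assumes [measurable]: "\<And>n. y n \<in> borel_measurable lebesgue" and inc: "incseq y"
  shows "choquet (\<lambda>t. SUP n. y n t) = (SUP n. choquet (y n))"
proof -
  have superlevel: "superlevel (\<lambda>t. SUP n. y n t) u = (SUP n. superlevel (y n) u)" for u
  proof -
    have "{t \<in> I. ennreal u < (SUP n. y n t)} = (\<Union>n. {t \<in> I. ennreal u < y n t})"
      by (auto simp: less_SUP_iff)
    moreover have "incseq (\<lambda>n. {t \<in> I. ennreal u < y n t})"
      using inc by (fastforce simp: incseq_def le_fun_def intro: less_le_trans)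
    ultimately show ?thesis
      unfolding superlevel_def by (subst SUP_emeasure_incseq) (auto intro: level_set)
  qed
  have inclv: "incseq (\<lambda>n. superlevel (y n) u)" for u
    using inc unfolding incseq_def le_fun_def by (auto intro!: superlevel_mono_AE)
  have "choquet (\<lambda>t. SUP n. y n t) = (\<integral>\<^sup>+ u. (SUP n. Wt (superlevel (y n) u) * indicator {0..} u) \<partial>lborel)"
    unfolding choquet_def superlevel
    by (subst Wt_SUP[OF inclv]) (simp add: SUP_mult_right_ennreal)
  also have "\<dots> = (SUP n. choquet (y n))"
    unfolding choquet_def
    by (intro nn_integral_monotone_convergence_SUP)
       (auto simp: incseq_def le_fun_def intro!: mult_right_mono Wt_mono incseqD[OF inclv])
  finally show ?thesis .
qed

section \<open>The weight as a mixture of cut-offs, and subadditivity\<close>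

definition sv :: "real \<Rightarrow> ennreal" where
  "sv v = superlevel wI v"

text \<open>Since \<open>w\<close> is decreasing, the set where it exceeds \<open>v\<close> is, up
  to the point 0, an initial interval of length \<open>sv v\<close>. Two initial intervals are
  nested, so their intersection has the smaller length.\<close>

lemma emeasure_superlevel_weight:
  assumes "s \<le> \<gamma>" "0 \<le> v"
  shows "(\<integral>\<^sup>+ t. indicator I t * indicator {t. ennreal t < s} t * indicator {t. ennreal v < wI t} t \<partial>lebesgue)
    = min (sv v) s"
proof -
  define S where "S = {t \<in> I. ennreal v < wI t}"
  have S[measurable]: "S \<in> sets lebesgue" unfolding S_def by measurable
  have mD: "{t. 0 \<le> t \<and> ennreal t < s} \<in> sets lebesgue" using interval_I_lebesgue[of s] by (simp add: interval_I_def)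
  have sv: "sv v = emeasure lebesgue S" by (simp add: sv_def superlevel_def S_def)
  have D: "emeasure lebesgue {t. 0 \<le> t \<and> ennreal t < s} = s"
    by (rule emeasure_interval_below)
  have SD: "S \<inter> {t. 0 \<le> t \<and> ennreal t < s} \<in> sets lebesgue"
    using S mD by auto
  have "(\<integral>\<^sup>+ t. indicator I t * indicator {t. ennreal t < s} t * indicator {t. ennreal v < wI t} t \<partial>lebesgue)
      = (\<integral>\<^sup>+ t. indicator (S \<inter> {t. 0 \<le> t \<and> ennreal t < s}) t \<partial>lebesgue)"
    by (intro nn_integral_cong) (auto simp: indicator_def S_def interval_I_def)
  also have "\<dots> = emeasure lebesgue (S \<inter> {t. 0 \<le> t \<and> ennreal t < s})"
    using SD by simp
  \<comment> \<open>Either \<open>S\<close> contains the whole open interval from 0 to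
    \<open>s\<close>, or it misses a point \<open>t0\<close> of it and by monotonicity lies below
    \<open>t0\<close>.\<close>
  also have "\<dots> = min (sv v) s"
  proof (cases "\<forall>t. 0 < t \<and> ennreal t < s \<longrightarrow> t \<in> S")
    case True
    have nS: "AE t in lebesgue. t \<noteq> (0::real)"
      by (rule AE_completion) (rule AE_lborel_singleton)
    have "emeasure lebesgue (S \<inter> {t. 0 \<le> t \<and> ennreal t < s}) = emeasure lebesgue {t. 0 \<le> t \<and> ennreal t < s}"
    proof (intro emeasure_eq_AE SD mD)
      show "AE t in lebesgue. t \<in> S \<inter> {t. 0 \<le> t \<and> ennreal t < s} \<longleftrightarrow> t \<in> {t. 0 \<le> t \<and> ennreal t < s}"
        using nS by eventually_elim (use True in auto)
    qed
    moreover have "emeasure lebesgue (S \<inter> {t. 0 \<le> t \<and> ennreal t < s}) \<le> emeasure lebesgue S"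
      by (intro emeasure_mono S) auto
    ultimately show ?thesis by (simp add: sv D min_absorb2)
  next
    case False
    then obtain t0 where t0: "0 < t0" "ennreal t0 < s" "t0 \<notin> S" by auto
    have t0I: "t0 \<in> I" using t0 assms by (auto simp: interval_I_def)
    have below: "t < t0" if "t \<in> S" for t
    proof (rule ccontr)
      assume "\<not> t < t0"
      then have "w t \<le> w t0" using that t0I t0(1) weight by (auto simp: decreasing_weight_def S_def)
      then have "wI t \<le> wI t0" using that t0I by (auto simp: wI_def S_def intro: ennreal_leI)
      then show False using that t0(3) t0I by (auto simp: S_def)
    qed
    have "S \<subseteq> {t. 0 \<le> t \<and> ennreal t < s}"
    proof safe
      fix t assume "t \<in> S"
      with below have "t \<le> t0" by (simp add: less_imp_le)
      then show "ennreal t < s" using t0(2) by (meson ennreal_leI le_less_trans)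
      show "0 \<le> t" using \<open>t \<in> S\<close> by (simp add: S_def interval_I_def)
    qed
    then have "S \<inter> {t. 0 \<le> t \<and> ennreal t < s} = S" by auto
    moreover have "emeasure lebesgue S \<le> emeasure lebesgue {t. 0 \<le> t \<and> ennreal t < s}"
      using \<open>S \<subseteq> _\<close> by (intro emeasure_mono mD)
    ultimately show ?thesis by (simp add: sv D min_absorb1)
  qed
  finally show ?thesis .
qed

lemma sv_measurable [measurable]: "sv \<in> borel_measurable borel"
proof -
  have "sv = superlevel wI" by (simp add: sv_def fun_eq_iff)
  then show ?thesis using superlevel_measurable[OF wI_measurable] by simp
qed

text \<open>Layer-cake formula in the values of \<open>w\<close>. It displays the primitive as a
  mixture of the concave functions \<open>min c\<close>; concavity of the primitive is used in this
  form only.\<close>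

lemma Wt_eq_min:
  assumes "s \<le> \<gamma>"
  shows "Wt s = (\<integral>\<^sup>+ v. min (sv v) s * indicator {0..} v \<partial>lborel)"
proof -
  have "Wt s = (\<integral>\<^sup>+ t. (indicator I t * indicator {t. ennreal t < s} t) * wI t \<partial>lebesgue)"
    unfolding Wt_def by (intro nn_integral_cong) (auto simp: indicator_def wI_def)
  also have "\<dots> = (\<integral>\<^sup>+ v. (\<integral>\<^sup>+ t. indicator I t * indicator {t. ennreal t < s} t *
      indicator {t. ennreal v < wI t} t \<partial>lebesgue) * indicator {0..} v \<partial>lborel)"
    by (intro layer_cake) measurable
  also have "\<dots> = (\<integral>\<^sup>+ v. min (sv v) s * indicator {0..} v \<partial>lborel)"
    using emeasure_superlevel_weight[OF assms] by (intro nn_integral_cong) (auto simp: indicator_def)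
  finally show ?thesis .
qed

text \<open>The integral of the decreasing rearrangement of \<open>y\<close> over
  \<open>[0,s]\<close>, that is, the K-functional of \<open>y\<close> between L^1 and L^\<infinity>
  at \<open>s\<close>.\<close>

definition cutint :: "ennreal \<Rightarrow> (real \<Rightarrow> ennreal) \<Rightarrow> ennreal" where
  "cutint s y = (\<integral>\<^sup>+ u. min s (superlevel y u) * indicator {0..} u \<partial>lborel)"

text \<open>Exchanging the levels of \<open>y\<close> with the levels of \<open>w\<close> reduces
  subadditivity of the Choquet integral to that of \<open>cutint s\<close> for one fixed
  \<open>s\<close>.\<close>

lemma choquet_eq_cutint:
  assumes [measurable]: "y \<in> borel_measurable lebesgue"
  shows "choquet y = (\<integral>\<^sup>+ v. cutint (sv v) y * indicator {0..} v \<partial>lborel)"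
proof -
  have "choquet y = (\<integral>\<^sup>+ u. (\<integral>\<^sup>+ v. min (sv v) (superlevel y u) * indicator {0..} v * indicator {0..} u \<partial>lborel) \<partial>lborel)"
    unfolding choquet_def
    by (subst Wt_eq_min[OF superlevel_le_gamma]) (simp add: nn_integral_multc)
  also have "\<dots> = (\<integral>\<^sup>+ v. (\<integral>\<^sup>+ u. min (sv v) (superlevel y u) * indicator {0..} v * indicator {0..} u \<partial>lborel) \<partial>lborel)"
    by (rule lborel_pair.Fubini') measurable
  also have "\<dots> = (\<integral>\<^sup>+ v. (\<integral>\<^sup>+ u. (min (sv v) (superlevel y u) * indicator {0..} u) * indicator {0..} v \<partial>lborel) \<partial>lborel)"
    by (simp add: mult_ac)
  also have "\<dots> = (\<integral>\<^sup>+ v. cutint (sv v) y * indicator {0..} v \<partial>lborel)"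
    unfolding cutint_def by (intro nn_integral_cong nn_integral_multc) measurable
  finally show ?thesis .
qed

text \<open>Subtraction in \<open>ennreal\<close> is truncated at 0, so this is the layer-cake
  formula for a positive part, with the levels shifted by \<open>c\<close>.\<close>

lemma nn_integral_excess:
  assumes [measurable]: "y \<in> borel_measurable lebesgue" and c: "0 \<le> c"
  shows "(\<integral>\<^sup>+ t. indicator I t * (y t - ennreal c) \<partial>lebesgue) = (\<integral>\<^sup>+ u. superlevel y u * indicator {c..} u \<partial>lborel)"
proof -
  have "(\<integral>\<^sup>+ t. indicator I t * (y t - ennreal c) \<partial>lebesgue) =
      (\<integral>\<^sup>+ u. (\<integral>\<^sup>+ t. indicator I t * indicator {t. ennreal u < y t - ennreal c} t \<partial>lebesgue) * indicator {0..} u \<partial>lborel)"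
    by (rule layer_cake[where k = "indicator I" and y = "\<lambda>t. y t - ennreal c"]) measurable
  also have "\<dots> = (\<integral>\<^sup>+ u. superlevel y (c + 1 * u) * indicator {c..} (c + 1 * u) \<partial>lborel)"
  proof (intro nn_integral_cong)
    fix u :: real
    show "(\<integral>\<^sup>+ t. indicator I t * indicator {t. ennreal u < y t - ennreal c} t \<partial>lebesgue) * indicator {0..} u
      = superlevel y (c + 1 * u) * indicator {c..} (c + 1 * u)"
    proof (cases "0 \<le> u")
      case True
      then have "ennreal u < y t - ennreal c \<longleftrightarrow> ennreal (c + u) < y t" for t
        using c by (simp add: less_diff_eq_ennreal add.commute)
      then show ?thesis using True
        by (simp add: superlevel_eq_nn_integral)
    qed simp
  qed
  also have "\<dots> = (\<integral>\<^sup>+ u. superlevel y u * indicator {c..} u \<partial>lborel)"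
    by (subst nn_integral_real_affine[where c=1 and t=c]) auto
  finally show ?thesis .
qed

lemma cutint_le:
  assumes [measurable]: "y \<in> borel_measurable lebesgue" and c: "0 \<le> c"
  shows "cutint s y \<le> ennreal c * s + (\<integral>\<^sup>+ t. indicator I t * (y t - ennreal c) \<partial>lebesgue)"
proof -
  have "cutint s y \<le> (\<integral>\<^sup>+ u. s * indicator {0..<c} u + superlevel y u * indicator {c..} u \<partial>lborel)"
    unfolding cutint_def by (intro nn_integral_mono) (auto simp: indicator_def)
  also have "\<dots> = ennreal c * s + (\<integral>\<^sup>+ u. superlevel y u * indicator {c..} u \<partial>lborel)"
    using c by (subst nn_integral_add) (auto simp: nn_integral_cmult mult.commute)
  finally show ?thesis using c by (simp add: nn_integral_excess)
qed

text \<open>The bound of \<open>cutint_le\<close> is sharp when \<open>c\<close> is the level at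
  which the distribution function falls to \<open>s\<close>: below it the minimum equals
  \<open>s\<close>, above it the distribution function, and \<open>c\<close> itself is a null set.
  The hypothesis on \<open>u0\<close> says that there is such a level.\<close>

lemma cutint_attained:
  assumes [measurable]: "y \<in> borel_measurable lebesgue" and "0 \<le> u0" "superlevel y u0 \<le> s"
  obtains c where "0 \<le> c"
    "cutint s y = ennreal c * s + (\<integral>\<^sup>+ t. indicator I t * (y t - ennreal c) \<partial>lebesgue)"
proof -
  define U where "U = {u. 0 \<le> u \<and> superlevel y u \<le> s}"
  define c where "c = Inf U"
  have U: "u0 \<in> U" "bdd_below U" using assms by (auto simp: U_def)
  have c0: "0 \<le> c" unfolding c_def using U by (intro cInf_greatest) (auto simp: U_def)
  have below: "s \<le> superlevel y u" if "0 \<le> u" "u < c" for u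
    using cInf_lower[OF _ U(2), of u] that by (fastforce simp: U_def c_def)
  have above: "superlevel y u \<le> s" if "c < u" for u
  proof -
    have "\<exists>u'\<in>U. u' < u"
      using that U(1) by (intro cInf_lessD) (auto simp: c_def)
    then obtain u' where "u' \<in> U" "u' < u" by blast
    have "superlevel y u \<le> superlevel y u'"
      unfolding superlevel_def using \<open>u' < u\<close>
      by (intro emeasure_mono level_set) (auto intro: le_less_trans[OF ennreal_leI[of u' u]])
    then show ?thesis
      using \<open>u' \<in> U\<close> by (auto simp: U_def)
  qed
  have ne: "AE u in lborel. u \<noteq> c" by (rule AE_lborel_singleton)
  have "cutint s y = (\<integral>\<^sup>+ u. s * indicator {0..<c} u + superlevel y u * indicator {c..} u \<partial>lborel)"
    unfolding cutint_def
  proof (intro nn_integral_cong_AE)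
    show "AE u in lborel. min s (superlevel y u) * indicator {0..} u = s * indicator {0..<c} u + superlevel y u * indicator {c..} u"
      using ne
    proof eventually_elim
      case (elim u)
      then show ?case
        using c0 below[of u] above[of u] by (cases "u < c") (auto simp: indicator_def min_absorb1 min_absorb2)
    qed
  qed
  also have "\<dots> = ennreal c * s + (\<integral>\<^sup>+ u. superlevel y u * indicator {c..} u \<partial>lborel)"
    using c0 by (subst nn_integral_add) (auto simp: nn_integral_cmult mult.commute)
  finally show ?thesis using c0 that[of c] by (simp add: nn_integral_excess)
qed

text \<open>Optimal levels \<open>c\<close> and \<open>d\<close> for the summands give the
  admissible level \<open>c + d\<close> for the sum, and the positive part of a sum is at most the
  sum of the positive parts. If one distribution function never falls to \<open>s > 0\<close>, its
  \<open>cutint\<close> is infinite.\<close>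

lemma cutint_add_le:
  assumes [measurable]: "y \<in> borel_measurable lebesgue" "z \<in> borel_measurable lebesgue"
  shows "cutint s (\<lambda>t. y t + z t) \<le> cutint s y + cutint s z"
proof -
  have top: "cutint s x = \<infinity>" if "\<nexists>u. 0 \<le> u \<and> superlevel x u \<le> s" "s > 0" for x
  proof -
    have "cutint s x = (\<integral>\<^sup>+ u. s * indicator {0..} u \<partial>(lborel :: real measure))"
      unfolding cutint_def using that(1) by (intro nn_integral_cong) (auto simp: indicator_def min_def dest: less_imp_le simp flip: not_le)
    also have "\<dots> = s * (\<integral>\<^sup>+ u. indicator {u. ennreal u < \<infinity>} u * indicator {0..} u \<partial>lborel)"
      by (subst nn_integral_cmult[symmetric]) auto
    also have "\<dots> = \<infinity>"
      unfolding nn_integral_indicator_interval_below using that(2) by (simp add: ennreal_mult_top)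
    finally show ?thesis .
  qed
  show ?thesis
  proof (cases "s = 0")
    case True then show ?thesis by (simp add: cutint_def)
  next
    case False
    then have s: "s > 0" by (simp add: zero_less_iff_neq_zero)
    show ?thesis
    proof (cases "(\<exists>u. 0 \<le> u \<and> superlevel y u \<le> s) \<and> (\<exists>u. 0 \<le> u \<and> superlevel z u \<le> s)")
      case True
      then obtain u v where uv: "0 \<le> u" "superlevel y u \<le> s" "0 \<le> v" "superlevel z v \<le> s" by blast
      obtain c where c: "0 \<le> c"
        "cutint s y = ennreal c * s + (\<integral>\<^sup>+ t. indicator I t * (y t - ennreal c) \<partial>lebesgue)"
        by (rule cutint_attained[OF assms(1) uv(1,2)])
      obtain d where d: "0 \<le> d"
        "cutint s z = ennreal d * s + (\<integral>\<^sup>+ t. indicator I t * (z t - ennreal d) \<partial>lebesgue)"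
        by (rule cutint_attained[OF assms(2) uv(3,4)])
      have "cutint s (\<lambda>t. y t + z t) \<le> ennreal (c + d) * s + (\<integral>\<^sup>+ t. indicator I t * ((y t + z t) - ennreal (c + d)) \<partial>lebesgue)"
        using c d by (intro cutint_le) auto
      also have "(\<integral>\<^sup>+ t. indicator I t * ((y t + z t) - ennreal (c + d)) \<partial>lebesgue)
         \<le> (\<integral>\<^sup>+ t. indicator I t * (y t - ennreal c) + indicator I t * (z t - ennreal d) \<partial>lebesgue)"
      proof (intro nn_integral_mono)
        fix t
        have "(y t + z t) - ennreal (c + d) \<le> (y t - ennreal c) + (z t - ennreal d)"
        proof -
          have "y t \<le> ennreal c + (y t - ennreal c)" "z t \<le> ennreal d + (z t - ennreal d)"
            using ennreal_minus_le_iff by blast+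
          then have "y t + z t \<le> ennreal (c + d) + ((y t - ennreal c) + (z t - ennreal d))"
            using c d add_mono by (fastforce simp: ac_simps)
          then show ?thesis
            by (subst ennreal_minus_le_iff) auto
        qed
        then show "indicator I t * ((y t + z t) - ennreal (c + d))
          \<le> indicator I t * (y t - ennreal c) + indicator I t * (z t - ennreal d)"
          by (auto simp: indicator_def)
      qed
      also have "\<dots> = (\<integral>\<^sup>+ t. indicator I t * (y t - ennreal c) \<partial>lebesgue) + (\<integral>\<^sup>+ t. indicator I t * (z t - ennreal d) \<partial>lebesgue)"
        by (intro nn_integral_add) measurable
      finally show ?thesis using c d by (simp add: ring_distribs ac_simps add_left_mono)
    next
      case False
      then show ?thesis using top[of y] top[of z] s by auto
    qed
  qed
qed

lemma choquet_add_le: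
  assumes [measurable]: "y \<in> borel_measurable lebesgue" "z \<in> borel_measurable lebesgue"
  shows "choquet (\<lambda>t. y t + z t) \<le> choquet y + choquet z"
proof -
  have [measurable]: "(\<lambda>v. cutint (sv v) x) \<in> borel_measurable borel"
    if [measurable]: "x \<in> borel_measurable lebesgue" for x
    unfolding cutint_def by measurable
  have "choquet (\<lambda>t. y t + z t) \<le> (\<integral>\<^sup>+ v. cutint (sv v) y * indicator {0..} v + cutint (sv v) z * indicator {0..} v \<partial>lborel)"
    by (subst choquet_eq_cutint) (auto intro!: nn_integral_mono simp: indicator_def cutint_add_le)
  also have "\<dots> = choquet y + choquet z"
    by (subst nn_integral_add) (auto simp: choquet_eq_cutint)
  finally show ?thesis .
qed

lemma choquet_cmult:
  assumes [measurable]: "y \<in> borel_measurable lebesgue" and c: "0 < c"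
  shows "choquet (\<lambda>t. ennreal c * y t) = ennreal c * choquet y"
proof -
  have superlevel: "superlevel (\<lambda>t. ennreal c * y t) u = superlevel y (u / c)" if "0 \<le> u" for u
  proof -
    have "ennreal u < ennreal c * y t \<longleftrightarrow> ennreal (u / c) < y t" for t
    proof (cases "y t")
      case (real r)
      then show ?thesis using c that
        by (simp add: ennreal_mult[symmetric] ennreal_less_iff field_simps)
    qed (use c that in \<open>auto simp: ennreal_mult_top\<close>)
    then show ?thesis by (simp add: superlevel_def)
  qed
  have "choquet (\<lambda>t. ennreal c * y t) = (\<integral>\<^sup>+ u. Wt (superlevel y (u / c)) * indicator {0..} u \<partial>lborel)"
    unfolding choquet_def by (intro nn_integral_cong) (auto simp: indicator_def superlevel)
  also have "\<dots> = ennreal \<bar>c\<bar> * (\<integral>\<^sup>+ u. Wt (superlevel y ((0 + c * u) / c)) * indicator {0..} (0 + c * u) \<partial>lborel)"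
    using c by (intro nn_integral_real_affine) auto
  also have "\<dots> = ennreal c * choquet y"
    using c by (auto simp: choquet_def indicator_def zero_le_mult_iff intro!: arg_cong2[where f="(*)"] nn_integral_cong)
  finally show ?thesis .
qed

section \<open>Size of the primitive, and convergence theorems for the Choquet integral\<close>

lemma emeasure_interval_I: "emeasure lebesgue (interval_I s) = s"
  by (simp only: interval_I_def emeasure_interval_below)

lemma Wt_zero [simp]: "Wt 0 = 0"
  by (simp add: Wt_def)

lemma AE_nonzero: "AE t in lebesgue. t \<noteq> (0::real)"
  by (rule AE_completion) (rule AE_lborel_singleton)

lemma choquet_indicator:
  assumes [measurable]: "S \<in> sets lebesgue"
  shows "choquet (\<lambda>t. c * indicator S t) = c * Wt (emeasure lebesgue (I \<inter> S))"
proof -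
  have superlevel: "superlevel (\<lambda>t. c * indicator S t) u = (if ennreal u < c then emeasure lebesgue (I \<inter> S) else 0)" for u
  proof -
    have "{t \<in> I. ennreal u < c * indicator S t} = (if ennreal u < c then I \<inter> S else {})"
      by (auto simp: indicator_def)
    then show ?thesis by (simp add: superlevel_def)
  qed
  have "choquet (\<lambda>t. c * indicator S t) = (\<integral>\<^sup>+ u. Wt (emeasure lebesgue (I \<inter> S)) *
      (indicator {u. ennreal u < c} u * indicator {0..} u) \<partial>lborel)"
    unfolding choquet_def superlevel by (intro nn_integral_cong) (auto simp del: emeasure_completion)
  also have "\<dots> = Wt (emeasure lebesgue (I \<inter> S)) * c"
    by (subst nn_integral_cmult) (auto simp: nn_integral_indicator_interval_below)
  finally show ?thesis by (simp add: mult.commute)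
qed

text \<open>The weight is compared with its value at such a point: it is at least
  \<open>w t0\<close> before \<open>t0\<close> and at most \<open>w t0\<close> after it.\<close>

lemma small_point: obtains t0 where "t0 \<in> I" "0 < t0" "t0 \<le> 1"
proof (cases \<gamma>)
  case (real r)
  with gamma_pos have "0 < r" by auto
  then show ?thesis
    using real that[of "min 1 (r/2)"] by (auto simp: interval_I_def ennreal_less_iff min_def)
next
  case top
  then show ?thesis using that[of 1] by (auto simp: interval_I_def)
qed

lemma weight_pos: "t \<in> I \<Longrightarrow> 0 < t \<Longrightarrow> 0 < w t"
  using weight by (auto simp: decreasing_weight_def)

lemma weight_mono: "s \<in> I \<Longrightarrow> t \<in> I \<Longrightarrow> 0 < s \<Longrightarrow> s \<le> t \<Longrightarrow> w t \<le> w s"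
  using weight by (auto simp: decreasing_weight_def)

text \<open>Local integrability is given only up to points below \<gamma>. Past \<open>t0\<close>
  the weight is bounded by \<open>w t0\<close>, which also covers \<open>s = \<gamma>\<close> when
  \<gamma> is finite.\<close>

lemma Wt_finite: "s < \<infinity> \<Longrightarrow> Wt s < \<infinity>"
proof -
  assume s: "s < \<infinity>"
  obtain t0 where t0: "t0 \<in> I" "0 < t0" by (rule small_point)
  have [measurable]: "interval_I s \<in> sets lebesgue" by (rule interval_I_lebesgue)
  have below: "Wt (ennreal t0) < \<infinity>"
  proof -
    have "Wt (ennreal t0) = weight_primitive w (ennreal t0)"
      unfolding Wt_def weight_primitive_def using t0
      by (intro nn_integral_cong)
         (auto simp: wI_def indicator_def interval_I_def intro: less_trans)
    also have "\<dots> < \<infinity>" using weight t0 by (auto simp: decreasing_weight_def)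
    finally show ?thesis .
  qed
  have "Wt s \<le> (\<integral>\<^sup>+ t. wI t * indicator {t. ennreal t < ennreal t0} t + ennreal (w t0) * indicator (interval_I s) t \<partial>lebesgue)"
    unfolding Wt_def
  proof (intro nn_integral_mono)
    fix t
    show "wI t * indicator {t. ennreal t < s} t
      \<le> wI t * indicator {t. ennreal t < ennreal t0} t + ennreal (w t0) * indicator (interval_I s) t"
    proof (cases "t \<in> I \<and> ennreal t < s \<and> \<not> ennreal t < ennreal t0")
      case True
      then have "0 \<le> t" by (auto simp: interval_I_def)
      with True have "t0 \<le> t" by (auto simp: ennreal_less_iff)
      then have "w t \<le> w t0" using True t0 by (intro weight_mono) auto
      then show ?thesis using True by (auto simp: wI_def interval_I_def intro: ennreal_leI)
    qed (auto simp: wI_def indicator_def)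
  qed
  also have "\<dots> = Wt (ennreal t0) + ennreal (w t0) * s"
    by (subst nn_integral_add)
       (auto simp: Wt_def nn_integral_cmult emeasure_interval_I simp del: emeasure_completion)
  also have "\<dots> < \<infinity>"
    using below s by (auto simp: ennreal_mult_less_top)
  finally show ?thesis .
qed

text \<open>Up to \<open>t0\<close> the weight is at least \<open>w t0\<close>, so the primitive at
  \<open>s\<close> is at least \<open>w t0 * min t0 s\<close>. This is what makes the Choquet
  integral dominate an L^1 norm for a finite measure.\<close>

lemma Wt_lower:
  obtains C where "0 < C" "\<And>s. s \<le> \<gamma> \<Longrightarrow> min 1 s \<le> ennreal C * Wt s"
proof -
  obtain t0 where t0: "t0 \<in> I" "0 < t0" "t0 \<le> 1" by (rule small_point)
  have w0: "0 < w t0" using t0 by (intro weight_pos)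
  have "min 1 s \<le> ennreal (1 / (w t0 * t0)) * Wt s" if s: "s \<le> \<gamma>" for s
  proof -
    define J where "J = interval_I (min (ennreal t0) s)"
    have J: "J \<in> sets lebesgue" unfolding J_def by (rule interval_I_lebesgue)
    have "ennreal (w t0) * min (ennreal t0) s = (\<integral>\<^sup>+ t. ennreal (w t0) * indicator J t \<partial>lebesgue)"
      using J by (subst nn_integral_cmult) (simp_all add: emeasure_interval_I J_def del: emeasure_completion)
    also have "\<dots> \<le> Wt s"
      unfolding Wt_def
    proof (rule nn_integral_mono_AE)
      show "AE t in lebesgue. ennreal (w t0) * indicator J t \<le> wI t * indicator {t. ennreal t < s} t"
        using AE_nonzero
      proof eventually_elim
        case (elim t)
        show ?case
        proof (cases "t \<in> J")
          case True
          then have t: "0 < t" "ennreal t < ennreal t0" "ennreal t < s"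
            using elim by (auto simp: J_def interval_I_def)
          then have "t \<in> I" "t \<le> t0"
            using s by (auto simp: interval_I_def ennreal_less_iff intro: less_le_trans)
          then show ?thesis using t weight_mono[of t t0] t0 True by (auto simp: wI_def intro: ennreal_leI)
        qed simp
      qed
    qed
    finally have *: "ennreal (w t0) * min (ennreal t0) s \<le> Wt s" .
    \<comment> \<open>The case \<open>s < 1\<close> uses \<open>t0 \<le> 1\<close>.\<close>
    have "ennreal t0 * min 1 s \<le> min (ennreal t0) s"
    proof (cases s)
      case (real r)
      then have "t0 * min 1 r \<le> min t0 r" using t0
        by (auto simp: min_def mult_left_le_one_le) 
      then show ?thesis using real t0
        by (auto simp: min_def ennreal_mult[symmetric] ennreal_le_iff split: if_splits simp flip: ennreal_1)
    qed (simp add: min_def)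
    then have "ennreal (w t0) * (ennreal t0 * min 1 s) \<le> Wt s"
      using * by (meson mult_left_mono order_trans zero_le)
    then have "ennreal (1 / (w t0 * t0)) * (ennreal (w t0) * (ennreal t0 * min 1 s)) \<le> ennreal (1 / (w t0 * t0)) * Wt s"
      by (rule mult_left_mono) simp
    moreover have "ennreal (1 / (w t0 * t0)) * (ennreal (w t0) * (ennreal t0 * min 1 s)) = min 1 s"
      using t0 w0 by (simp add: mult.assoc[symmetric] ennreal_mult[symmetric])
    ultimately show ?thesis by simp
  qed
  moreover have "0 < 1 / (w t0 * t0)" using w0 t0 by simp
  ultimately show ?thesis using that by blast
qed

text \<open>Absolute continuity of the integral; the common finite bound \<open>b\<close> supplies
  the integrable majorant.\<close>

lemma Wt_tendsto_0:
  assumes s: "s \<longlonglongrightarrow> 0" and bound: "\<And>n::nat. s n \<le> b" "b < \<infinity>"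
  shows "(\<lambda>n. Wt (s n)) \<longlonglongrightarrow> 0"
proof -
  have "(\<lambda>n. Wt (s n)) \<longlonglongrightarrow> (\<integral>\<^sup>+ (t::real). 0 \<partial>lebesgue)"
    unfolding Wt_def
  proof (rule nn_integral_dominated_convergence[where w = "\<lambda>t. wI t * indicator {t. ennreal t < b} t"])
    show "AE t in lebesgue. wI t * indicator {t. ennreal t < s j} t \<le> wI t * indicator {t. ennreal t < b} t" for j
      using bound(1)[of j] by (intro AE_I2) (auto simp: indicator_def)
    show "(\<integral>\<^sup>+ t. wI t * indicator {t. ennreal t < b} t \<partial>lebesgue) < \<infinity>"
      using Wt_finite[OF bound(2)] by (simp add: Wt_def)
    show "AE t in lebesgue. (\<lambda>i. wI t * indicator {t. ennreal t < s i} t) \<longlonglongrightarrow> 0"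
      using AE_nonzero
    proof eventually_elim
      case (elim t)
      show ?case
      proof (cases "t \<in> I")
        case True
        then have "0 < ennreal t" using elim by (simp add: interval_I_def)
        then have "\<forall>\<^sub>F i in sequentially. s i < ennreal t" using s by (simp add: order_tendstoD)
        then have "\<forall>\<^sub>F i in sequentially. wI t * indicator {t. ennreal t < s i} t = 0"
          by eventually_elim (auto simp: indicator_def)
        then show ?thesis by (rule tendsto_eventually)
      qed (simp add: wI_def)
    qed
  qed measurable
  then show ?thesis by simp
qed

text \<open>Only \<open>s = \<gamma> = \<infinity>\<close> has to be excluded, and there the
  primitive diverges by \<open>weight_infinity\<close>. The lemma turns finiteness of a Choquet
  integral into finite measure of superlevel sets.\<close>

lemma Wt_infinite_imp: "s \<le> \<gamma> \<Longrightarrow> Wt s < \<infinity> \<Longrightarrow> s < \<infinity>"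
proof (rule ccontr)
  assume s: "s \<le> \<gamma>" "Wt s < \<infinity>" "\<not> s < \<infinity>"
  then have "s = \<infinity>" by (simp add: less_top[symmetric])
  with s have "\<gamma> = \<infinity>" by (simp add: top_unique)
  note \<open>s = \<infinity>\<close> this
  moreover have "Wt \<infinity> = weight_primitive w \<gamma>"
    unfolding Wt_def weight_primitive_def
    by (intro nn_integral_cong) (auto simp: wI_def indicator_def interval_I_def)
  ultimately show False using s(2) weight_infinity by simp
qed

text \<open>Dominated convergence is applied twice. At a level \<open>u > 0\<close> the superlevel
  sets shrink to a null set inside that of \<open>z\<close>, which has finite measure for almost
  every \<open>u\<close> because its primitive is finite there. Then the integrals over levels
  converge under the majorant coming from \<open>z\<close>.\<close>

lemma choquet_dominated_convergence:
  assumes [measurable]: "\<And>n::nat. y n \<in> borel_measurable lebesgue" "z \<in> borel_measurable lebesgue"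
    and fin: "choquet z < \<infinity>"
    and le: "\<And>n. AE t in lebesgue. t \<in> I \<longrightarrow> y n t \<le> z t"
    and lim: "AE t in lebesgue. t \<in> I \<longrightarrow> (\<lambda>n. y n t) \<longlonglongrightarrow> 0"
  shows "(\<lambda>n. choquet (y n)) \<longlonglongrightarrow> 0"
proof -
  have lvlim: "(\<lambda>n. superlevel (y n) u) \<longlonglongrightarrow> 0" if u: "0 < u" and f: "superlevel z u < \<infinity>" for u
  proof -
    have "(\<lambda>n. superlevel (y n) u) \<longlonglongrightarrow> (\<integral>\<^sup>+ (t::real). 0 \<partial>lebesgue)"
      unfolding superlevel_eq_nn_integral[OF assms(1)]
    proof (rule nn_integral_dominated_convergence[where w = "\<lambda>t. indicator I t * indicator {t. ennreal u < z t} t"])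
      show "AE t in lebesgue. indicator I t * indicator {t. ennreal u < y j t} t
          \<le> (indicator I t * indicator {t. ennreal u < z t} t :: ennreal)" for j
        using le[of j] by eventually_elim (auto simp: indicator_def dest: less_le_trans)
      show "(\<integral>\<^sup>+ t. indicator I t * indicator {t. ennreal u < z t} t \<partial>lebesgue) < \<infinity>"
        using f by (simp add: superlevel_eq_nn_integral)
      show "AE t in lebesgue. (\<lambda>i. indicator I t * indicator {t. ennreal u < y i t} t) \<longlonglongrightarrow> (0::ennreal)"
        using lim
      proof eventually_elim
        case (elim t)
        show ?case
        proof (cases "t \<in> I")
          case True
          with elim u have "\<forall>\<^sub>F i in sequentially. y i t < ennreal u" by (simp add: order_tendstoD)
          then have "\<forall>\<^sub>F i in sequentially. indicator I t * indicator {t. ennreal u < y i t} t = (0::ennreal)"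
            by eventually_elim (auto simp: indicator_def)
          then show ?thesis by (rule tendsto_eventually)
        qed simp
      qed
    qed measurable
    then show ?thesis by simp
  qed
  have lvle: "superlevel (y n) u \<le> superlevel z u" for n u
    using le by (intro superlevel_mono_AE) auto
  have finite: "AE u in lborel. Wt (superlevel z u) * indicator {0..} u \<noteq> \<infinity>"
    using fin unfolding choquet_def by (intro nn_integral_noteq_infinite) auto
  have "(\<lambda>n. choquet (y n)) \<longlonglongrightarrow> (\<integral>\<^sup>+ (u::real). 0 \<partial>lborel)"
    unfolding choquet_def
  proof (rule nn_integral_dominated_convergence[where w = "\<lambda>u. Wt (superlevel z u) * indicator {0..} u"])
    show "AE u in lborel. Wt (superlevel (y j) u) * indicator {0..} u \<le> Wt (superlevel z u) * indicator {0..} u" for j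
      by (intro AE_I2 mult_right_mono Wt_mono lvle) auto
    show "(\<integral>\<^sup>+ u. Wt (superlevel z u) * indicator {0..} u \<partial>lborel) < \<infinity>"
      using fin by (simp add: choquet_def)
    show "AE u in lborel. (\<lambda>i. Wt (superlevel (y i) u) * indicator {0..} u) \<longlonglongrightarrow> 0"
      using finite AE_lborel_singleton[of 0]
    proof eventually_elim
      case (elim u)
      show ?case
      proof (cases "0 < u")
        case True
        then have "Wt (superlevel z u) < \<infinity>" using elim by (simp add: less_top)
        then have f: "superlevel z u < \<infinity>" by (rule Wt_infinite_imp[OF superlevel_le_gamma])
        have "(\<lambda>i. Wt (superlevel (y i) u)) \<longlonglongrightarrow> 0"
          by (rule Wt_tendsto_0[OF lvlim[OF True f] lvle f])
        then show ?thesis using True by simp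
      qed (use elim in auto)
    qed
  qed measurable
  then show ?thesis by simp
qed

text \<open>Fatou's lemma: the tail infima increase to the lower limit, and
  \<open>choquet_SUP\<close> applies to them.\<close>

lemma choquet_liminf:
  assumes [measurable]: "\<And>n::nat. y n \<in> borel_measurable lebesgue"
  shows "choquet (\<lambda>t. liminf (\<lambda>n. y n t)) \<le> liminf (\<lambda>n. choquet (y n))"
proof -
  have "choquet (\<lambda>t. liminf (\<lambda>n. y n t)) = (SUP n. choquet (\<lambda>t. INF m\<in>{n..}. y m t))"
    unfolding liminf_SUP_INF
    by (rule choquet_SUP) (auto simp: incseq_def le_fun_def intro!: INF_superset_mono)
  also have "\<dots> \<le> (SUP n. INF m\<in>{n..}. choquet (y m))"
    by (intro SUP_mono' INF_greatest choquet_mono_AE) (auto intro!: AE_I2 INF_lower)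
  finally show ?thesis by (simp add: liminf_SUP_INF)
qed

section \<open>A finite measure dominated by the Choquet integral\<close>

definition eta :: "real measure" where
  "eta = density lebesgue (\<lambda>t. ennreal (exp (- t)) * indicator I t)"

lemma exp_measurable [measurable]: "(\<lambda>t. ennreal (exp (- t))) \<in> borel_measurable lebesgue"
  by (rule measurable_completion) simp

lemma sets_eta [measurable_cong, simp]: "sets eta = sets lebesgue"
  by (simp add: eta_def)

lemma space_eta [simp]: "space eta = UNIV"
  by (simp add: eta_def)

lemma AE_eta: "(AE t in eta. P t) \<longleftrightarrow> (AE t in lebesgue. t \<in> I \<longrightarrow> P t)"
  unfolding eta_def by (subst AE_density) (auto simp: indicator_def)

text \<open>The density is at most 1 and has integral at most 1. These are exactly the two bounds
  that \<open>Wt_lower\<close> can absorb.\<close>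

lemma emeasure_eta_le:
  assumes [measurable]: "S \<in> sets lebesgue"
  shows "emeasure eta S \<le> min 1 (emeasure lebesgue (I \<inter> S))"
proof -
  have e: "emeasure eta S = (\<integral>\<^sup>+ t. ennreal (exp (- t)) * indicator I t * indicator S t \<partial>lebesgue)"
    unfolding eta_def by (subst emeasure_density) auto
  have "emeasure eta S \<le> (\<integral>\<^sup>+ t. ennreal (exp (- t)) * indicator {0..} t \<partial>lebesgue)"
    unfolding e by (intro nn_integral_mono) (auto simp: indicator_def interval_I_def)
  also have "\<dots> = (\<integral>\<^sup>+ t. ennreal (exp (- t)) * indicator {0..} t \<partial>lborel)"
    by (rule nn_integral_completion) 
  also have "\<dots> = ennreal (0 - - exp (- 0))"
  proof (rule nn_integral_FTC_atLeast)
    show "((\<lambda>t::real. - exp (- t)) \<longlongrightarrow> 0) at_top"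
      using tendsto_minus[OF filterlim_compose[OF exp_at_bot filterlim_uminus_at_bot_at_top]] by simp
  qed (auto intro!: derivative_eq_intros)
  finally have 1: "emeasure eta S \<le> 1" by simp
  have "emeasure eta S \<le> (\<integral>\<^sup>+ t. indicator (I \<inter> S) t \<partial>lebesgue)"
    unfolding e by (intro nn_integral_mono) (auto simp: indicator_def interval_I_def ennreal_le_1)
  then show ?thesis using 1 by simp
qed

lemma finite_measure_eta: "finite_measure eta"
proof
  show "emeasure eta (space eta) \<noteq> \<infinity>"
    using emeasure_eta_le[of UNIV] by (auto simp: min_def top_unique split: if_splits)
qed

text \<open>The comparison is made level by level: the \<open>eta\<close>-measure of a superlevel
  set is at most the minimum of 1 and its length, hence at most a multiple of the primitive.\<close>

lemma nn_integral_eta_le_choquet: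
  obtains C where "0 < C" "\<And>y. y \<in> borel_measurable lebesgue \<Longrightarrow> (\<integral>\<^sup>+ t. y t \<partial>eta) \<le> ennreal C * choquet y"
proof -
  obtain C where C: "0 < C" "\<And>s. s \<le> \<gamma> \<Longrightarrow> min 1 s \<le> ennreal C * Wt s"
    by (rule Wt_lower) blast
  have "(\<integral>\<^sup>+ t. y t \<partial>eta) \<le> ennreal C * choquet y" if [measurable]: "y \<in> borel_measurable lebesgue" for y
  proof -
    have S: "{t. ennreal u < y t} \<in> sets lebesgue" for u
    proof -
      have "{t \<in> space lebesgue. ennreal u < y t} \<in> sets lebesgue" by measurable
      then show ?thesis by simp
    qed
    have "(\<integral>\<^sup>+ t. y t \<partial>eta) = (\<integral>\<^sup>+ t. (ennreal (exp (- t)) * indicator I t) * y t \<partial>lebesgue)"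
      unfolding eta_def by (subst nn_integral_density) auto
    also have "\<dots> = (\<integral>\<^sup>+ u. (\<integral>\<^sup>+ t. ennreal (exp (- t)) * indicator I t * indicator {t. ennreal u < y t} t \<partial>lebesgue)
        * indicator {0..} u \<partial>lborel)"
      by (rule layer_cake) measurable
    also have "\<dots> = (\<integral>\<^sup>+ u. emeasure eta {t. ennreal u < y t} * indicator {0..} u \<partial>lborel)"
      using S by (intro nn_integral_cong) (simp add: eta_def emeasure_density)
    also have "\<dots> \<le> (\<integral>\<^sup>+ u. ennreal C * (Wt (superlevel y u) * indicator {0..} u) \<partial>lborel)"
    proof (intro nn_integral_mono)
      fix u
      have "emeasure eta {t. ennreal u < y t} \<le> min 1 (superlevel y u)"
        using emeasure_eta_le[OF S] by (simp add: superlevel_def Int_def)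
      also have "\<dots> \<le> ennreal C * Wt (superlevel y u)"
        by (intro C superlevel_le_gamma)
      finally show "emeasure eta {t. ennreal u < y t} * indicator {0..} u
          \<le> ennreal C * (Wt (superlevel y u) * indicator {0..} u)"
        by (auto simp: indicator_def)
    qed
    also have "\<dots> = ennreal C * choquet y"
      unfolding choquet_def by (intro nn_integral_cmult) measurable
    finally show ?thesis .
  qed
  with C(1) show ?thesis using that by blast
qed

end

section \<open>The modular and the Luxemburg norm\<close>

locale orlicz_lorentz_space = lorentz_weight +
  fixes \<phi> :: "real \<Rightarrow> real"
  assumes N_function: "orlicz_N_function \<phi>"
begin

section \<open>Elementary properties of the Orlicz function\<close>

lemma phi_convex: "convex_on {0..} \<phi>" and phi_0 [simp]: "\<phi> 0 = 0"
  and phi_pos: "0 < u \<Longrightarrow> 0 < \<phi> u"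
  using N_function by (auto simp: orlicz_N_function_def orlicz_function_def)

lemma phi_nonneg [simp]: "0 \<le> u \<Longrightarrow> 0 \<le> \<phi> u"
  using phi_pos[of u] by (cases "u = 0") auto

lemma phi_contract: "0 \<le> c \<Longrightarrow> c \<le> 1 \<Longrightarrow> 0 \<le> u \<Longrightarrow> \<phi> (c * u) \<le> c * \<phi> u"
  using convex_onD[OF phi_convex, of c 0 u] by simp

lemma phi_strict_mono:
  assumes "0 \<le> u" "u < v" shows "\<phi> u < \<phi> v"
proof -
  have "\<phi> u \<le> u / v * \<phi> v"
    using phi_contract[of "u / v" v] assms by simp
  also have "\<dots> < 1 * \<phi> v"
    using assms phi_pos[of v] by (intro mult_strict_right_mono) auto
  finally show ?thesis by simp
qed

lemma phi_mono: "0 \<le> u \<Longrightarrow> u \<le> v \<Longrightarrow> \<phi> u \<le> \<phi> v"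
  using phi_strict_mono[of u v] by (cases "u = v") auto

lemma phi_less_iff: "0 \<le> u \<Longrightarrow> 0 \<le> v \<Longrightarrow> \<phi> u < \<phi> v \<longleftrightarrow> u < v"
  using phi_strict_mono[of u v] phi_mono[of v u] by (cases "u < v") auto

text \<open>Inside the half-line convexity gives continuity; at 0 the function is squeezed between 0
  and the chord \<open>u * \<phi> 1\<close>.\<close>

lemma phi_continuous: "continuous_on {0..} \<phi>"
proof -
  have "continuous_on {0<..} \<phi>"
    by (rule convex_on_continuous) (auto intro: convex_on_subset[OF phi_convex])
  then have pos: "isCont \<phi> u" if "0 < u" for u
    using that by (simp add: continuous_on_eq_continuous_at)
  have "(\<phi> \<longlongrightarrow> 0) (at_right 0)"
  proof (rule tendsto_sandwich)
    show "\<forall>\<^sub>F u in at_right (0::real). 0 \<le> \<phi> u"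
      by (auto simp: eventually_at_filter)
    show "\<forall>\<^sub>F u in at_right (0::real). \<phi> u \<le> u * \<phi> 1"
      using eventually_at_right_real[of 0 1] phi_contract[of _ 1] by (auto elim!: eventually_mono)
    show "((\<lambda>u. u * \<phi> 1) \<longlongrightarrow> 0) (at_right 0)"
      by (auto intro!: tendsto_eq_intros)
  qed auto
  then have zero: "continuous (at 0 within {0..}) \<phi>"
    by (simp add: continuous_within at_within_Ici_at_right)
  show ?thesis
    unfolding continuous_on_eq_continuous_within
  proof
    fix u :: real assume "u \<in> {0..}"
    then show "continuous (at u within {0..}) \<phi>"
      using pos[of u] zero by (cases "u = 0") (auto intro: continuous_at_imp_continuous_at_within)
  qed
qed

lemma phi_abs_continuous: "continuous_on UNIV (\<lambda>u. \<phi> \<bar>u\<bar>)"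
  by (rule continuous_on_compose2[OF phi_continuous]) (auto intro!: continuous_intros)

lemma phi_abs_measurable [measurable]: "(\<lambda>u. \<phi> \<bar>u\<bar>) \<in> borel_measurable borel"
  by (rule borel_measurable_continuous_onI[OF phi_abs_continuous])

text \<open>The divergence of \<open>\<phi> u / u\<close> in the form of de la Vallee Poussin's
  criterion: beyond \<open>l\<close> the identity is at most \<open>e * \<phi>\<close>.\<close>

lemma phi_superlinear:
  assumes "0 < e"
  obtains l where "0 \<le> l" "\<And>u. 0 \<le> u \<Longrightarrow> u \<le> l + e * \<phi> u"
proof -
  have "\<forall>\<^sub>F u in at_top. 1 / e \<le> \<phi> u / u"
    using N_function by (auto simp: orlicz_N_function_def filterlim_at_top)
  then obtain l where l: "\<And>u. l \<le> u \<Longrightarrow> 1 / e \<le> \<phi> u / u"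
    by (auto simp: eventually_at_top_linorder)
  have "u \<le> max 1 l + e * \<phi> u" if "0 \<le> u" for u
  proof (cases "u \<le> max 1 l")
    case True
    then show ?thesis using that assms by (simp add: add_increasing2)
  next
    case False
    then have "1 / e \<le> \<phi> u / u" "0 < u" by (auto intro: l)
    then have "u \<le> e * \<phi> u" using assms by (simp add: field_simps)
    then show ?thesis by simp
  qed
  then show ?thesis using that[of "max 1 l"] by simp
qed

text \<open>Intermediate values on \<open>[0, l + u]\<close>, where superlinearity with constant 1
  gives \<open>u \<le> \<phi> (l + u)\<close>. Every level of \<open>phi_of x\<close> can thus be
  written as \<open>\<phi> v\<close>.\<close>

lemma phi_surj:
  assumes "0 \<le> u" obtains v where "0 \<le> v" "\<phi> v = u"
proof -
  obtain l where l: "0 \<le> l" "\<And>u. 0 \<le> u \<Longrightarrow> u \<le> l + 1 * \<phi> u"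
    using phi_superlinear[of 1] by auto
  have "\<exists>v\<ge>0. v \<le> l + u \<and> \<phi> v = u"
    using assms l l(2)[of "l + u"]
    by (intro IVT') (auto intro: continuous_on_subset[OF phi_continuous])
  then show ?thesis using that by blast
qed

section \<open>The modular as a Choquet integral\<close>

definition phi_of :: "L0 \<Rightarrow> real \<Rightarrow> ennreal" where
  "phi_of x t = ennreal (\<phi> \<bar>rep_L0 x t\<bar>)"

lemma phi_of_measurable [measurable]: "phi_of x \<in> borel_measurable lebesgue"
  unfolding phi_of_def by measurable

lemma distribution_level: "{t \<in> I. l < \<bar>rep_L0 x t\<bar>} \<in> sets lebesgue"
proof -
  have "{t \<in> I. l < \<bar>rep_L0 x t\<bar>} = I \<inter> {t \<in> space lebesgue. l < \<bar>rep_L0 x t\<bar>}" by auto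
  also have "\<dots> \<in> sets lebesgue" by measurable
  finally show ?thesis .
qed

text \<open>The rearrangement is the generalised inverse of the distribution function. From right to
  left this needs right-continuity of the latter: if it exceeds \<open>t\<close> at
  \<open>l\<close>, it still does at some \<open>l + inverse (real (Suc n))\<close>, and this number
  bounds the infimum from below.\<close>

lemma less_rearrangement_iff:
  assumes "0 \<le> l" "0 \<le> t"
  shows "ennreal l < rearrangement \<gamma> x t \<longleftrightarrow> ennreal t < distribution \<gamma> x l"
proof
  assume "ennreal l < rearrangement \<gamma> x t"
  show "ennreal t < distribution \<gamma> x l"
  proof (rule ccontr)
    assume "\<not> ennreal t < distribution \<gamma> x l"
    then have "rearrangement \<gamma> x t \<le> ennreal l"
      unfolding rearrangement_def using assms by (intro Inf_lower) (auto simp: not_less)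
    with \<open>ennreal l < rearrangement \<gamma> x t\<close> show False by simp
  qed
next
  assume t: "ennreal t < distribution \<gamma> x l"
  define A where "A n = {t \<in> I. l + inverse (real (Suc n)) < \<bar>rep_L0 x t\<bar>}" for n
  have Am: "A n \<in> sets lebesgue" for n
    unfolding A_def by (rule distribution_level)
  have inc: "incseq A"
    unfolding incseq_def A_def
    by (auto intro: le_less_trans[rotated] simp: frac_le)
  have "{t \<in> I. l < \<bar>rep_L0 x t\<bar>} = (\<Union>n. A n)"
  proof (intro equalityI subsetI)
    fix s assume "s \<in> {t \<in> I. l < \<bar>rep_L0 x t\<bar>}"
    then have s: "s \<in> I" "0 < \<bar>rep_L0 x s\<bar> - l" by auto
    then obtain n where "inverse (real (Suc n)) < \<bar>rep_L0 x s\<bar> - l"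
      using reals_Archimedean by blast
    then show "s \<in> (\<Union>n. A n)" using s by (auto simp: A_def intro!: exI[of _ n])
  qed (auto simp: A_def intro: less_trans[rotated])
  then have "distribution \<gamma> x l = (SUP n. emeasure lebesgue (A n))"
    using SUP_emeasure_incseq[of A lebesgue] Am inc by (simp add: distribution_rep image_subset_iff)
  then obtain n where n: "ennreal t < emeasure lebesgue (A n)"
    using t by (auto simp: less_SUP_iff)
  have "ennreal (l + inverse (real (Suc n))) \<le> rearrangement \<gamma> x t"
    unfolding rearrangement_def
  proof (intro Inf_greatest, clarify)
    fix m assume m: "0 \<le> m" "distribution \<gamma> x m \<le> ennreal t"
    show "ennreal (l + inverse (real (Suc n))) \<le> ennreal m"
    proof (rule ccontr)
      assume "\<not> ennreal (l + inverse (real (Suc n))) \<le> ennreal m"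
      then have "m < l + inverse (real (Suc n))" using m(1) by (meson ennreal_leI not_le)
      then have "emeasure lebesgue (A n) \<le> distribution \<gamma> x m"
        unfolding distribution_rep A_def
        by (intro emeasure_mono distribution_level) auto
      with n m show False by simp
    qed
  qed
  moreover have "ennreal l < ennreal (l + inverse (real (Suc n)))"
    using assms by (intro ennreal_lessI) (auto intro: add_nonneg_pos)
  ultimately show "ennreal l < rearrangement \<gamma> x t" by (rule less_le_trans[rotated])
qed

text \<open>The set of \<open>t\<close> at which \<open>\<phi>\<close> of the rearrangement exceeds
  \<open>u\<close> is the initial interval of length \<open>superlevel (phi_of x) u\<close>. Layer
  cake in the values and an exchange of integrals turn the integral over \<open>t\<close> into one
  over levels.\<close>

lemma modular_eq_choquet: "modular \<gamma> \<phi> w x = choquet (phi_of x)"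
proof -
  have ext: "ennreal u < orlicz_ext \<phi> (rearrangement \<gamma> x t) \<longleftrightarrow> ennreal t < superlevel (phi_of x) u"
    if "0 \<le> u" "0 \<le> t" for u t
  proof -
    obtain v where v: "0 \<le> v" "\<phi> v = u" by (rule phi_surj[OF \<open>0 \<le> u\<close>])
    have "ennreal u < orlicz_ext \<phi> a \<longleftrightarrow> ennreal v < a" for a
    proof (cases a)
      case (real r)
      then show ?thesis using v by (auto simp: orlicz_ext_def ennreal_less_iff phi_less_iff)
    qed (simp add: orlicz_ext_def)
    moreover have "distribution \<gamma> x v = superlevel (phi_of x) u"
      using v by (auto simp: distribution_rep superlevel_def phi_of_def ennreal_less_iff phi_less_iff)
    ultimately show ?thesis using less_rearrangement_iff[OF v(1) that(2)] by simp
  qed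
  have "modular \<gamma> \<phi> w x = (\<integral>\<^sup>+ t. (\<integral>\<^sup>+ u. wI t * (indicator {t. ennreal t < superlevel (phi_of x) u} t * indicator {0..} u) \<partial>lborel) \<partial>lebesgue)"
    unfolding modular_def
  proof (intro nn_integral_cong)
    fix t
    show "orlicz_ext \<phi> (rearrangement \<gamma> x t) * ennreal (w t) * indicator I t =
      (\<integral>\<^sup>+ u. wI t * (indicator {t. ennreal t < superlevel (phi_of x) u} t * indicator {0..} u) \<partial>lborel)"
    proof (cases "t \<in> I")
      case True
      then have "0 \<le> t" by (simp add: interval_I_def)
      have "(\<integral>\<^sup>+ u. wI t * (indicator {t. ennreal t < superlevel (phi_of x) u} t * indicator {0..} u) \<partial>lborel)
        = (\<integral>\<^sup>+ u. wI t * (indicator {u. ennreal u < orlicz_ext \<phi> (rearrangement \<gamma> x t)} u * indicator {0..} u) \<partial>lborel)"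
        using ext[OF _ \<open>0 \<le> t\<close>] by (intro nn_integral_cong) (auto simp: indicator_def)
      also have "\<dots> = wI t * orlicz_ext \<phi> (rearrangement \<gamma> x t)"
        by (subst nn_integral_cmult) (auto simp: nn_integral_indicator_interval_below)
      finally show ?thesis using True by (simp add: wI_def mult.commute)
    qed (simp add: wI_def)
  qed
  also have "\<dots> = (\<integral>\<^sup>+ u. (\<integral>\<^sup>+ t. wI t * (indicator {t. ennreal t < superlevel (phi_of x) u} t * indicator {0..} u) \<partial>lebesgue) \<partial>lborel)"
    by (rule lebesgue_lborel.Fubini'[symmetric]) measurable
  also have "\<dots> = (\<integral>\<^sup>+ u. (\<integral>\<^sup>+ t. (wI t * indicator {t. ennreal t < superlevel (phi_of x) u} t) * indicator {0..} u \<partial>lebesgue) \<partial>lborel)"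
    by (simp add: mult.assoc)
  also have "\<dots> = (\<integral>\<^sup>+ u. Wt (superlevel (phi_of x) u) * indicator {0..} u \<partial>lborel)"
    unfolding Wt_def by (intro nn_integral_cong nn_integral_multc) measurable
  finally show ?thesis by (simp add: choquet_def)
qed

abbreviation rho :: "L0 \<Rightarrow> ennreal" where "rho \<equiv> modular \<gamma> \<phi> w"
abbreviation V :: "L0 set" where "V \<equiv> orlicz_lorentz \<gamma> \<phi> w"
abbreviation N :: "L0 \<Rightarrow> real" where "N \<equiv> luxemburg_norm \<gamma> \<phi> w"

section \<open>Convexity and lower semicontinuity of the modular\<close>

lemma rho_mono:
  assumes "AE t in lebesgue. t \<in> I \<longrightarrow> \<bar>rep_L0 x t\<bar> \<le> \<bar>rep_L0 y t\<bar>"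
  shows "rho x \<le> rho y"
  unfolding modular_eq_choquet
proof (intro choquet_mono_AE phi_of_measurable)
  show "AE t in lebesgue. t \<in> I \<longrightarrow> phi_of x t \<le> phi_of y t"
    using assms by eventually_elim (auto simp: phi_of_def intro!: ennreal_leI phi_mono)
qed

lemma rho_scaleR_mono:
  assumes "\<bar>a\<bar> \<le> \<bar>b\<bar>"
  shows "rho (a *\<^sub>R x) \<le> rho (b *\<^sub>R x)"
proof (rule rho_mono)
  show "AE t in lebesgue. t \<in> I \<longrightarrow> \<bar>rep_L0 (a *\<^sub>R x) t\<bar> \<le> \<bar>rep_L0 (b *\<^sub>R x) t\<bar>"
    using rep_L0_scaleR[of a x] rep_L0_scaleR[of b x]
    by eventually_elim (simp add: abs_mult assms mult_right_mono)
qed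

text \<open>Pointwise convexity of \<open>\<phi>\<close> is carried through the Choquet integral by
  its subadditivity and homogeneity; here the monotonicity of the weight pays off.\<close>

lemma rho_convex:
  assumes "0 < a" "0 < b" "a + b = 1"
  shows "rho (a *\<^sub>R x + b *\<^sub>R y) \<le> ennreal a * rho x + ennreal b * rho y"
proof -
  have "rho (a *\<^sub>R x + b *\<^sub>R y) \<le> choquet (\<lambda>t. ennreal a * phi_of x t + ennreal b * phi_of y t)"
    unfolding modular_eq_choquet
  proof (intro choquet_mono_AE)
    show "AE t in lebesgue. t \<in> I \<longrightarrow>
      phi_of (a *\<^sub>R x + b *\<^sub>R y) t \<le> ennreal a * phi_of x t + ennreal b * phi_of y t"
      using rep_L0_add[of "a *\<^sub>R x" "b *\<^sub>R y"] rep_L0_scaleR[of a x] rep_L0_scaleR[of b y]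
    proof eventually_elim
      case (elim t)
      have "\<phi> \<bar>rep_L0 (a *\<^sub>R x + b *\<^sub>R y) t\<bar> \<le> \<phi> (a * \<bar>rep_L0 x t\<bar> + b * \<bar>rep_L0 y t\<bar>)"
        unfolding elim using assms by (intro phi_mono order_trans[OF abs_triangle_ineq]) (auto simp: abs_mult)
      also have "\<dots> \<le> a * \<phi> \<bar>rep_L0 x t\<bar> + b * \<phi> \<bar>rep_L0 y t\<bar>"
        using convex_onD[OF phi_convex, of b "\<bar>rep_L0 x t\<bar>" "\<bar>rep_L0 y t\<bar>"] assms
        by (simp add: eq_diff_eq[symmetric])
      finally show ?case
        using assms by (auto simp: phi_of_def ennreal_mult[symmetric] ennreal_plus[symmetric] simp del: ennreal_plus intro!: ennreal_leI)
    qed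
  qed measurable
  also have "\<dots> \<le> choquet (\<lambda>t. ennreal a * phi_of x t) + choquet (\<lambda>t. ennreal b * phi_of y t)"
    by (intro choquet_add_le) measurable
  also have "\<dots> = ennreal a * rho x + ennreal b * rho y"
    using assms by (simp add: choquet_cmult modular_eq_choquet)
  finally show ?thesis .
qed

lemma rho_zero [simp]: "rho 0 = 0"
proof -
  have "choquet (phi_of 0) \<le> choquet (\<lambda>t. 0 * indicator {} t)"
  proof (intro choquet_mono_AE)
    show "AE t in lebesgue. t \<in> I \<longrightarrow> phi_of 0 t \<le> 0 * indicator {} t"
      using rep_L0_zero by eventually_elim (simp add: phi_of_def)
  qed auto
  also have "\<dots> = 0" by (subst choquet_indicator) auto
  finally show ?thesis by (simp add: modular_eq_choquet)
qed

lemma rho_contract: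
  assumes "0 < c" "c \<le> 1"
  shows "rho (c *\<^sub>R x) \<le> ennreal c * rho x"
proof (cases "c = 1")
  case False
  then show ?thesis using rho_convex[of c "1 - c" x 0] assms by simp
qed simp

lemma rho_liminf:
  assumes "AE t in lebesgue. t \<in> I \<longrightarrow> (\<lambda>n::nat. rep_L0 (x n) t) \<longlonglongrightarrow> rep_L0 z t"
  shows "rho z \<le> liminf (\<lambda>n. rho (x n))"
proof -
  have "choquet (phi_of z) \<le> choquet (\<lambda>t. liminf (\<lambda>n. phi_of (x n) t))"
  proof (intro choquet_mono_AE)
    show "AE t in lebesgue. t \<in> I \<longrightarrow> phi_of z t \<le> liminf (\<lambda>n. phi_of (x n) t)"
      using assms
    proof eventually_elim
      case (elim t)
      show ?case
      proof
        assume "t \<in> I"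
        with elim have "(\<lambda>n. rep_L0 (x n) t) \<longlonglongrightarrow> rep_L0 z t" by simp
        then have "(\<lambda>n. \<phi> \<bar>rep_L0 (x n) t\<bar>) \<longlonglongrightarrow> \<phi> \<bar>rep_L0 z t\<bar>"
          using continuous_on_tendsto_compose[OF phi_abs_continuous] by simp
        then have "(\<lambda>n. phi_of (x n) t) \<longlonglongrightarrow> phi_of z t"
          unfolding phi_of_def by (rule tendsto_ennrealI)
        then show "phi_of z t \<le> liminf (\<lambda>n. phi_of (x n) t)"
          by (simp add: lim_imp_Liminf)
      qed
    qed
  qed measurable
  also have "\<dots> \<le> liminf (\<lambda>n. choquet (phi_of (x n)))"
    by (rule choquet_liminf) measurable
  finally show ?thesis by (simp add: modular_eq_choquet)
qed

section \<open>The Luxemburg norm, its Fatou property and order continuity\<close>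

lemma V_L0_on: "x \<in> V \<Longrightarrow> x \<in> L0_on \<gamma>"
  by (simp add: orlicz_lorentz_def)

lemma V_iff: "x \<in> V \<longleftrightarrow> x \<in> L0_on \<gamma> \<and> (\<exists>e>0. rho (x /\<^sub>R e) \<le> 1)"
proof (intro iffI conjI)
  assume x: "x \<in> V"
  then obtain l where l: "0 < l" "rho (l *\<^sub>R x) < \<infinity>" by (auto simp: orlicz_lorentz_def)
  then obtain r where r: "rho (l *\<^sub>R x) = ennreal r" "0 \<le> r" by (cases "rho (l *\<^sub>R x)") auto
  \<comment> \<open>With this factor \<open>c * r \<le> 1\<close>, so contracting by
    \<open>c\<close> brings a finite modular below 1.\<close>
  define c where "c = 1 / (1 + r)"
  have c: "0 < c" "c \<le> 1" using r by (auto simp: c_def)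
  have "rho (c *\<^sub>R (l *\<^sub>R x)) \<le> ennreal c * ennreal r" using rho_contract[OF c] r by metis
  also have "\<dots> \<le> 1" using r c by (auto simp: c_def ennreal_mult[symmetric] simp flip: ennreal_1 intro!: ennreal_leI)
  finally have "rho (x /\<^sub>R (1 / (c * l))) \<le> 1" by simp
  moreover have "0 < 1 / (c * l)" using c l by simp
  ultimately show "\<exists>e>0. rho (x /\<^sub>R e) \<le> 1" by blast
next
  assume x: "x \<in> L0_on \<gamma> \<and> (\<exists>e>0. rho (x /\<^sub>R e) \<le> 1)"
  then obtain e where e: "0 < e" "rho (x /\<^sub>R e) \<le> 1" by auto
  then have "rho (inverse e *\<^sub>R x) < \<infinity>" using le_less_trans by fastforce
  then show "x \<in> V" using x e unfolding orlicz_lorentz_def by (auto intro!: exI[of _ "inverse e"])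
qed (auto simp: orlicz_lorentz_def)

lemma N_nonneg: "x \<in> V \<Longrightarrow> 0 \<le> N x"
  unfolding luxemburg_norm_def by (rule cInf_greatest) (auto simp: V_iff)

lemma N_leI: "0 < e \<Longrightarrow> rho (x /\<^sub>R e) \<le> 1 \<Longrightarrow> N x \<le> e"
  unfolding luxemburg_norm_def by (rule cInf_lower) (auto intro!: bdd_belowI[of _ 0])

text \<open>The infimum in the norm is attained: the modular is at most 1 at every scale
  \<open>d n > e\<close>, and it is lower semicontinuous as \<open>d n\<close> tends to
  \<open>e\<close>. From here on the unit balls of the norm and of the modular coincide.\<close>

lemma N_le_iff:
  assumes x: "x \<in> V" and e: "0 < e"
  shows "N x \<le> e \<longleftrightarrow> rho (x /\<^sub>R e) \<le> 1"
proof
  assume N: "N x \<le> e"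
  have *: "rho (x /\<^sub>R d) \<le> 1" if "e < d" for d
  proof -
    have "\<exists>b\<in>{b. 0 < b \<and> rho (x /\<^sub>R b) \<le> 1}. b < d"
      using x N that by (intro cInf_lessD) (auto simp: V_iff luxemburg_norm_def)
    then obtain b where b: "0 < b" "rho (x /\<^sub>R b) \<le> 1" "b < d" by auto
    have "rho (x /\<^sub>R d) \<le> rho (x /\<^sub>R b)"
      using b by (intro rho_scaleR_mono) (auto simp: field_simps)
    then show ?thesis using b by simp
  qed
  define d where "d n = e + inverse (real (Suc n))" for n
  have d: "d \<longlonglongrightarrow> e" unfolding d_def
    using tendsto_add[OF tendsto_const LIMSEQ_inverse_real_of_nat, of e] by simp
  have "AE t in lebesgue. \<forall>n. rep_L0 (x /\<^sub>R d n) t = inverse (d n) * rep_L0 x t"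
    by (subst AE_all_countable) (auto intro: rep_L0_scaleR)
  then have "AE t in lebesgue. t \<in> I \<longrightarrow> (\<lambda>n. rep_L0 (x /\<^sub>R d n) t) \<longlonglongrightarrow> rep_L0 (x /\<^sub>R e) t"
    using rep_L0_scaleR[of "inverse e" x]
  proof eventually_elim
    case (elim t)
    then show ?case using d e by (auto intro!: tendsto_intros)
  qed
  then have "rho (x /\<^sub>R e) \<le> liminf (\<lambda>n. rho (x /\<^sub>R d n))"
    by (rule rho_liminf)
  also have "\<dots> \<le> liminf (\<lambda>n::nat. 1)"
    by (intro Liminf_mono always_eventually allI *) (simp add: d_def)
  finally show "rho (x /\<^sub>R e) \<le> 1" by (simp add: Liminf_const)
qed (rule N_leI[OF e])

lemma V_zero [simp]: "0 \<in> V"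
  using rep_L0_zero by (auto simp: V_iff L0_on_iff intro!: exI[of _ 1] elim: eventually_mono)

lemma L0_on_scaleR: "x \<in> L0_on \<gamma> \<Longrightarrow> c *\<^sub>R x \<in> L0_on \<gamma>"
  unfolding L0_on_iff using rep_L0_scaleR[of c x] by (auto elim: eventually_elim2)

lemma L0_on_add: "x \<in> L0_on \<gamma> \<Longrightarrow> y \<in> L0_on \<gamma> \<Longrightarrow> x + y \<in> L0_on \<gamma>"
  unfolding L0_on_iff
proof -
  assume "AE t in lebesgue. t \<notin> I \<longrightarrow> rep_L0 x t = 0" "AE t in lebesgue. t \<notin> I \<longrightarrow> rep_L0 y t = 0"
  then show "AE t in lebesgue. t \<notin> I \<longrightarrow> rep_L0 (x + y) t = 0"
    using rep_L0_add[of x y] by eventually_elim simp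
qed

lemma V_scaleR: assumes "x \<in> V" shows "c *\<^sub>R x \<in> V"
proof -
  obtain e where e: "0 < e" "rho (x /\<^sub>R e) \<le> 1" using assms by (auto simp: V_iff)
  have p: "0 < e + e * \<bar>c\<bar>" using e by (simp add: add_pos_nonneg)
  \<comment> \<open>The summand 1 keeps the scale positive for \<open>c = 0\<close>.\<close>
  have "\<bar>inverse (e * (\<bar>c\<bar> + 1)) * c\<bar> \<le> \<bar>inverse e\<bar>"
    using e p by (simp add: abs_mult field_simps)
  then have "rho ((c *\<^sub>R x) /\<^sub>R (e * (\<bar>c\<bar> + 1))) \<le> rho (x /\<^sub>R e)"
    unfolding scaleR_scaleR by (rule rho_scaleR_mono)
  then have "rho ((c *\<^sub>R x) /\<^sub>R (e * (\<bar>c\<bar> + 1))) \<le> 1" using e by simp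
  moreover have "0 < e * (\<bar>c\<bar> + 1)" using e by (simp add: add_nonneg_pos)
  ultimately show ?thesis using assms L0_on_scaleR unfolding V_iff by blast
qed

text \<open>The scaled sum is the convex combination of the scaled summands with weights
  proportional to \<open>a\<close> and \<open>b\<close>; the triangle inequality is an immediate
  consequence.\<close>

lemma rho_add_le_1:
  assumes "0 < a" "0 < b" "rho (x /\<^sub>R a) \<le> 1" "rho (y /\<^sub>R b) \<le> 1"
  shows "rho ((x + y) /\<^sub>R (a + b)) \<le> 1"
proof -
  have sum1: "a / (a + b) + b / (a + b) = 1"
    using assms by (simp add: add_divide_distrib[symmetric])
  have eq: "(x + y) /\<^sub>R (a + b) = (a / (a + b)) *\<^sub>R (x /\<^sub>R a) + (b / (a + b)) *\<^sub>R (y /\<^sub>R b)"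
  proof -
    have "a / (a + b) * inverse a = inverse (a + b)" "b / (a + b) * inverse b = inverse (a + b)"
      using assms by (simp_all add: divide_inverse)
    then show ?thesis by (simp add: scaleR_add_right)
  qed
  have "rho ((x + y) /\<^sub>R (a + b)) \<le> ennreal (a / (a + b)) * rho (x /\<^sub>R a) + ennreal (b / (a + b)) * rho (y /\<^sub>R b)"
    unfolding eq using assms sum1 by (intro rho_convex) auto
  also have "\<dots> \<le> ennreal (a / (a + b)) * 1 + ennreal (b / (a + b)) * 1"
    using assms by (intro add_mono mult_left_mono) auto
  also have "\<dots> = ennreal (a / (a + b) + b / (a + b))"
    using assms by (subst ennreal_plus) auto
  also note sum1
  finally show ?thesis by simp
qed

lemma V_add: "x \<in> V \<Longrightarrow> y \<in> V \<Longrightarrow> x + y \<in> V"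
  using rho_add_le_1 L0_on_add unfolding V_iff by (metis add_pos_pos)

lemma N_triangle: assumes "x \<in> V" "y \<in> V" shows "N (x + y) \<le> N x + N y"
proof (rule field_le_epsilon)
  fix e :: real assume e: "0 < e"
  have p: "0 < N x + e / 2" "0 < N y + e / 2"
    using e N_nonneg[OF assms(1)] N_nonneg[OF assms(2)] by auto
  have "rho (x /\<^sub>R (N x + e / 2)) \<le> 1" "rho (y /\<^sub>R (N y + e / 2)) \<le> 1"
    using N_le_iff[OF assms(1) p(1)] N_le_iff[OF assms(2) p(2)] e by auto
  then have "rho ((x + y) /\<^sub>R ((N x + e / 2) + (N y + e / 2))) \<le> 1"
    by (intro rho_add_le_1 p)
  then have "N (x + y) \<le> (N x + e / 2) + (N y + e / 2)"
    using p by (intro N_leI) auto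
  then show "N (x + y) \<le> N x + N y + e" by simp
qed

lemma N_zero [simp]: "N 0 = 0"
proof (rule antisym)
  show "N 0 \<le> 0"
  proof (rule field_le_epsilon)
    fix e :: real assume "0 < e"
    then show "N 0 \<le> 0 + e" by (simp add: N_leI)
  qed
qed (simp add: N_nonneg)

lemma N_scaleR_le: assumes "x \<in> V" "c \<noteq> 0" shows "N (c *\<^sub>R x) \<le> \<bar>c\<bar> * N x"
proof (rule field_le_epsilon)
  fix e :: real assume e: "0 < e"
  define d where "d = N x + e / \<bar>c\<bar>"
  have d: "0 < d" "N x \<le> d" using e assms N_nonneg[of x] by (auto simp: d_def intro!: add_nonneg_pos)
  have "rho ((c *\<^sub>R x) /\<^sub>R (\<bar>c\<bar> * d)) \<le> rho (x /\<^sub>R d)"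
    unfolding scaleR_scaleR using assms d by (intro rho_scaleR_mono) (auto simp: field_simps abs_mult)
  also have "\<dots> \<le> 1" using N_le_iff[OF assms(1) d(1)] d by simp
  finally have "N (c *\<^sub>R x) \<le> \<bar>c\<bar> * d" using assms d by (intro N_leI) auto
  then show "N (c *\<^sub>R x) \<le> \<bar>c\<bar> * N x + e" using assms by (simp add: d_def distrib_left)
qed

lemma N_scaleR: assumes "x \<in> V" shows "N (c *\<^sub>R x) = \<bar>c\<bar> * N x"
proof (cases "c = 0")
  case False
  have "N x = N (inverse c *\<^sub>R (c *\<^sub>R x))" using False by simp
  also have "\<dots> \<le> \<bar>inverse c\<bar> * N (c *\<^sub>R x)"
    using False by (intro N_scaleR_le V_scaleR assms) auto
  finally have "\<bar>c\<bar> * N x \<le> N (c *\<^sub>R x)" using False by (simp add: field_simps)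
  then show ?thesis using N_scaleR_le[OF assms False] by simp
qed simp

lemma V_dominated:
  assumes "y \<in> V" "x \<in> L0_on \<gamma>" "AE t in lebesgue. t \<in> I \<longrightarrow> \<bar>rep_L0 x t\<bar> \<le> \<bar>rep_L0 y t\<bar>"
  shows "x \<in> V" "N x \<le> N y"
proof -
  have le: "rho (x /\<^sub>R e) \<le> rho (y /\<^sub>R e)" if "0 < e" for e
  proof (rule rho_mono)
    show "AE t in lebesgue. t \<in> I \<longrightarrow> \<bar>rep_L0 (x /\<^sub>R e) t\<bar> \<le> \<bar>rep_L0 (y /\<^sub>R e) t\<bar>"
      using rep_L0_scaleR[of "inverse e" x] rep_L0_scaleR[of "inverse e" y] assms(3)
      by eventually_elim (use that in \<open>auto simp: abs_mult intro!: mult_left_mono\<close>)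
  qed
  show "x \<in> V" using assms(1,2) le unfolding V_iff by (meson order_trans)
  show "N x \<le> N y"
  proof (rule field_le_epsilon)
    fix e :: real assume e: "0 < e"
    have p: "0 < N y + e" using e N_nonneg[OF assms(1)] by simp
    then have "rho (y /\<^sub>R (N y + e)) \<le> 1" using e by (subst N_le_iff[OF assms(1), symmetric]) auto
    then show "N x \<le> N y + e" using le[OF p] p by (intro N_leI) auto
  qed
qed

lemma N_Fatou:
  assumes x: "\<And>n::nat. x n \<in> V" "\<And>n. N (x n) \<le> e" "0 < e" and z: "z \<in> L0_on \<gamma>"
    and lim: "AE t in lebesgue. t \<in> I \<longrightarrow> (\<lambda>n. rep_L0 (x n) t) \<longlonglongrightarrow> rep_L0 z t"
  shows "z \<in> V" "N z \<le> e"
proof -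
  have "AE t in lebesgue. \<forall>n. rep_L0 (x n /\<^sub>R e) t = inverse e * rep_L0 (x n) t"
    by (subst AE_all_countable) (auto intro: rep_L0_scaleR)
  then have "AE t in lebesgue. t \<in> I \<longrightarrow> (\<lambda>n. rep_L0 (x n /\<^sub>R e) t) \<longlonglongrightarrow> rep_L0 (z /\<^sub>R e) t"
    using rep_L0_scaleR[of "inverse e" z] lim
    by eventually_elim (auto intro!: tendsto_intros)
  then have "rho (z /\<^sub>R e) \<le> liminf (\<lambda>n. rho (x n /\<^sub>R e))"
    by (rule rho_liminf)
  also have "\<dots> \<le> liminf (\<lambda>n::nat. 1)"
    using x N_le_iff by (intro Liminf_mono always_eventually allI) blast
  finally have "rho (z /\<^sub>R e) \<le> 1" by (simp add: Liminf_const)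
  then show "z \<in> V" "N z \<le> e" using z x(3) by (auto simp: V_iff intro: N_leI)
qed

text \<open>Norm convergence to 0 concerns the modular of \<open>x n /\<^sub>R e\<close> for every
  \<open>e\<close>, so the majorant must have finite modular at every scale. Doubling will provide
  this for all elements of the space.\<close>

lemma N_dominated_convergence:
  assumes fin: "\<And>l. rho (l *\<^sub>R y) < \<infinity>" and x: "\<And>n::nat. x n \<in> L0_on \<gamma>"
    and le: "\<And>n. AE t in lebesgue. t \<in> I \<longrightarrow> \<bar>rep_L0 (x n) t\<bar> \<le> \<bar>rep_L0 y t\<bar>"
    and lim: "AE t in lebesgue. t \<in> I \<longrightarrow> (\<lambda>n. rep_L0 (x n) t) \<longlonglongrightarrow> 0"
  shows "(\<lambda>n. N (x n)) \<longlonglongrightarrow> 0"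
proof -
  have ev: "\<forall>\<^sub>F n in sequentially. rho (x n /\<^sub>R e) \<le> 1" if e: "0 < e" for e
  proof -
    have s: "AE t in lebesgue. \<forall>n. rep_L0 (x n /\<^sub>R e) t = inverse e * rep_L0 (x n) t"
      by (subst AE_all_countable) (auto intro: rep_L0_scaleR)
    have "(\<lambda>n. choquet (phi_of (x n /\<^sub>R e))) \<longlonglongrightarrow> 0"
    proof (rule choquet_dominated_convergence[where z = "phi_of (y /\<^sub>R e)"])
      show "choquet (phi_of (y /\<^sub>R e)) < \<infinity>" using fin by (simp add: modular_eq_choquet)
      show "AE t in lebesgue. t \<in> I \<longrightarrow> phi_of (x n /\<^sub>R e) t \<le> phi_of (y /\<^sub>R e) t" for n
        using s rep_L0_scaleR[of "inverse e" y] le[of n]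
        by eventually_elim (use e in \<open>auto simp: phi_of_def abs_mult intro!: ennreal_leI phi_mono mult_left_mono\<close>)
      show "AE t in lebesgue. t \<in> I \<longrightarrow> (\<lambda>n. phi_of (x n /\<^sub>R e) t) \<longlonglongrightarrow> 0"
        using s lim
      proof eventually_elim
        case (elim t)
        show ?case
        proof
          assume "t \<in> I"
          then have "(\<lambda>n. inverse e * rep_L0 (x n) t) \<longlonglongrightarrow> inverse e * 0"
            using elim by (intro tendsto_intros) auto
          then have "(\<lambda>n. \<phi> \<bar>inverse e * rep_L0 (x n) t\<bar>) \<longlonglongrightarrow> \<phi> \<bar>inverse e * 0\<bar>"
            by (rule continuous_on_tendsto_compose[OF phi_abs_continuous]) auto
          then have "(\<lambda>n. \<phi> \<bar>rep_L0 (x n /\<^sub>R e) t\<bar>) \<longlonglongrightarrow> \<phi> \<bar>inverse e * 0\<bar>"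
            using elim(1) by simp
          then have "(\<lambda>n. phi_of (x n /\<^sub>R e) t) \<longlonglongrightarrow> ennreal (\<phi> \<bar>inverse e * 0\<bar>)"
            unfolding phi_of_def by (rule tendsto_ennrealI)
          then show "(\<lambda>n. phi_of (x n /\<^sub>R e) t) \<longlonglongrightarrow> 0" by simp
        qed
      qed
    qed measurable
    then have "\<forall>\<^sub>F n in sequentially. choquet (phi_of (x n /\<^sub>R e)) < 1"
      by (rule order_tendstoD) simp
    then show ?thesis by (auto simp: modular_eq_choquet elim: eventually_mono)
  qed
  show ?thesis
  proof (rule tendstoI)
    fix e :: real assume e: "0 < e"
    have "\<forall>\<^sub>F n in sequentially. rho (x n /\<^sub>R (e/2)) \<le> 1" using e by (intro ev) auto
    then show "\<forall>\<^sub>F n in sequentially. dist (N (x n)) 0 < e"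
    proof eventually_elim
      case (elim n)
      have "x n \<in> V" using x elim e unfolding V_iff by (meson half_gt_zero)
      moreover have "N (x n) \<le> e / 2" using elim e by (intro N_leI) auto
      ultimately show ?case using e N_nonneg by (auto simp: abs_if dest!: N_nonneg)
    qed
  qed
qed

section \<open>Uniform integrability, and elements with finite modular at every scale\<close>

lemma nn_integral_phi_eta:
  obtains C where "0 < C" "\<And>x. rho x \<le> 1 \<Longrightarrow> (\<integral>\<^sup>+ t. phi_of x t \<partial>eta) \<le> ennreal C"
proof -
  obtain C where C: "0 < C" "\<And>y. y \<in> borel_measurable lebesgue \<Longrightarrow> (\<integral>\<^sup>+ t. y t \<partial>eta) \<le> ennreal C * choquet y"
    by (rule nn_integral_eta_le_choquet) blast
  have "(\<integral>\<^sup>+ t. phi_of x t \<partial>eta) \<le> ennreal C" if "rho x \<le> 1" for x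
  proof -
    have "(\<integral>\<^sup>+ t. phi_of x t \<partial>eta) \<le> ennreal C * rho x"
      unfolding modular_eq_choquet by (intro C) measurable
    also have "\<dots> \<le> ennreal C * 1" using that by (intro mult_left_mono) auto
    finally show ?thesis by simp
  qed
  then show ?thesis using C(1) that by blast
qed

text \<open>De la Vallee Poussin's criterion for the unit ball of the modular:
  \<open>(e / C) * \<phi>\<close> dominates the excess over \<open>l\<close>, and its
  \<open>eta\<close>-integral is at most \<open>e\<close>.\<close>

lemma uniformly_integrable:
  assumes "0 < e"
  obtains l where "0 \<le> l" "\<And>x. rho x \<le> 1 \<Longrightarrow> (\<integral>\<^sup>+ t. ennreal (\<bar>rep_L0 x t\<bar> - l) \<partial>eta) \<le> ennreal e"
proof -
  obtain C where C: "0 < C" "\<And>x. rho x \<le> 1 \<Longrightarrow> (\<integral>\<^sup>+ t. phi_of x t \<partial>eta) \<le> ennreal C"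
    by (rule nn_integral_phi_eta) blast
  have "0 < e / C" using C assms by simp
  then obtain l where l: "0 \<le> l" "\<And>u. 0 \<le> u \<Longrightarrow> u \<le> l + (e / C) * \<phi> u"
    by (rule phi_superlinear) blast
  have "(\<integral>\<^sup>+ t. ennreal (\<bar>rep_L0 x t\<bar> - l) \<partial>eta) \<le> ennreal e" if "rho x \<le> 1" for x
  proof -
    have "phi_of x \<in> borel_measurable eta" by simp
    then have "(\<integral>\<^sup>+ t. ennreal (e / C) * phi_of x t \<partial>eta) = ennreal (e / C) * (\<integral>\<^sup>+ t. phi_of x t \<partial>eta)"
      by (rule nn_integral_cmult)
    moreover have "(\<integral>\<^sup>+ t. ennreal (\<bar>rep_L0 x t\<bar> - l) \<partial>eta) \<le> (\<integral>\<^sup>+ t. ennreal (e / C) * phi_of x t \<partial>eta)"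
      using l(2)[of "\<bar>rep_L0 x _\<bar>"] assms C
      by (intro nn_integral_mono) (auto simp: phi_of_def ennreal_mult[symmetric] intro!: ennreal_leI simp: algebra_simps)
    ultimately have "(\<integral>\<^sup>+ t. ennreal (\<bar>rep_L0 x t\<bar> - l) \<partial>eta) \<le> ennreal (e / C) * (\<integral>\<^sup>+ t. phi_of x t \<partial>eta)"
      by simp
    also have "\<dots> \<le> ennreal (e / C) * ennreal C"
      by (intro mult_left_mono C that) auto
    also have "\<dots> = ennreal e" using C assms by (simp add: ennreal_mult[symmetric])
    finally show ?thesis .
  qed
  then show ?thesis using l(1) that by blast
qed

text \<open>The modular is at most \<open>\<phi> (\<bar>l\<bar> * b)\<close> times the primitive at
  a finite length, hence finite at every scale \<open>l\<close>. Bounded functions of bounded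
  support are therefore admissible majorants for norm convergence.\<close>

lemma bounded_in_V:
  assumes [measurable]: "f \<in> borel_measurable lebesgue" and b: "\<And>t. \<bar>f t\<bar> \<le> b"
    and supp: "\<And>t. t \<notin> I \<or> M < t \<Longrightarrow> f t = 0"
  shows "abs_L0 f \<in> L0_on \<gamma>" "rho (l *\<^sub>R abs_L0 f) < \<infinity>"
proof -
  show "abs_L0 f \<in> L0_on \<gamma>"
    unfolding L0_on_iff using rep_abs_L0[OF assms(1)] by eventually_elim (simp add: supp)
  have "0 \<le> b" using b[of 0] by (meson abs_ge_zero order_trans)
  have m [measurable]: "{0..M} \<in> sets lebesgue" by simp
  have "choquet (phi_of (l *\<^sub>R abs_L0 f)) \<le> choquet (\<lambda>t. ennreal (\<phi> (\<bar>l\<bar> * b)) * indicator {0..M} t)"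
  proof (intro choquet_mono_AE)
    show "AE t in lebesgue. t \<in> I \<longrightarrow> phi_of (l *\<^sub>R abs_L0 f) t \<le> ennreal (\<phi> (\<bar>l\<bar> * b)) * indicator {0..M} t"
      using rep_abs_L0[OF assms(1)] rep_L0_scaleR[of l "abs_L0 f"]
    proof eventually_elim
      case (elim t)
      show ?case
      proof (cases "t \<in> I \<and> t \<le> M")
        case True
        then have "0 \<le> t" by (simp add: interval_I_def)
        then show ?thesis using True elim b[of t] \<open>0 \<le> b\<close>
          by (auto simp: phi_of_def abs_mult intro!: ennreal_leI phi_mono mult_left_mono)
      next
        case False
        then show ?thesis using elim supp[of t] by (auto simp: phi_of_def not_le)
      qed
    qed
  qed auto
  also have "\<dots> = ennreal (\<phi> (\<bar>l\<bar> * b)) * Wt (emeasure lebesgue (I \<inter> {0..M}))"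
    using m by (rule choquet_indicator)
  also have "\<dots> < \<infinity>"
  proof -
    have "emeasure lebesgue (I \<inter> {0..M}) \<le> emeasure lebesgue {0..M}"
      by (intro emeasure_mono) auto
    also have "\<dots> < \<infinity>" by (cases "0 \<le> M") auto
    finally show ?thesis using Wt_finite by (simp add: ennreal_mult_less_top)
  qed
  finally show "rho (l *\<^sub>R abs_L0 f) < \<infinity>" by (simp add: modular_eq_choquet)
qed

text \<open>Both conditions are used in the form
  \<open>\<phi> (2 * u) \<le> K * \<phi> u + B\<close>. The constant \<open>B\<close> accounts for
  arguments below \<open>u0\<close> and contributes \<open>B * Wt \<gamma>\<close>, which is finite
  because \<open>B = 0\<close> unless \<gamma> is finite. Repeated doubling then reaches every
  multiple.\<close>

lemma Delta2_rho_finite: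
  assumes D: "(\<gamma> = \<infinity> \<longrightarrow> Delta2 \<phi>) \<and> (\<gamma> < \<infinity> \<longrightarrow> Delta2_infinity \<phi>)" and x: "x \<in> V"
  shows "rho (l *\<^sub>R x) < \<infinity>"
proof -
  obtain K B where K: "0 < K" "0 \<le> B" "\<And>u. 0 \<le> u \<Longrightarrow> \<phi> (2 * u) \<le> K * \<phi> u + B" "B = 0 \<or> \<gamma> < \<infinity>"
  proof (cases "\<gamma> = \<infinity>")
    case True
    with D obtain K where "K > 0" "\<forall>u\<ge>0. \<phi> (2 * u) \<le> K * \<phi> u" by (auto simp: Delta2_def)
    then show ?thesis using that[of K 0] by simp
  next
    case False
    then have g: "\<gamma> < \<infinity>" by (simp add: less_top)
    with D obtain K u0 where K: "K > 0" "u0 \<ge> 0" "\<forall>u\<ge>u0. \<phi> (2 * u) \<le> K * \<phi> u"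
      by (auto simp: Delta2_infinity_def)
    have "\<phi> (2 * u) \<le> K * \<phi> u + \<phi> (2 * u0)" if "0 \<le> u" for u
    proof (cases "u0 \<le> u")
      case True
      then have "\<phi> (2 * u) \<le> K * \<phi> u" "0 \<le> \<phi> (2 * u0)" using K by auto
      then show ?thesis by linarith
    next
      case False
      then have "\<phi> (2 * u) \<le> \<phi> (2 * u0)" "0 \<le> K * \<phi> u" using that K by (auto intro: phi_mono)
      then show ?thesis by linarith
    qed
    then show ?thesis using that[of K "\<phi> (2 * u0)"] K g by auto
  qed
  have double: "rho (2 *\<^sub>R z) < \<infinity>" if "rho z < \<infinity>" for z
  proof -
    have "rho (2 *\<^sub>R z) \<le> choquet (\<lambda>t. ennreal K * phi_of z t + ennreal B * indicator UNIV t)"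
      unfolding modular_eq_choquet
    proof (intro choquet_mono_AE)
      show "AE t in lebesgue. t \<in> I \<longrightarrow> phi_of (2 *\<^sub>R z) t \<le> ennreal K * phi_of z t + ennreal B * indicator UNIV t"
        using rep_L0_scaleR[of 2 z]
        by eventually_elim (use K in \<open>auto simp: phi_of_def abs_mult ennreal_mult[symmetric] ennreal_plus[symmetric]
          simp del: ennreal_plus intro!: ennreal_leI\<close>)
    qed measurable
    also have "\<dots> \<le> choquet (\<lambda>t. ennreal K * phi_of z t) + choquet (\<lambda>t. ennreal B * indicator UNIV t)"
      by (intro choquet_add_le) measurable
    also have "\<dots> = ennreal K * rho z + ennreal B * Wt \<gamma>"
      using K by (subst choquet_cmult, measurable) (subst choquet_indicator, auto simp: modular_eq_choquet emeasure_I simp del: emeasure_completion)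
    also have "\<dots> < \<infinity>"
      using that K(4) Wt_finite[of \<gamma>] by (auto simp: ennreal_mult_less_top)
    finally show ?thesis .
  qed
  obtain k where k: "0 < k" "rho (k *\<^sub>R x) < \<infinity>" using x by (auto simp: orlicz_lorentz_def)
  have pow: "rho ((2 ^ n * k) *\<^sub>R x) < \<infinity>" for n
  proof (induction n)
    case (Suc n)
    then show ?case using double[of "(2 ^ n * k) *\<^sub>R x"] by (simp add: mult.assoc)
  qed (use k in simp)
  obtain n where "\<bar>l\<bar> / k < 2 ^ n" using real_arch_pow[of 2 "\<bar>l\<bar> / k"] by auto
  then have "\<bar>l\<bar> \<le> \<bar>2 ^ n * k\<bar>" using k by (simp add: field_simps)
  then have "rho (l *\<^sub>R x) \<le> rho ((2 ^ n * k) *\<^sub>R x)" by (rule rho_scaleR_mono)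
  then show ?thesis using pow le_less_trans by blast
qed

end

section \<open>Bochner integrals in normed subspaces\<close>

text \<open>The integral of a simple function is defined through its values. This regroups it over
  the fibres of any finer simple function \<open>h\<close>, where \<open>f\<close> may identify
  several fibres.\<close>

lemma (in finite_measure) simple_vector_integral_compose:
  assumes h: "simple_function M h" and E: "E \<in> sets M"
  shows "simple_vector_integral M E (\<lambda>\<omega>. f (h \<omega>)) = (\<Sum>i\<in>h ` space M. measure M (h -` {i} \<inter> E) *\<^sub>R f i)"
proof -
  have fin: "finite (h ` space M)" using h by (rule simple_functionD)
  have m: "h -` {i} \<inter> E \<in> sets M" for i
  proof -
    have "h -` {i} \<inter> E = (h -` {i} \<inter> space M) \<inter> E" using sets.sets_into_space[OF E] by auto
    then show ?thesis using simple_functionD(2)[OF h] E by auto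
  qed
  have meas: "measure M ((\<lambda>\<omega>. f (h \<omega>)) -` {v} \<inter> E) = (\<Sum>i\<in>{i \<in> h ` space M. f i = v}. measure M (h -` {i} \<inter> E))" for v
  proof -
    have "(\<lambda>\<omega>. f (h \<omega>)) -` {v} \<inter> E = (\<Union>i\<in>{i \<in> h ` space M. f i = v}. h -` {i} \<inter> E)"
      using sets.sets_into_space[OF E] by auto
    also have "measure M \<dots> = (\<Sum>i\<in>{i \<in> h ` space M. f i = v}. measure M (h -` {i} \<inter> E))"
      using fin m by (intro finite_measure_finite_Union) (auto simp: disjoint_family_on_def)
    finally show ?thesis .
  qed
  have "simple_vector_integral M E (\<lambda>\<omega>. f (h \<omega>)) =
      (\<Sum>v\<in>f ` (h ` space M). (\<Sum>i\<in>{i \<in> h ` space M. f i = v}. measure M (h -` {i} \<inter> E) *\<^sub>R f i))"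
    unfolding simple_vector_integral_def meas image_image scaleR_sum_left
    by (intro sum.cong refl) auto
  also have "\<dots> = (\<Sum>i\<in>h ` space M. measure M (h -` {i} \<inter> E) *\<^sub>R f i)"
    using fin by (intro sum.group) auto
  finally show ?thesis .
qed

text \<open>The pair of the two functions is a common refinement on which all three integrals can be
  compared.\<close>

lemma (in finite_measure) simple_vector_integral_diff:
  assumes s: "simple_function M s" "simple_function M s'" and E: "E \<in> sets M"
  shows "simple_vector_integral M E (\<lambda>\<omega>. s \<omega> - s' \<omega>) = simple_vector_integral M E s - simple_vector_integral M E s'"
proof -
  have h: "simple_function M (\<lambda>\<omega>. (s \<omega>, s' \<omega>))"
    using s by (rule simple_function_Pair)
  show ?thesis
    using simple_vector_integral_compose[OF h E, of "\<lambda>z. fst z - snd z"]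
      simple_vector_integral_compose[OF h E, of fst] simple_vector_integral_compose[OF h E, of snd]
    by (simp add: sum_subtractf scaleR_diff_right)
qed

text \<open>The axioms are isolated because the results are needed for two norms on the same
  subspace, the Luxemburg norm and a weaker L^1 norm.\<close>

locale normed_subspace =
  fixes V :: "'v::real_vector set" and N :: "'v \<Rightarrow> real"
  assumes zero_mem [simp]: "0 \<in> V"
    and add_mem: "x \<in> V \<Longrightarrow> y \<in> V \<Longrightarrow> x + y \<in> V"
    and scaleR_mem: "x \<in> V \<Longrightarrow> c *\<^sub>R x \<in> V"
    and norm_nonneg: "x \<in> V \<Longrightarrow> 0 \<le> N x"
    and norm_scaleR: "x \<in> V \<Longrightarrow> N (c *\<^sub>R x) = \<bar>c\<bar> * N x"
    and norm_triangle: "x \<in> V \<Longrightarrow> y \<in> V \<Longrightarrow> N (x + y) \<le> N x + N y"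
    and norm_definite: "x \<in> V \<Longrightarrow> N x = 0 \<Longrightarrow> x = 0"
begin

lemma norm_zero [simp]: "N 0 = 0"
  using norm_scaleR[of 0 0] by simp

lemma norm_minus: "x \<in> V \<Longrightarrow> N (- x) = N x"
  using norm_scaleR[of x "-1"] by simp

lemma diff_mem: "x \<in> V \<Longrightarrow> y \<in> V \<Longrightarrow> x - y \<in> V"
  using add_mem[of x "- y"] scaleR_mem[of y "-1"] by simp

lemma sum_mem: "(\<And>i. i \<in> A \<Longrightarrow> f i \<in> V) \<Longrightarrow> sum f A \<in> V"
  by (induction A rule: infinite_finite_induct) (auto intro: add_mem)

lemma norm_sum: "(\<And>i. i \<in> A \<Longrightarrow> f i \<in> V) \<Longrightarrow> N (sum f A) \<le> (\<Sum>i\<in>A. N (f i))"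
proof (induction A rule: infinite_finite_induct)
  case (insert a A)
  have "N (sum f (insert a A)) \<le> N (f a) + N (sum f A)"
    using insert by (simp add: norm_triangle sum_mem)
  then show ?case using insert by simp
qed auto

lemma norm_diff_commute: "x \<in> V \<Longrightarrow> y \<in> V \<Longrightarrow> N (x - y) = N (y - x)"
  using norm_minus[of "x - y"] by (simp add: diff_mem)

lemma norm_diff_triangle: "x \<in> V \<Longrightarrow> y \<in> V \<Longrightarrow> z \<in> V \<Longrightarrow> N (x - z) \<le> N (x - y) + N (y - z)"
  using norm_triangle[of "x - y" "y - z"] by (simp add: diff_mem)

lemma norm_le_diff: "x \<in> V \<Longrightarrow> y \<in> V \<Longrightarrow> N x \<le> N y + N (x - y)"
  using norm_triangle[of y "x - y"] by (simp add: diff_mem)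

lemma norm_diff_le: "x \<in> V \<Longrightarrow> y \<in> V \<Longrightarrow> N (x - y) \<le> N x + N y"
  using norm_triangle[of x "- y"] norm_minus[of y] scaleR_mem[of y "-1"] by simp

lemma tendsto_norm_diff:
  assumes "\<And>n::nat. s n \<in> V" "x \<in> V" "y \<in> V" "(\<lambda>n. N (s n - y)) \<longlonglongrightarrow> 0"
  shows "(\<lambda>n. N (x - s n)) \<longlonglongrightarrow> N (x - y)"
proof (rule Lim_transform_bound[THEN LIM_zero_cancel])
  show "\<forall>\<^sub>F n in sequentially. norm (N (x - s n) - N (x - y)) \<le> norm (N (s n - y))"
  proof (rule always_eventually, rule allI)
    fix n
    have "N (x - s n) \<le> N (x - y) + N (y - s n)" "N (x - y) \<le> N (x - s n) + N (s n - y)"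
      using assms by (auto intro: norm_diff_triangle)
    moreover have "N (y - s n) = N (s n - y)" using assms by (auto intro: norm_diff_commute)
    ultimately show "norm (N (x - s n) - N (x - y)) \<le> norm (N (s n - y))"
      by (auto simp: abs_le_iff)
  qed
qed fact

section \<open>Strongly measurable functions and Bochner approximation\<close>

lemma simple_into_mem: "simple_into V M s \<Longrightarrow> \<omega> \<in> space M \<Longrightarrow> s \<omega> \<in> V"
  by (auto simp: simple_into_def)

lemma simple_into_diff: "simple_into V M s \<Longrightarrow> simple_into V M s' \<Longrightarrow> simple_into V M (\<lambda>\<omega>. s \<omega> - s' \<omega>)"
  unfolding simple_into_def image_subset_iff by (simp add: diff_mem simple_function_diff)

lemma simple_into_norm_measurable:
  assumes "simple_into V M s" shows "(\<lambda>\<omega>. N (s \<omega>)) \<in> borel_measurable M"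
  by (rule borel_measurable_simple_function, rule simple_function_compose1[where g = N])
     (use assms in \<open>simp add: simple_into_def\<close>)

lemma simple_vector_integral_mem:
  "simple_into V M s \<Longrightarrow> simple_vector_integral M E s \<in> V"
  unfolding simple_vector_integral_def simple_into_def by (intro sum_mem scaleR_mem) blast

lemma norm_simple_vector_integral_le:
  assumes M: "finite_measure M" and s: "simple_into V M s" and E: "E \<in> sets M"
  shows "ennreal (N (simple_vector_integral M E s)) \<le> (\<integral>\<^sup>+ \<omega>. ennreal (N (s \<omega>)) * indicator E \<omega> \<partial>M)"
proof -
  interpret finite_measure M by fact
  have fin: "finite (s ` space M)" using s by (auto simp: simple_into_def simple_function_def)
  have m: "s -` {i} \<inter> E \<in> sets M" for i
  proof -
    have "s -` {i} \<inter> E = (s -` {i} \<inter> space M) \<inter> E" using sets.sets_into_space[OF E] by auto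
    then show ?thesis using s E by (auto simp: simple_into_def intro: simple_functionD)
  qed
  have V: "v \<in> V" if "v \<in> s ` space M" for v using s that by (auto simp: simple_into_def)
  have "N (simple_vector_integral M E s) \<le> (\<Sum>v\<in>s ` space M. N (measure M (s -` {v} \<inter> E) *\<^sub>R v))"
    unfolding simple_vector_integral_def using V by (intro norm_sum scaleR_mem)
  also have "\<dots> = (\<Sum>v\<in>s ` space M. N v * measure M (s -` {v} \<inter> E))"
    using V by (intro sum.cong) (auto simp: norm_scaleR)
  finally have "ennreal (N (simple_vector_integral M E s)) \<le> ennreal (\<Sum>v\<in>s ` space M. N v * measure M (s -` {v} \<inter> E))"
    by (rule ennreal_leI)
  also have "\<dots> = (\<Sum>v\<in>s ` space M. ennreal (N v) * emeasure M (s -` {v} \<inter> E))"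
    using V by (subst sum_ennreal[symmetric]) (auto simp: norm_nonneg emeasure_eq_measure ennreal_mult)
  also have "\<dots> = (\<integral>\<^sup>+ \<omega>. (\<Sum>v\<in>s ` space M. ennreal (N v) * indicator (s -` {v} \<inter> E) \<omega>) \<partial>M)"
    using m by (subst nn_integral_sum) (auto simp: nn_integral_cmult_indicator)
  also have "\<dots> = (\<integral>\<^sup>+ \<omega>. ennreal (N (s \<omega>)) * indicator E \<omega> \<partial>M)"
  proof (intro nn_integral_cong)
    fix \<omega> assume \<omega>: "\<omega> \<in> space M"
    have "(\<Sum>v\<in>s ` space M. ennreal (N v) * indicator (s -` {v} \<inter> E) \<omega>)
      = (\<Sum>v\<in>s ` space M. if v = s \<omega> then ennreal (N (s \<omega>)) * indicator E \<omega> else 0)"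
      by (intro sum.cong) (auto simp: indicator_def)
    also have "\<dots> = ennreal (N (s \<omega>)) * indicator E \<omega>"
      using fin \<omega> by (simp add: sum.delta)
    finally show "(\<Sum>v\<in>s ` space M. ennreal (N v) * indicator (s -` {v} \<inter> E) \<omega>) = ennreal (N (s \<omega>)) * indicator E \<omega>" .
  qed
  finally show ?thesis .
qed

text \<open>The distance to \<open>g\<close> need not be measurable, since \<open>g\<close> is a
  limit almost everywhere only and \<open>M\<close> need not be complete. An upper limit of simple
  functions replaces it, and such versions give access to additivity and dominated
  convergence.\<close>

lemma norm_diff_measurable_version:
  assumes s: "\<And>n::nat. simple_into V M (s n)" and g: "g ` space M \<subseteq> V"
    and lim: "AE \<omega> in M. (\<lambda>n. N (s n \<omega> - g \<omega>)) \<longlonglongrightarrow> 0"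
    and s': "simple_into V M s'"
  obtains f :: "'b \<Rightarrow> real" where "f \<in> borel_measurable M" "AE \<omega> in M. f \<omega> = N (s' \<omega> - g \<omega>)"
proof
  show "(\<lambda>\<omega>. enn2real (limsup (\<lambda>n. ennreal (N (s' \<omega> - s n \<omega>))))) \<in> borel_measurable M"
    using simple_into_norm_measurable[OF simple_into_diff[OF s' s]] by measurable
  show "AE \<omega> in M. enn2real (limsup (\<lambda>n. ennreal (N (s' \<omega> - s n \<omega>)))) = N (s' \<omega> - g \<omega>)"
    using lim AE_space
  proof eventually_elim
    case (elim \<omega>)
    have mem: "s' \<omega> \<in> V" "g \<omega> \<in> V" "s n \<omega> \<in> V" for n
      using elim g s s' by (auto intro: simple_into_mem)
    have "(\<lambda>n. ennreal (N (s' \<omega> - s n \<omega>))) \<longlonglongrightarrow> ennreal (N (s' \<omega> - g \<omega>))"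
      using mem elim by (intro tendsto_ennrealI tendsto_norm_diff) auto
    then have "limsup (\<lambda>n. ennreal (N (s' \<omega> - s n \<omega>))) = ennreal (N (s' \<omega> - g \<omega>))"
      by (intro lim_imp_Limsup) auto
    then show ?case using mem by (simp add: norm_nonneg diff_mem)
  qed
qed

text \<open>The approximants are replaced by 0 where their norm exceeds \<open>2 * h\<close>, with
  \<open>h\<close> a version of the norm of \<open>g\<close>. The error is then dominated by
  \<open>3 * h\<close>.\<close>

lemma strongly_measurable_bochner_approximation:
  assumes M: "finite_measure M" and g: "strongly_measurable V N M g"
    and fin: "(\<integral>\<^sup>+ \<omega>. ennreal (N (g \<omega>)) \<partial>M) < \<infinity>"
  obtains s where "bochner_approximation V N M g s"
proof -
  from g obtain s where gV: "g ` space M \<subseteq> V" and s: "\<And>n::nat. simple_into V M (s n)"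
    and lim: "AE \<omega> in M. (\<lambda>n. N (s n \<omega> - g \<omega>)) \<longlonglongrightarrow> 0"
    unfolding strongly_measurable_def by blast
  have "simple_into V M (\<lambda>_. 0)" by (simp add: simple_into_def image_subset_iff)
  then obtain h :: "_ \<Rightarrow> real" where h [measurable]: "h \<in> borel_measurable M" and h_eq: "AE \<omega> in M. h \<omega> = N (0 - g \<omega>)"
    using norm_diff_measurable_version[OF s gV lim] by blast
  define s' where "s' n \<omega> = (if N (s n \<omega>) \<le> 2 * h \<omega> then s n \<omega> else 0)" for n \<omega>
  have s': "simple_into V M (s' n)" for n
  proof -
    have [measurable]: "(\<lambda>\<omega>. N (s n \<omega>)) \<in> borel_measurable M" by (rule simple_into_norm_measurable[OF s])
    have "{\<omega> \<in> space M. N (s n \<omega>) \<le> 2 * h \<omega>} \<in> sets M" by measurable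
    then show ?thesis
      using s[of n] unfolding simple_into_def s'_def
      by (auto intro!: simple_function_If)
  qed
  have ex: "\<exists>f. f \<in> borel_measurable M \<and> (AE \<omega> in M. f \<omega> = N (s' n \<omega> - g \<omega>))" for n
    by (rule norm_diff_measurable_version[OF s gV lim s'[of n]]) blast
  then obtain f :: "nat \<Rightarrow> _ \<Rightarrow> real" where f [measurable]: "\<And>n. f n \<in> borel_measurable M"
    and f_eq: "\<And>n. AE \<omega> in M. f n \<omega> = N (s' n \<omega> - g \<omega>)"
    by metis
  have h_eq': "AE \<omega> in M. h \<omega> = N (g \<omega>)"
    using h_eq AE_space by eventually_elim (use gV in \<open>auto simp: norm_minus\<close>)
  have "(\<lambda>n. \<integral>\<^sup>+ \<omega>. ennreal (f n \<omega>) \<partial>M) \<longlonglongrightarrow> (\<integral>\<^sup>+ \<omega>. 0 \<partial>M)"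
  proof (rule nn_integral_dominated_convergence[where w = "\<lambda>\<omega>. ennreal (3 * h \<omega>)"])
    show "AE \<omega> in M. ennreal (f n \<omega>) \<le> ennreal (3 * h \<omega>)" for n
      using f_eq[of n] h_eq' AE_space
    proof eventually_elim
      case (elim \<omega>)
      have mem: "g \<omega> \<in> V" "s' n \<omega> \<in> V" using elim gV s' by (auto intro: simple_into_mem)
      have "N (s' n \<omega>) \<le> 2 * h \<omega>" using elim norm_nonneg[OF mem(1)] by (simp add: s'_def)
      then show ?case using norm_diff_le[OF mem(2,1)] elim by (intro ennreal_leI) simp
    qed
    have "(\<integral>\<^sup>+ \<omega>. ennreal (3 * h \<omega>) \<partial>M) = (\<integral>\<^sup>+ \<omega>. ennreal 3 * ennreal (h \<omega>) \<partial>M)"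
      by (simp add: ennreal_mult')
    also have "\<dots> = ennreal 3 * (\<integral>\<^sup>+ \<omega>. ennreal (h \<omega>) \<partial>M)"
      by (intro nn_integral_cmult) measurable
    also have "(\<integral>\<^sup>+ \<omega>. ennreal (h \<omega>) \<partial>M) = (\<integral>\<^sup>+ \<omega>. ennreal (N (g \<omega>)) \<partial>M)"
      using h_eq' by (intro nn_integral_cong_AE) (auto elim: eventually_mono)
    finally show "(\<integral>\<^sup>+ \<omega>. ennreal (3 * h \<omega>) \<partial>M) < \<infinity>"
      using fin by (simp add: ennreal_mult_less_top)
    have "AE \<omega> in M. \<forall>n. f n \<omega> = N (s' n \<omega> - g \<omega>)"
      using f_eq by (simp add: AE_all_countable)
    then show "AE \<omega> in M. (\<lambda>n. ennreal (f n \<omega>)) \<longlonglongrightarrow> 0"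
      using h_eq' lim AE_space
    proof eventually_elim
      case (elim \<omega>)
      have mem: "g \<omega> \<in> V" "s n \<omega> \<in> V" for n using elim gV s by (auto intro: simple_into_mem)
      \<comment> \<open>Where \<open>g\<close> does not vanish, the cut is eventually inactive,
        because the norms of \<open>s n \<omega>\<close> tend to that of \<open>g \<omega>\<close>.
        Where \<open>g\<close> vanishes, the cut leaves only the value 0.\<close>
      have "(\<lambda>n. N (s' n \<omega> - g \<omega>)) \<longlonglongrightarrow> 0"
      proof (cases "N (g \<omega>) = 0")
        case True
        have "N (s' n \<omega> - g \<omega>) = 0" for n
        proof -
          have "N (s' n \<omega>) = 0"
            using True elim mem norm_nonneg[OF mem(2)[of n]] by (auto simp: s'_def)
          moreover have "s' n \<omega> \<in> V" using mem by (simp add: s'_def)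
          ultimately show ?thesis
            using True norm_definite mem by (metis diff_self)
        qed
        then show ?thesis by simp
      next
        case False
        then have p: "0 < N (g \<omega>)" using norm_nonneg[OF mem(1)] by simp
        have "\<forall>\<^sub>F n in sequentially. N (s n \<omega> - g \<omega>) < N (g \<omega>)"
          using elim p by (intro order_tendstoD) auto
        then have "\<forall>\<^sub>F n in sequentially. N (s n \<omega> - g \<omega>) = N (s' n \<omega> - g \<omega>)"
        proof eventually_elim
          case (elim n)
          then have "N (s n \<omega>) \<le> 2 * N (g \<omega>)"
            using norm_le_diff[OF mem(2) mem(1), of n] by simp
          then show ?case using \<open>h \<omega> = _\<close> by (simp add: s'_def)
        qed
        then show ?thesis using elim(3) by (rule Lim_transform_eventually[rotated])
      qed
      then have "(\<lambda>n. ennreal (N (s' n \<omega> - g \<omega>))) \<longlonglongrightarrow> ennreal 0"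
        by (rule tendsto_ennrealI)
      then show ?case using elim by simp
    qed
  qed measurable
  moreover have "(\<integral>\<^sup>+ \<omega>. ennreal (f n \<omega>) \<partial>M) = (\<integral>\<^sup>+ \<omega>. ennreal (N (s' n \<omega> - g \<omega>)) \<partial>M)" for n
    using f_eq[of n] by (intro nn_integral_cong_AE) (auto elim: eventually_mono)
  ultimately have "bochner_approximation V N M g s'"
    using s' by (simp add: bochner_approximation_def)
  then show ?thesis by (rule that)
qed

text \<open>A diagonal sequence. The index \<open>n k\<close> makes the integral of the distance
  from \<open>s k (n k)\<close> to \<open>h k\<close>, capped at 1 for want of integrability, less
  than \<open>(1/2) ^ k\<close>. The sum over \<open>k\<close> is finite almost everywhere, so the
  distances tend to 0.\<close>

lemma strongly_measurable_limit:
  assumes M: "finite_measure M" and h: "\<And>k::nat. strongly_measurable V N M (h k)"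
    and g: "g ` space M \<subseteq> V" and lim: "AE \<omega> in M. (\<lambda>k. N (h k \<omega> - g \<omega>)) \<longlonglongrightarrow> 0"
  shows "strongly_measurable V N M g"
proof -
  interpret finite_measure M by fact
  have hV: "h k ` space M \<subseteq> V" for k using h[of k] by (simp add: strongly_measurable_def)
  have "\<exists>s. (\<forall>n::nat. simple_into V M (s n)) \<and> (AE \<omega> in M. (\<lambda>n. N (s n \<omega> - h k \<omega>)) \<longlonglongrightarrow> 0)" for k
    using h[of k] by (simp add: strongly_measurable_def)
  then have "\<forall>k. \<exists>s. (\<forall>n::nat. simple_into V M (s n)) \<and> (AE \<omega> in M. (\<lambda>n. N (s n \<omega> - h k \<omega>)) \<longlonglongrightarrow> 0)"
    by blast
  from choice[OF this] obtain s where s: "\<And>k n::nat. simple_into V M (s k n)"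
    and slim: "\<And>k. AE \<omega> in M. (\<lambda>n. N (s k n \<omega> - h k \<omega>)) \<longlonglongrightarrow> 0"
    by blast
  have "\<exists>f. f \<in> borel_measurable M \<and> (AE \<omega> in M. f \<omega> = N (s k n \<omega> - h k \<omega>))" for k n
    by (rule norm_diff_measurable_version[OF s[of k] hV slim s[of k n]]) blast
  then obtain f :: "nat \<Rightarrow> nat \<Rightarrow> _ \<Rightarrow> real" where f [measurable]: "\<And>k n. f k n \<in> borel_measurable M"
    and f_eq: "\<And>k n. AE \<omega> in M. f k n \<omega> = N (s k n \<omega> - h k \<omega>)"
    by metis
  have "(\<lambda>n. \<integral>\<^sup>+ \<omega>. ennreal (min 1 (f k n \<omega>)) \<partial>M) \<longlonglongrightarrow> (\<integral>\<^sup>+ \<omega>. 0 \<partial>M)" for k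
  proof (rule nn_integral_dominated_convergence[where w = "\<lambda>\<omega>. 1"])
    show "AE \<omega> in M. ennreal (min 1 (f k n \<omega>)) \<le> 1" for n
      by (auto simp: ennreal_le_1)
    show "(\<integral>\<^sup>+ \<omega>. 1 \<partial>M) < \<infinity>" by (simp add: less_top[symmetric])
    have "AE \<omega> in M. \<forall>n. f k n \<omega> = N (s k n \<omega> - h k \<omega>)"
      using f_eq by (simp add: AE_all_countable)
    then show "AE \<omega> in M. (\<lambda>n. ennreal (min 1 (f k n \<omega>))) \<longlonglongrightarrow> 0"
      using slim[of k]
    proof eventually_elim
      case (elim \<omega>)
      then have "(\<lambda>n. min 1 (f k n \<omega>)) \<longlonglongrightarrow> min 1 0" by (intro tendsto_min) auto
      then have "(\<lambda>n. ennreal (min 1 (f k n \<omega>))) \<longlonglongrightarrow> ennreal (min 1 0)" by (rule tendsto_ennrealI)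
      then show ?case by simp
    qed
  qed measurable
  then have "\<forall>\<^sub>F n in sequentially. (\<integral>\<^sup>+ \<omega>. ennreal (min 1 (f k n \<omega>)) \<partial>M) < ennreal ((1/2) ^ k)" for k
    by (rule order_tendstoD) simp
  then have "\<exists>n. (\<integral>\<^sup>+ \<omega>. ennreal (min 1 (f k n \<omega>)) \<partial>M) < ennreal ((1/2) ^ k)" for k
    by (meson eventually_sequentially order_refl)
  then obtain n where n: "\<And>k. (\<integral>\<^sup>+ \<omega>. ennreal (min 1 (f k (n k) \<omega>)) \<partial>M) < ennreal ((1/2) ^ k)"
    by metis
  have "(\<integral>\<^sup>+ \<omega>. (\<Sum>k. ennreal (min 1 (f k (n k) \<omega>))) \<partial>M) = (\<Sum>k. \<integral>\<^sup>+ \<omega>. ennreal (min 1 (f k (n k) \<omega>)) \<partial>M)"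
    by (rule nn_integral_suminf) measurable
  also have "\<dots> \<le> (\<Sum>k. ennreal ((1/2) ^ k))"
    using n by (intro suminf_le) (auto simp: less_imp_le)
  also have "\<dots> < \<infinity>"
    by (subst suminf_ennreal2) auto
  finally have "AE \<omega> in M. (\<Sum>k. ennreal (min 1 (f k (n k) \<omega>))) \<noteq> \<infinity>"
    by (intro nn_integral_noteq_infinite) auto
  moreover have "AE \<omega> in M. \<forall>k. f k (n k) \<omega> = N (s k (n k) \<omega> - h k \<omega>)"
    using f_eq by (simp add: AE_all_countable)
  ultimately have "AE \<omega> in M. (\<lambda>k. N (s k (n k) \<omega> - g \<omega>)) \<longlonglongrightarrow> 0"
    using lim AE_space
  proof eventually_elim
    case (elim \<omega>)
    have mem: "s k (n k) \<omega> \<in> V" "h k \<omega> \<in> V" "g \<omega> \<in> V" for k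
      using elim(4) g hV[of k] simple_into_mem[OF s[of k "n k"]] by auto
    have nn: "0 \<le> f k (n k) \<omega>" for k using elim mem by (simp add: norm_nonneg diff_mem)
    have "summable (\<lambda>k. min 1 (f k (n k) \<omega>))"
      using elim nn by (intro summable_suminf_not_top) auto
    then have "(\<lambda>k. min 1 (f k (n k) \<omega>)) \<longlonglongrightarrow> 0" by (rule summable_LIMSEQ_zero)
    moreover from this have "\<forall>\<^sub>F k in sequentially. min 1 (f k (n k) \<omega>) < 1"
      by (rule order_tendstoD) simp
    then have "\<forall>\<^sub>F k in sequentially. min 1 (f k (n k) \<omega>) = N (s k (n k) \<omega> - h k \<omega>)"
      by eventually_elim (use elim in \<open>auto simp: min_def split: if_splits\<close>)
    ultimately have "(\<lambda>k. N (s k (n k) \<omega> - h k \<omega>)) \<longlonglongrightarrow> 0"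
      by (rule Lim_transform_eventually)
    then have sum: "(\<lambda>k. N (s k (n k) \<omega> - h k \<omega>) + N (h k \<omega> - g \<omega>)) \<longlonglongrightarrow> 0"
      using tendsto_add[of _ 0 sequentially "\<lambda>k. N (h k \<omega> - g \<omega>)" 0] elim(3) by simp
    show ?case
    proof (rule tendsto_sandwich[OF _ _ tendsto_const sum])
      show "\<forall>\<^sub>F k in sequentially. 0 \<le> N (s k (n k) \<omega> - g \<omega>)"
        using mem by (intro always_eventually allI norm_nonneg diff_mem)
      show "\<forall>\<^sub>F k in sequentially. N (s k (n k) \<omega> - g \<omega>) \<le> N (s k (n k) \<omega> - h k \<omega>) + N (h k \<omega> - g \<omega>)"
        using mem by (intro always_eventually allI norm_diff_triangle)
    qed
  qed
  then show ?thesis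
    using g s unfolding strongly_measurable_def by (intro conjI exI[of _ "\<lambda>k. s k (n k)"]) auto
qed

text \<open>The indicator is kept on the first error term only: in the applications the second term
  tends to 0, while the first may have to be small relative to the measure of
  \<open>E\<close>.\<close>

lemma norm_integral_diff_le:
  assumes M: "finite_measure M" and g: "strongly_measurable V N M g"
    and s: "simple_into V M s" "simple_into V M s'" and E: "E \<in> sets M"
  shows "ennreal (N (simple_vector_integral M E s - simple_vector_integral M E s'))
    \<le> (\<integral>\<^sup>+ \<omega>. ennreal (N (s \<omega> - g \<omega>)) * indicator E \<omega> \<partial>M) + (\<integral>\<^sup>+ \<omega>. ennreal (N (s' \<omega> - g \<omega>)) \<partial>M)"
proof -
  interpret finite_measure M by fact
  from g obtain t where gV: "g ` space M \<subseteq> V" and t: "\<And>n::nat. simple_into V M (t n)"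
    and lim: "AE \<omega> in M. (\<lambda>n. N (t n \<omega> - g \<omega>)) \<longlonglongrightarrow> 0"
    unfolding strongly_measurable_def by blast
  obtain f :: "_ \<Rightarrow> real" where f[measurable]: "f \<in> borel_measurable M" and f_eq: "AE \<omega> in M. f \<omega> = N (s \<omega> - g \<omega>)"
    using norm_diff_measurable_version[OF t gV lim s(1)] by blast
  obtain f' :: "_ \<Rightarrow> real" where f'[measurable]: "f' \<in> borel_measurable M" and f'_eq: "AE \<omega> in M. f' \<omega> = N (s' \<omega> - g \<omega>)"
    using norm_diff_measurable_version[OF t gV lim s(2)] by blast
  note E[measurable]
  have "ennreal (N (simple_vector_integral M E s - simple_vector_integral M E s'))
      = ennreal (N (simple_vector_integral M E (\<lambda>\<omega>. s \<omega> - s' \<omega>)))"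
    using s E by (simp add: simple_vector_integral_diff simple_into_def)
  also have "\<dots> \<le> (\<integral>\<^sup>+ \<omega>. ennreal (N (s \<omega> - s' \<omega>)) * indicator E \<omega> \<partial>M)"
    by (intro norm_simple_vector_integral_le M simple_into_diff s E)
  also have "\<dots> \<le> (\<integral>\<^sup>+ \<omega>. ennreal (f \<omega>) * indicator E \<omega> + ennreal (f' \<omega>) \<partial>M)"
  proof (rule nn_integral_mono_AE)
    show "AE \<omega> in M. ennreal (N (s \<omega> - s' \<omega>)) * indicator E \<omega> \<le> ennreal (f \<omega>) * indicator E \<omega> + ennreal (f' \<omega>)"
      using f_eq f'_eq AE_space
    proof eventually_elim
      case (elim \<omega>)
      have mem: "s \<omega> \<in> V" "s' \<omega> \<in> V" "g \<omega> \<in> V" using elim gV s by (auto intro: simple_into_mem)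
      have "N (s \<omega> - s' \<omega>) \<le> f \<omega> + f' \<omega>"
        using norm_diff_triangle[of "s \<omega>" "g \<omega>" "s' \<omega>"] norm_diff_commute[of "g \<omega>" "s' \<omega>"] mem elim by simp
      then have "ennreal (N (s \<omega> - s' \<omega>)) \<le> ennreal (f \<omega>) + ennreal (f' \<omega>)"
      proof -
        have "ennreal (f \<omega>) + ennreal (f' \<omega>) = ennreal (f \<omega> + f' \<omega>)"
          using elim mem by (simp add: norm_nonneg diff_mem)
        then show ?thesis using \<open>N (s \<omega> - s' \<omega>) \<le> _\<close> by (simp add: ennreal_leI)
      qed
      then show ?case by (auto simp: indicator_def)
    qed
  qed
  also have "\<dots> = (\<integral>\<^sup>+ \<omega>. ennreal (f \<omega>) * indicator E \<omega> \<partial>M) + (\<integral>\<^sup>+ \<omega>. ennreal (f' \<omega>) \<partial>M)"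
    by (rule nn_integral_add) measurable
  also have "(\<integral>\<^sup>+ \<omega>. ennreal (f \<omega>) * indicator E \<omega> \<partial>M) = (\<integral>\<^sup>+ \<omega>. ennreal (N (s \<omega> - g \<omega>)) * indicator E \<omega> \<partial>M)"
    using f_eq by (intro nn_integral_cong_AE) (auto elim: eventually_mono)
  also have "(\<integral>\<^sup>+ \<omega>. ennreal (f' \<omega>) \<partial>M) = (\<integral>\<^sup>+ \<omega>. ennreal (N (s' \<omega> - g \<omega>)) \<partial>M)"
    using f'_eq by (intro nn_integral_cong_AE) (auto elim: eventually_mono)
  finally show ?thesis .
qed

text \<open>On bounded sequences \<open>Y\<close> is an isomorphic embedding of l^\<infinity>, and
  \<open>r_null\<close> is the Riemann-Lebesgue property of the functions \<open>r n\<close>. The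
  single estimate \<open>N (G E) \<le> measure M E\<close> yields countable additivity, continuity
  and bounded variation.\<close>

lemma no_radon_nikodym_property:
  fixes M :: "'b measure" and r :: "nat \<Rightarrow> 'b \<Rightarrow> real" and Y :: "(nat \<Rightarrow> real) \<Rightarrow> 'v"
  assumes M: "finite_measure M" and pos: "0 < measure M (space M)"
    and r [measurable]: "\<And>n. r n \<in> borel_measurable M"
    and r_sign: "\<And>n \<omega>. \<omega> \<in> space M \<Longrightarrow> r n \<omega> = 1 \<or> r n \<omega> = -1"
    and r_null: "\<And>A. A \<in> sets M \<Longrightarrow> (\<lambda>n. \<integral>\<omega>. indicator A \<omega> * r n \<omega> \<partial>M) \<longlonglongrightarrow> 0"
    and Y_add: "\<And>a b. Y (\<lambda>n. a n + b n) = Y a + Y b" and Y_scaleR: "\<And>c a. Y (\<lambda>n. c * a n) = c *\<^sub>R Y a"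
    and Y_upper: "\<And>C a. 0 \<le> C \<Longrightarrow> (\<And>n. \<bar>a n\<bar> \<le> C) \<Longrightarrow> Y a \<in> V \<and> N (Y a) \<le> C"
    and c: "0 < c" and Y_lower: "\<And>C a n. (\<And>n. \<bar>a n\<bar> \<le> C) \<Longrightarrow> c * \<bar>a n\<bar> \<le> N (Y a)"
  shows "\<not> radon_nikodym_property TYPE('b) V N"
proof
  assume RNP: "radon_nikodym_property TYPE('b) V N"
  interpret finite_measure M by fact
  define a where "a E n = (\<integral>\<omega>. indicator E \<omega> * r n \<omega> \<partial>M)" for E n
  define G where "G E = Y (a E)" for E
  have r_bound: "\<bar>r n \<omega>\<bar> \<le> 1" if "\<omega> \<in> space M" for n \<omega>
    using r_sign[OF that, of n] by auto
  have int: "integrable M (\<lambda>\<omega>. indicator E \<omega> * r n \<omega>)" if [measurable]: "E \<in> sets M" for E n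
  proof (rule integrable_const_bound[where B = 1])
    show "AE \<omega> in M. norm (indicator E \<omega> * r n \<omega>) \<le> 1"
      using r_bound by (intro AE_I2) (auto simp: indicator_def)
  qed measurable
  have a_bound: "\<bar>a E n\<bar> \<le> measure M E" if E[measurable]: "E \<in> sets M" for E n
  proof -
    have "norm (a E n) \<le> (\<integral>\<omega>. norm (indicator E \<omega> * r n \<omega>) \<partial>M)"
      unfolding a_def by (rule integral_norm_bound)
    also have "\<dots> \<le> (\<integral>\<omega>. indicator E \<omega> \<partial>M)"
    proof (intro integral_mono integrable_norm int E)
      show "integrable M (indicator E :: 'b \<Rightarrow> real)"
        using E by (intro integrable_real_indicator) (auto simp: less_top[symmetric])
      show "norm (indicator E \<omega> * r n \<omega>) \<le> indicator E \<omega>" if "\<omega> \<in> space M" for \<omega>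
        using r_bound[OF that, of n] by (auto simp: indicator_def)
    qed
    also have "\<dots> = measure M E" using sets.sets_into_space[OF E] by (simp add: Int_absorb2)
    finally show ?thesis by simp
  qed
  have Y_zero: "Y (\<lambda>n. 0) = 0" using Y_scaleR[of 0 "\<lambda>n. 0"] by simp
  have Y_sum: "Y (\<lambda>n. \<Sum>i<k. b i n) = (\<Sum>i<k. Y (b i))" for b :: "nat \<Rightarrow> nat \<Rightarrow> real" and k :: nat
    by (induction k) (simp_all add: Y_zero Y_add)
  have Y_diff: "Y (\<lambda>n. p n - q n) = Y p - Y q" for p q
    using Y_add[of p "\<lambda>n. (-1) * q n"] Y_scaleR[of "-1" q] by simp
  have G_bound: "G E \<in> V" "N (G E) \<le> measure M E" if "E \<in> sets M" for E
    using Y_upper[of "measure M E" "a E"] a_bound[OF that] by (auto simp: G_def)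
  have vm: "vector_measure V N M G"
    unfolding vector_measure_def
  proof (intro conjI ballI allI impI)
    fix A :: "nat \<Rightarrow> 'b set" assume A: "range A \<subseteq> sets M \<and> disjoint_family A"
    then have Am [measurable]: "A i \<in> sets M" for i by auto
    have dA: "disjoint_family A" using A by simp
    \<comment> \<open>The error in countable additivity is the value of \<open>G\<close> on a
      remainder set, whose measure tends to 0.\<close>
    define R where "R k = (\<Union>i. A i) - (\<Union>i<k. A i)" for k :: nat
    have Rm [measurable]: "R k \<in> sets M" for k unfolding R_def by measurable
    have ind: "indicator (\<Union>i. A i) \<omega> = (\<Sum>i<k. indicator (A i) \<omega>) + (indicator (R k) \<omega> :: real)" for k \<omega>
    proof -
      have "(\<Sum>i<k. indicator (A i) \<omega>) = (indicator (\<Union>i<k. A i) \<omega> :: real)"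
        using dA by (intro indicator_UN_disjoint[symmetric]) (auto simp: disjoint_family_on_def)
      then show ?thesis by (auto simp: R_def indicator_def)
    qed
    have split: "a (\<Union>i. A i) n = (\<Sum>i<k. a (A i) n) + a (R k) n" for k n
    proof -
      have "a (\<Union>i. A i) n = (\<integral>\<omega>. (\<Sum>i<k. indicator (A i) \<omega> * r n \<omega>) + indicator (R k) \<omega> * r n \<omega> \<partial>M)"
        unfolding a_def by (simp only: ind[of _ k] distrib_right sum_distrib_right)
      also have "\<dots> = (\<integral>\<omega>. (\<Sum>i<k. indicator (A i) \<omega> * r n \<omega>) \<partial>M) + a (R k) n"
        unfolding a_def by (intro Bochner_Integration.integral_add Bochner_Integration.integrable_sum int Am Rm)
      also have "(\<integral>\<omega>. (\<Sum>i<k. indicator (A i) \<omega> * r n \<omega>) \<partial>M) = (\<Sum>i<k. a (A i) n)"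
        unfolding a_def by (intro Bochner_Integration.integral_sum int Am)
      finally show ?thesis .
    qed
    have meas: "measure M (\<Union>i. A i) = (\<Sum>i<k. measure M (A i)) + measure M (R k)" for k
    proof -
      have "measure M (R k) = measure M (\<Union>i. A i) - measure M (\<Union>i<k. A i)"
        unfolding R_def by (rule finite_measure_Diff) auto
      moreover have "measure M (\<Union>i<k. A i) = (\<Sum>i<k. measure M (A i))"
        using dA by (intro finite_measure_finite_Union) (auto simp: disjoint_family_on_def)
      ultimately show ?thesis by simp
    qed
    have le: "N ((\<Sum>i<k. G (A i)) - G (\<Union>i. A i)) \<le> measure M (\<Union>i. A i) - (\<Sum>i<k. measure M (A i))" for k
    proof -
      have "(\<Sum>i<k. G (A i)) - G (\<Union>i. A i) = Y (\<lambda>n. (\<Sum>i<k. a (A i) n) - a (\<Union>i. A i) n)"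
        by (simp add: G_def Y_sum Y_diff)
      also have "\<dots> = - G (R k)"
        using Y_scaleR[of "-1" "a (R k)"] by (simp add: split[of _ k] G_def)
      finally show ?thesis using G_bound[OF Rm[of k]] meas[of k] by (simp add: norm_minus)
    qed
    have sums: "(\<lambda>k. \<Sum>i<k. measure M (A i)) \<longlonglongrightarrow> measure M (\<Union>i. A i)"
      using finite_measure_UNION[of A] A by (simp add: sums_def)
    have lim: "(\<lambda>k. measure M (\<Union>i. A i) - (\<Sum>i<k. measure M (A i))) \<longlonglongrightarrow> 0"
      using tendsto_diff[OF tendsto_const sums, of "measure M (\<Union>i. A i)"] by simp
    show "(\<lambda>k. N ((\<Sum>i<k. G (A i)) - G (\<Union>i. A i))) \<longlonglongrightarrow> 0"
    proof (rule tendsto_sandwich[OF _ _ tendsto_const lim])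
      show "\<forall>\<^sub>F k in sequentially. 0 \<le> N ((\<Sum>i<k. G (A i)) - G (\<Union>i. A i))"
        by (intro always_eventually allI norm_nonneg diff_mem sum_mem G_bound) auto
      show "\<forall>\<^sub>F k in sequentially. N ((\<Sum>i<k. G (A i)) - G (\<Union>i. A i)) \<le> measure M (\<Union>i. A i) - (\<Sum>i<k. measure M (A i))"
        by (intro always_eventually allI le)
    qed
  qed (rule G_bound)
  have cont: "continuous_wrt N M G"
    unfolding continuous_wrt_def using G_bound(2) by (meson le_less_trans)
  have bv: "bounded_variation N M G"
    unfolding bounded_variation_def
  proof (intro exI allI impI)
    fix P assume P: "finite P \<and> P \<subseteq> sets M \<and> partition_on (space M) P"
    have "(\<Sum>E\<in>P. N (G E)) \<le> (\<Sum>E\<in>P. measure M E)"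
      using P by (intro sum_mono G_bound(2)) auto
    also have "\<dots> = measure M (\<Union>E\<in>P. E)"
      using P by (intro finite_measure_finite_Union[symmetric])
        (auto simp: disjoint_family_on_def partition_on_def disjoint_def)
    also have "\<dots> \<le> measure M (space M)" by (rule bounded_measure)
    finally show "(\<Sum>E\<in>P. N (G E)) \<le> measure M (space M)" .
  qed
  from RNP M vm cont bv obtain g where g: "bochner_integrable V N M g"
    and gint: "\<And>E. E \<in> sets M \<Longrightarrow> has_bochner_integral_on V N M g E (G E)"
    unfolding radon_nikodym_property_def by blast
  have gs: "strongly_measurable V N M g" using g by (simp add: bochner_integrable_def)
  from g obtain s0 where s0: "bochner_approximation V N M g s0" by (auto simp: bochner_integrable_def)
  \<comment> \<open>Any positive number below \<open>c\<close> would serve: the argument ends in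
    \<open>c * measure M (A v) \<le> e * measure M (A v)\<close>.\<close>
  define e where "e = c / 4"
  have e: "0 < e" using c by (simp add: e_def)
  have "\<forall>\<^sub>F n in sequentially. (\<integral>\<^sup>+ \<omega>. ennreal (N (s0 n \<omega> - g \<omega>)) \<partial>M) < ennreal (e * measure M (space M))"
    using s0 e pos unfolding bochner_approximation_def by (intro order_tendstoD) auto
  then obtain n0 where n0: "(\<integral>\<^sup>+ \<omega>. ennreal (N (s0 n0 \<omega> - g \<omega>)) \<partial>M) < ennreal (e * measure M (space M))"
    by (meson eventually_sequentially order_refl)
  define s where "s = s0 n0"
  have s: "simple_into V M s" using s0 by (simp add: s_def bochner_approximation_def)
  \<comment> \<open>The fixed function \<open>s\<close> is compared with approximants
    \<open>t n\<close> whose integrals over \<open>E\<close> tend to \<open>G E\<close>; their error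
    terms vanish in the limit.\<close>
  have close: "ennreal (N (simple_vector_integral M E s - G E)) \<le> (\<integral>\<^sup>+ \<omega>. ennreal (N (s \<omega> - g \<omega>)) * indicator E \<omega> \<partial>M)"
    if E: "E \<in> sets M" for E
  proof -
    from gint[OF E] obtain t where t: "bochner_approximation V N M g t"
      and tlim: "(\<lambda>n. N (simple_vector_integral M E (t n) - G E)) \<longlonglongrightarrow> 0"
      by (auto simp: has_bochner_integral_on_def)
    have ts: "simple_into V M (t n)" for n using t by (simp add: bochner_approximation_def)
    have "(\<lambda>n. N (simple_vector_integral M E s - simple_vector_integral M E (t n))) \<longlonglongrightarrow> N (simple_vector_integral M E s - G E)"
      by (intro tendsto_norm_diff tlim simple_vector_integral_mem[OF ts] simple_vector_integral_mem[OF s] G_bound E)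
    then have l: "(\<lambda>n. ennreal (N (simple_vector_integral M E s - simple_vector_integral M E (t n)))) \<longlonglongrightarrow> ennreal (N (simple_vector_integral M E s - G E))"
      by (rule tendsto_ennrealI)
    have r': "(\<lambda>n. (\<integral>\<^sup>+ \<omega>. ennreal (N (s \<omega> - g \<omega>)) * indicator E \<omega> \<partial>M) + (\<integral>\<^sup>+ \<omega>. ennreal (N (t n \<omega> - g \<omega>)) \<partial>M))
       \<longlonglongrightarrow> (\<integral>\<^sup>+ \<omega>. ennreal (N (s \<omega> - g \<omega>)) * indicator E \<omega> \<partial>M) + 0"
      using t by (intro tendsto_add tendsto_const) (simp add: bochner_approximation_def)
    have "ennreal (N (simple_vector_integral M E s - G E)) \<le> (\<integral>\<^sup>+ \<omega>. ennreal (N (s \<omega> - g \<omega>)) * indicator E \<omega> \<partial>M) + 0"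
      by (rule LIMSEQ_le[OF l r']) (use norm_integral_diff_le[OF M gs s ts E] in blast)
    then show ?thesis by simp
  qed
  from gs obtain t where gV: "g ` space M \<subseteq> V" and t: "\<And>n::nat. simple_into V M (t n)"
    and lim: "AE \<omega> in M. (\<lambda>n. N (t n \<omega> - g \<omega>)) \<longlonglongrightarrow> 0"
    unfolding strongly_measurable_def by blast
  obtain f :: "_ \<Rightarrow> real" where f[measurable]: "f \<in> borel_measurable M" and f_eq: "AE \<omega> in M. f \<omega> = N (s \<omega> - g \<omega>)"
    by (rule norm_diff_measurable_version[OF t gV lim s]) blast
  have f_int: "(\<integral>\<^sup>+ \<omega>. ennreal (N (s \<omega> - g \<omega>)) * indicator E \<omega> \<partial>M) = (\<integral>\<^sup>+ \<omega>. ennreal (f \<omega>) * indicator E \<omega> \<partial>M)" for E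
    using f_eq by (intro nn_integral_cong_AE) (auto elim: eventually_mono)
  have s_fun: "simple_function M s" using s by (simp add: simple_into_def)
  have fin: "finite (s ` space M)" using s_fun by (rule simple_functionD)
  define A where "A v = s -` {v} \<inter> space M" for v
  have Am [measurable]: "A v \<in> sets M" for v unfolding A_def by (rule simple_functionD[OF s_fun])
  \<comment> \<open>on one of the level sets of \<open>s\<close> the average of \<open>N (s - g)\<close> is at most \<open>e\<close>\<close>
  have "\<exists>v\<in>s ` space M. (\<integral>\<^sup>+ \<omega>. ennreal (f \<omega>) * indicator (A v) \<omega> \<partial>M) < ennreal (e * measure M (A v))"
  proof (rule ccontr)
    assume "\<not> ?thesis"
    then have ge: "ennreal (e * measure M (A v)) \<le> (\<integral>\<^sup>+ \<omega>. ennreal (f \<omega>) * indicator (A v) \<omega> \<partial>M)" if "v \<in> s ` space M" for v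
      using that by (auto simp: not_less)
    have "space M = (\<Union>v\<in>s ` space M. A v)" by (auto simp: A_def)
    then have "measure M (space M) = measure M (\<Union>v\<in>s ` space M. A v)" by simp
    also have "\<dots> = (\<Sum>v\<in>s ` space M. measure M (A v))"
    proof (intro finite_measure_finite_Union fin)
      show "A ` s ` space M \<subseteq> sets M" using Am by blast
      show "disjoint_family_on A (s ` space M)" by (auto simp: disjoint_family_on_def A_def)
    qed
    finally have "ennreal (e * measure M (space M)) = (\<Sum>v\<in>s ` space M. ennreal (e * measure M (A v)))"
      using e by (simp add: sum_distrib_left)
    also have "\<dots> \<le> (\<Sum>v\<in>s ` space M. \<integral>\<^sup>+ \<omega>. ennreal (f \<omega>) * indicator (A v) \<omega> \<partial>M)"
      by (intro sum_mono ge)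
    also have "\<dots> = (\<integral>\<^sup>+ \<omega>. (\<Sum>v\<in>s ` space M. ennreal (f \<omega>) * indicator (A v) \<omega>) \<partial>M)"
      by (rule nn_integral_sum[symmetric]) measurable
    also have "\<dots> = (\<integral>\<^sup>+ \<omega>. ennreal (f \<omega>) \<partial>M)"
    proof (intro nn_integral_cong)
      fix \<omega> assume \<omega>: "\<omega> \<in> space M"
      have "(\<Sum>v\<in>s ` space M. ennreal (f \<omega>) * indicator (A v) \<omega>) = (\<Sum>v\<in>s ` space M. if v = s \<omega> then ennreal (f \<omega>) else 0)"
        using \<omega> by (intro sum.cong) (auto simp: A_def indicator_def)
      also have "\<dots> = ennreal (f \<omega>)" using fin \<omega> by (simp add: sum.delta)
      finally show "(\<Sum>v\<in>s ` space M. ennreal (f \<omega>) * indicator (A v) \<omega>) = ennreal (f \<omega>)" .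
    qed
    also have "\<dots> = (\<integral>\<^sup>+ \<omega>. ennreal (N (s \<omega> - g \<omega>)) \<partial>M)"
      using f_eq by (intro nn_integral_cong_AE) (auto elim: eventually_mono)
    finally show False using n0 by (simp add: s_def)
  qed
  then obtain v where v: "v \<in> s ` space M"
    and small: "(\<integral>\<^sup>+ \<omega>. ennreal (f \<omega>) * indicator (A v) \<omega> \<partial>M) < ennreal (e * measure M (A v))" by blast
  have vV: "v \<in> V" using v s by (auto simp: simple_into_def)
  have mpos: "0 < measure M (A v)"
    using small e by (cases "measure M (A v) = 0") (auto simp: less_le)
  have svi: "simple_vector_integral M E s = measure M E *\<^sub>R v" if E: "E \<in> sets M" "E \<subseteq> A v" for E
  proof -
    have "simple_vector_integral M E s = (\<Sum>u\<in>s ` space M. if u = v then measure M E *\<^sub>R v else 0)"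
      unfolding simple_vector_integral_def
    proof (intro sum.cong refl)
      fix u
      have "s -` {u} \<inter> E = (if u = v then E else {})" using E(2) by (auto simp: A_def)
      then show "measure M (s -` {u} \<inter> E) *\<^sub>R u = (if u = v then measure M E *\<^sub>R v else 0)" by simp
    qed
    then show ?thesis using fin v by (simp add: sum.delta)
  qed
  \<comment> \<open>The \<open>n\<close>-th coefficient of \<open>G E - G F\<close> is the full
    measure of \<open>A v\<close>. On the other hand the density is close to \<open>v\<close> on
    both halves, which leaves only \<open>a (A v) n *\<^sub>R v\<close> and an error of
    \<open>e * measure M (A v)\<close>.\<close>
  have key: "c * measure M (A v) \<le> e * measure M (A v) + \<bar>a (A v) n\<bar> * N v" for n
  proof -
    define E where "E = {\<omega> \<in> space M. \<omega> \<in> A v \<and> r n \<omega> = 1}"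
    define F where "F = {\<omega> \<in> space M. \<omega> \<in> A v \<and> r n \<omega> = -1}"
    have Em [measurable]: "E \<in> sets M" unfolding E_def by measurable
    have Fm [measurable]: "F \<in> sets M" unfolding F_def by measurable
    have sub: "E \<subseteq> A v" "F \<subseteq> A v" by (auto simp: E_def F_def)
    have ind: "indicator (A v) \<omega> = indicator E \<omega> + (indicator F \<omega> :: ennreal)" if "\<omega> \<in> space M" for \<omega>
      using r_sign[OF that, of n] that by (auto simp: E_def F_def indicator_def)
    have aE: "a E n = measure M E"
    proof -
      have "a E n = (\<integral>\<omega>. indicator E \<omega> \<partial>M)"
        unfolding a_def by (intro Bochner_Integration.integral_cong) (auto simp: E_def indicator_def)
      then show ?thesis using sets.sets_into_space[OF Em] by (simp add: Int_absorb2)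
    qed
    have aF: "a F n = - measure M F"
    proof -
      have "a F n = (\<integral>\<omega>. - indicator F \<omega> \<partial>M)"
        unfolding a_def by (intro Bochner_Integration.integral_cong) (auto simp: F_def indicator_def)
      then show ?thesis using sets.sets_into_space[OF Fm] by (simp add: Int_absorb2)
    qed
    have EF: "E \<inter> F = {}" "A v = E \<union> F"
      using r_sign[of _ n] by (auto simp: E_def F_def A_def)
    have mA: "measure M (A v) = measure M E + measure M F"
      unfolding EF(2) by (rule finite_measure_Union[OF Em Fm EF(1)])
    have aA: "a (A v) n = measure M E - measure M F"
    proof -
      have "a (A v) n = (\<integral>\<omega>. indicator E \<omega> * r n \<omega> + indicator F \<omega> * r n \<omega> \<partial>M)"
        unfolding a_def EF(2)
      proof (intro Bochner_Integration.integral_cong refl)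
        show "indicator (E \<union> F) \<omega> * r n \<omega> = indicator E \<omega> * r n \<omega> + indicator F \<omega> * r n \<omega>" for \<omega>
          using EF(1) by (auto simp: indicator_def)
      qed
      also have "\<dots> = a E n + a F n"
        unfolding a_def by (intro Bochner_Integration.integral_add int Em Fm)
      finally show ?thesis by (simp add: aE aF)
    qed
    have "ennreal (N (measure M E *\<^sub>R v - G E)) + ennreal (N (measure M F *\<^sub>R v - G F))
      \<le> (\<integral>\<^sup>+ \<omega>. ennreal (f \<omega>) * indicator E \<omega> \<partial>M) + (\<integral>\<^sup>+ \<omega>. ennreal (f \<omega>) * indicator F \<omega> \<partial>M)"
      using close[OF Em] close[OF Fm] svi[OF Em sub(1)] svi[OF Fm sub(2)] unfolding f_int
      by (intro add_mono) simp_all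
    also have "\<dots> = (\<integral>\<^sup>+ \<omega>. ennreal (f \<omega>) * indicator E \<omega> + ennreal (f \<omega>) * indicator F \<omega> \<partial>M)"
      by (rule nn_integral_add[symmetric]) measurable
    also have "\<dots> = (\<integral>\<^sup>+ \<omega>. ennreal (f \<omega>) * indicator (A v) \<omega> \<partial>M)"
      by (intro nn_integral_cong) (simp add: ind distrib_left)
    also have "\<dots> \<le> ennreal (e * measure M (A v))" using small by simp
    finally have "N (measure M E *\<^sub>R v - G E) + N (measure M F *\<^sub>R v - G F) \<le> e * measure M (A v)"
      using e vV by (simp add: ennreal_plus[symmetric] norm_nonneg diff_mem scaleR_mem G_bound del: ennreal_plus)
    moreover have "N (G E - G F) \<le> N (measure M E *\<^sub>R v - G E) + N (measure M F *\<^sub>R v - G F) + \<bar>a (A v) n\<bar> * N v"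
    proof -
      have eq: "G E - G F = (measure M F *\<^sub>R v - G F) - (measure M E *\<^sub>R v - G E) + a (A v) n *\<^sub>R v"
        by (simp add: aA scaleR_diff_left)
      have "N (G E - G F) \<le> N ((measure M F *\<^sub>R v - G F) - (measure M E *\<^sub>R v - G E)) + N (a (A v) n *\<^sub>R v)"
        unfolding eq using vV by (intro norm_triangle diff_mem scaleR_mem G_bound Em Fm)
      moreover have "N ((measure M F *\<^sub>R v - G F) - (measure M E *\<^sub>R v - G E)) \<le> N (measure M F *\<^sub>R v - G F) + N (measure M E *\<^sub>R v - G E)"
        using vV by (intro norm_diff_le diff_mem scaleR_mem G_bound Em Fm)
      ultimately show ?thesis using vV by (simp add: norm_scaleR)
    qed
    moreover have "c * measure M (A v) \<le> N (G E - G F)"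
    proof -
      have "c * \<bar>a E n - a F n\<bar> \<le> N (Y (\<lambda>n. a E n - a F n))"
        using a_bound[OF Em] a_bound[OF Fm]
        by (intro Y_lower[of _ "measure M E + measure M F"] order_trans[OF abs_triangle_ineq4] add_mono)
      then show ?thesis by (simp add: aE aF mA Y_diff G_def)
    qed
    ultimately show ?thesis by simp
  qed
  have "(\<lambda>n. e * measure M (A v) + \<bar>a (A v) n\<bar> * N v) \<longlonglongrightarrow> e * measure M (A v) + \<bar>0\<bar> * N v"
    using r_null[OF Am] unfolding a_def by (intro tendsto_intros) auto
  then have "c * measure M (A v) \<le> e * measure M (A v) + \<bar>0\<bar> * N v"
    by (rule LIMSEQ_le_const) (use key in blast)
  then show False using mpos c by (simp add: e_def)
qed

end

section \<open>Truncated energies\<close>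

definition clamp_to :: "real \<Rightarrow> real \<Rightarrow> real" where
  "clamp_to T u = max (- T) (min T u)"

text \<open>The Huber function: convex with derivative \<open>2 * clamp_to T u\<close>, quadratic up
  to \<open>T\<close> and linear beyond, so that its integral is finite on L^1.\<close>

definition huber :: "real \<Rightarrow> real \<Rightarrow> real" where
  "huber T u = (if \<bar>u\<bar> \<le> T then u\<^sup>2 else 2 * T * \<bar>u\<bar> - T\<^sup>2)"

lemma clamp_to_measurable [measurable]: "clamp_to T \<in> borel_measurable borel"
  unfolding clamp_to_def by measurable

lemma huber_measurable [measurable]: "huber T \<in> borel_measurable borel"
  unfolding huber_def by measurable

lemma abs_clamp_to: "0 \<le> T \<Longrightarrow> \<bar>clamp_to T u\<bar> \<le> T"
  by (auto simp: clamp_to_def)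

lemma huber_eq_clamp:
  assumes "0 \<le> T" shows "huber T u = (clamp_to T u)\<^sup>2 + 2 * clamp_to T u * (u - clamp_to T u)"
proof -
  consider "\<bar>u\<bar> \<le> T" | "T < u" | "u < - T" by linarith
  then show ?thesis
  proof cases
    case 1
    then have "clamp_to T u = u" by (simp add: clamp_to_def)
    with 1 show ?thesis by (simp add: huber_def)
  next
    case 2
    with assms have "clamp_to T u = T" "\<bar>u\<bar> = u" by (simp_all add: clamp_to_def)
    with 2 show ?thesis by (simp add: huber_def power2_eq_square algebra_simps)
  next
    case 3
    with assms have "clamp_to T u = - T" "\<bar>u\<bar> = - u" by (simp_all add: clamp_to_def)
    with 3 show ?thesis by (simp add: huber_def power2_eq_square algebra_simps)
  qed
qed

lemma huber_bounds: "0 \<le> T \<Longrightarrow> 0 \<le> huber T u \<and> huber T u \<le> 2 * T * \<bar>u\<bar>"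
proof -
  assume T: "0 \<le> T"
  show ?thesis
  proof (cases "\<bar>u\<bar> \<le> T")
    case True
    have "u\<^sup>2 = \<bar>u\<bar> * \<bar>u\<bar>" by (simp add: power2_eq_square)
    also have "\<dots> \<le> T * \<bar>u\<bar>" using True by (intro mult_right_mono) auto
    also have "\<dots> \<le> 2 * T * \<bar>u\<bar>" using T by (simp add: mult_right_mono)
    finally show ?thesis using True by (simp add: huber_def)
  next
    case False
    then have "T * T \<le> T * \<bar>u\<bar>" using T by (intro mult_left_mono) auto
    moreover have "0 \<le> T * T" by simp
    ultimately have "T * T \<le> 2 * (T * \<bar>u\<bar>)" by linarith
    then show ?thesis using False by (simp add: huber_def power2_eq_square)
  qed
qed

text \<open>The Bregman divergence of the Huber function dominates the squared distance of the truncations,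
  and the truncations differ from the arguments by the excesses over \<open>T\<close>.\<close>
lemma huber_bregman:
  assumes T: "0 \<le> T" and d: "0 < d"
  shows "\<bar>v - u\<bar> \<le> d + (huber T v - huber T u - 2 * (clamp_to T u * v - clamp_to T u * u)) / d
    + max 0 (\<bar>v\<bar> - T) + max 0 (\<bar>u\<bar> - T)"
proof -
  define a where "a = clamp_to T v"
  define b where "b = clamp_to T u"
  have v: "\<bar>v - a\<bar> \<le> max 0 (\<bar>v\<bar> - T)" and u: "\<bar>u - b\<bar> \<le> max 0 (\<bar>u\<bar> - T)"
    using T by (auto simp: a_def b_def clamp_to_def)
  \<comment> \<open>Where \<open>v\<close> is cut, \<open>a\<close> is the endpoint of
    \<open>[-T, T]\<close> nearest to \<open>v\<close>, so \<open>v - a\<close> and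
    \<open>a - b\<close> do not have opposite signs.\<close>
  have "0 \<le> (v - a) * (a - b)"
  proof (cases "a = v")
    case False
    then consider "v > T" "a = T" | "v < - T" "a = - T"
      using T by (auto simp: a_def clamp_to_def min_def max_def split: if_splits)
    moreover have "- T \<le> b" "b \<le> T" using T by (auto simp: b_def clamp_to_def)
    ultimately show ?thesis by cases (auto intro: mult_nonneg_nonneg mult_nonpos_nonpos)
  qed simp
  moreover have "huber T v - huber T u - 2 * (b * v - b * u) = (a - b)\<^sup>2 + 2 * ((v - a) * (a - b))"
    using T by (simp add: huber_eq_clamp a_def[symmetric] b_def[symmetric] power2_eq_square algebra_simps)
  ultimately have sq: "(a - b)\<^sup>2 \<le> huber T v - huber T u - 2 * (b * v - b * u)" by simp
  \<comment> \<open>Trades the distance for its square: a number exceeding \<open>d\<close> is at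
    most its square divided by \<open>d\<close>.\<close>
  have "\<bar>a - b\<bar> \<le> d + (a - b)\<^sup>2 / d"
  proof (cases "\<bar>a - b\<bar> \<le> d")
    case True
    then show ?thesis using d by (simp add: add_increasing2)
  next
    case False
    then have "d * \<bar>a - b\<bar> \<le> \<bar>a - b\<bar> * \<bar>a - b\<bar>" using d by (intro mult_right_mono) auto
    then have "\<bar>a - b\<bar> \<le> (a - b)\<^sup>2 / d" using d by (simp add: field_simps power2_eq_square)
    then show ?thesis using d by simp
  qed
  also have "\<dots> \<le> d + (huber T v - huber T u - 2 * (b * v - b * u)) / d"
    using sq d by (simp add: divide_right_mono)
  finally have "\<bar>a - b\<bar> \<le> d + (huber T v - huber T u - 2 * (b * v - b * u)) / d" .
  then show ?thesis using u v unfolding b_def by linarith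
qed

context orlicz_lorentz_space
begin

section \<open>A weaker L^1 norm on the space\<close>

lemma rep_L0_eta_measurable [measurable]: "rep_L0 x \<in> borel_measurable eta"
  using rep_L0_measurable[of x] by simp

lemma AE_etaI: "(AE t in lebesgue. P t) \<Longrightarrow> AE t in eta. P t"
  unfolding AE_eta by (auto elim: eventually_mono)

lemma measure_eta_le: "measure eta UNIV \<le> 1"
proof -
  have "emeasure eta UNIV \<le> 1" using emeasure_eta_le[of UNIV] by simp
  then show ?thesis unfolding measure_def by (metis enn2real_mono enn2real_1 ennreal_one_less_top)
qed

text \<open>Above the threshold \<open>l\<close> belonging to the error 1, the excess of the
  normalised function has integral at most 1; the part below contributes at most \<open>l\<close>.
  Hence the constant \<open>1 + l\<close>. The scale is an arbitrary \<open>d > 0\<close> with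
  \<open>N x \<le> d\<close>, because \<open>N x = 0\<close> is not yet known to force
  \<open>x = 0\<close>.\<close>

lemma nn_integral_rep_le_norm:
  "\<exists>C>0. \<forall>x\<in>V. (\<integral>\<^sup>+ t. ennreal \<bar>rep_L0 x t\<bar> \<partial>eta) \<le> ennreal (C * N x)"
proof -
  interpret eta: finite_measure eta by (rule finite_measure_eta)
  obtain l where l: "0 \<le> l" "\<And>x. rho x \<le> 1 \<Longrightarrow> (\<integral>\<^sup>+ t. ennreal (\<bar>rep_L0 x t\<bar> - l) \<partial>eta) \<le> ennreal 1"
    by (rule uniformly_integrable[of 1]) auto
  have *: "(\<integral>\<^sup>+ t. ennreal \<bar>rep_L0 x t\<bar> \<partial>eta) \<le> ennreal ((1 + l) * d)" if x: "x \<in> V" and d: "0 < d" "N x \<le> d" for x d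
  proof -
    have "(\<integral>\<^sup>+ t. ennreal \<bar>rep_L0 x t\<bar> \<partial>eta)
        \<le> (\<integral>\<^sup>+ t. ennreal d * ennreal (\<bar>rep_L0 (x /\<^sub>R d) t\<bar> - l) + ennreal (l * d) \<partial>eta)"
    proof (rule nn_integral_mono_AE)
      show "AE t in eta. ennreal \<bar>rep_L0 x t\<bar> \<le> ennreal d * ennreal (\<bar>rep_L0 (x /\<^sub>R d) t\<bar> - l) + ennreal (l * d)"
        using AE_etaI[OF rep_L0_scaleR[of "inverse d" x]]
      proof eventually_elim
        case (elim t)
        define z where "z = \<bar>rep_L0 (x /\<^sub>R d) t\<bar>"
        have z: "\<bar>rep_L0 x t\<bar> = d * z" using d elim by (simp add: z_def abs_mult)
        have "d * z \<le> d * max 0 (z - l) + l * d"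
          using d l by (auto simp: max_def algebra_simps)
        then have "ennreal (d * z) \<le> ennreal (d * max 0 (z - l)) + ennreal (l * d)"
          using d l by (subst ennreal_plus[symmetric]) (auto intro: ennreal_leI simp del: ennreal_plus)
        also have "ennreal (d * max 0 (z - l)) = ennreal d * ennreal (z - l)"
          using d by (simp add: ennreal_mult max_def ennreal_neg)
        finally show ?case unfolding z by (simp add: z_def)
      qed
    qed
    also have "\<dots> = ennreal d * (\<integral>\<^sup>+ t. ennreal (\<bar>rep_L0 (x /\<^sub>R d) t\<bar> - l) \<partial>eta) + ennreal (l * d) * emeasure eta UNIV"
      by (subst nn_integral_add) (simp_all add: nn_integral_cmult)
    also have "\<dots> \<le> ennreal d * ennreal 1 + ennreal (l * d) * 1"
      using l(2)[of "x /\<^sub>R d"] N_le_iff[OF x d(1)] d emeasure_eta_le[of UNIV]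
      by (intro add_mono mult_left_mono) auto
    also have "\<dots> = ennreal ((1 + l) * d)"
      using d l by (simp add: distrib_right)
    finally show ?thesis .
  qed
  have "(\<integral>\<^sup>+ t. ennreal \<bar>rep_L0 x t\<bar> \<partial>eta) \<le> ennreal ((1 + l) * N x)" if x: "x \<in> V" for x
  proof (cases "N x = 0")
    case True
    have eps: "(\<integral>\<^sup>+ t. ennreal \<bar>rep_L0 x t\<bar> \<partial>eta) \<le> 0 + ennreal e" if "0 < e" for e
      using *[OF x, of "e / (1 + l)"] True that l by simp
    have "(\<integral>\<^sup>+ t. ennreal \<bar>rep_L0 x t\<bar> \<partial>eta) \<le> 0" by (rule ennreal_le_epsilon) (rule eps)
    then show ?thesis by simp
  next
    case False
    then show ?thesis using N_nonneg[OF x] by (intro * x) auto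
  qed
  then show ?thesis using l(1) by (intro exI[of _ "1 + l"]) auto
qed

definition pnorm :: "L0 \<Rightarrow> real" where
  "pnorm x = (\<integral>t. \<bar>rep_L0 x t\<bar> \<partial>eta)"

lemma rep_L0_integrable: assumes "x \<in> V" shows "integrable eta (rep_L0 x)"
proof -
  obtain C where "(\<integral>\<^sup>+ t. ennreal \<bar>rep_L0 x t\<bar> \<partial>eta) \<le> ennreal (C * N x)"
    using nn_integral_rep_le_norm assms by blast
  also have "\<dots> < \<infinity>" by simp
  finally show ?thesis by (intro integrableI_bounded) auto
qed

lemma nn_integral_rep_eq_pnorm:
  "x \<in> V \<Longrightarrow> (\<integral>\<^sup>+ t. ennreal \<bar>rep_L0 x t\<bar> \<partial>eta) = ennreal (pnorm x)"
  using nn_integral_eq_integral[OF integrable_abs[OF rep_L0_integrable]] by (simp add: pnorm_def)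

lemma pnorm_le_norm: "\<exists>C>0. \<forall>x\<in>V. pnorm x \<le> C * N x"
proof -
  obtain C where C: "0 < C" "\<forall>x\<in>V. (\<integral>\<^sup>+ t. ennreal \<bar>rep_L0 x t\<bar> \<partial>eta) \<le> ennreal (C * N x)"
    using nn_integral_rep_le_norm by blast
  have "pnorm x \<le> C * N x" if "x \<in> V" for x
  proof -
    have "ennreal (pnorm x) \<le> ennreal (C * N x)"
      using C(2) that by (simp add: nn_integral_rep_eq_pnorm[symmetric])
    moreover have "0 \<le> C * N x" using C(1) N_nonneg[OF that] by simp
    ultimately show ?thesis by (simp add: ennreal_le_iff)
  qed
  then show ?thesis using C(1) by blast
qed

lemma pnorm_nonneg [simp]: "0 \<le> pnorm x"
  unfolding pnorm_def by simp

lemma pnorm_definite: assumes x: "x \<in> V" and "pnorm x = 0" shows "x = 0"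
proof (rule L0_eqI)
  have "AE t in eta. \<bar>rep_L0 x t\<bar> = 0"
    using assms by (subst integral_nonneg_eq_0_iff_AE[symmetric]) (auto simp: pnorm_def intro!: rep_L0_integrable)
  then have "AE t in lebesgue. t \<in> I \<longrightarrow> rep_L0 x t = 0" by (simp add: AE_eta)
  then show "AE t in lebesgue. rep_L0 x t = rep_L0 0 t"
    using V_L0_on[OF x] rep_L0_zero unfolding L0_on_iff by eventually_elim auto
qed

text \<open>The Luxemburg norm dominates a multiple of the L^1 norm for \<open>eta\<close>, which
  vanishes only at 0.\<close>

lemma N_definite: assumes "x \<in> V" "N x = 0" shows "x = 0"
proof (rule pnorm_definite[OF assms(1)])
  obtain C where "\<forall>x\<in>V. pnorm x \<le> C * N x" using pnorm_le_norm by blast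
  then have "pnorm x \<le> C * N x" using assms(1) by (rule bspec)
  then show "pnorm x = 0" using assms(2) pnorm_nonneg[of x] by simp
qed

sublocale space: normed_subspace V N
  by unfold_locales (rule V_zero V_add V_scaleR N_nonneg N_scaleR N_triangle N_definite; assumption)+

sublocale p: normed_subspace V pnorm
proof
  fix x y c assume x: "x \<in> V"
  have "pnorm (c *\<^sub>R x) = (\<integral>t. \<bar>c\<bar> * \<bar>rep_L0 x t\<bar> \<partial>eta)"
    unfolding pnorm_def
    by (intro integral_cong_AE eventually_mono[OF AE_etaI[OF rep_L0_scaleR[of c x]]]) (auto simp: abs_mult)
  then show "pnorm (c *\<^sub>R x) = \<bar>c\<bar> * pnorm x" by (simp add: pnorm_def)
  assume y: "y \<in> V"
  have "pnorm (x + y) = (\<integral>t. \<bar>rep_L0 x t + rep_L0 y t\<bar> \<partial>eta)"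
    unfolding pnorm_def
    by (intro integral_cong_AE eventually_mono[OF AE_etaI[OF rep_L0_add[of x y]]]) auto
  also have "\<dots> \<le> (\<integral>t. \<bar>rep_L0 x t\<bar> + \<bar>rep_L0 y t\<bar> \<partial>eta)"
    using rep_L0_integrable[OF x] rep_L0_integrable[OF y] by (intro integral_mono) auto
  also have "\<dots> = pnorm x + pnorm y"
    unfolding pnorm_def using rep_L0_integrable[OF x] rep_L0_integrable[OF y] by simp
  finally show "pnorm (x + y) \<le> pnorm x + pnorm y" .
qed (rule V_zero V_add V_scaleR pnorm_nonneg pnorm_definite; assumption)+

section \<open>Excess, energy and the first-order term of the energy\<close>

definition tail :: "real \<Rightarrow> L0 \<Rightarrow> real" where
  "tail l x = (\<integral>t. max 0 (\<bar>rep_L0 x t\<bar> - l) \<partial>eta)"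

definition energy :: "real \<Rightarrow> L0 \<Rightarrow> real" where
  "energy T x = (\<integral>t. huber T (rep_L0 x t) \<partial>eta)"

text \<open>Half the directional derivative of \<open>energy T\<close> at \<open>x\<close> in the
  direction \<open>y\<close>; it is linear in \<open>y\<close>.\<close>

definition pairing :: "real \<Rightarrow> L0 \<Rightarrow> L0 \<Rightarrow> real" where
  "pairing T x y = (\<integral>t. clamp_to T (rep_L0 x t) * rep_L0 y t \<partial>eta)"

lemma tail_integrable: "x \<in> V \<Longrightarrow> 0 \<le> l \<Longrightarrow> integrable eta (\<lambda>t. max 0 (\<bar>rep_L0 x t\<bar> - l))"
  by (rule Bochner_Integration.integrable_bound[OF rep_L0_integrable[of x]]) auto

lemma tail_le_pnorm: "x \<in> V \<Longrightarrow> 0 \<le> l \<Longrightarrow> tail l x \<le> pnorm x"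
  unfolding tail_def pnorm_def
  by (rule integral_mono[OF tail_integrable integrable_abs[OF rep_L0_integrable]]) auto

text \<open>Rescaling to the unit ball: the excess over \<open>L * l\<close> is \<open>L\<close>
  times the excess of \<open>x /\<^sub>R L\<close> over \<open>l\<close>, which explains
  \<open>e / L\<close>.\<close>

lemma tail_uniform:
  assumes "0 < e" "0 < L"
  obtains l where "0 \<le> l" "\<And>x. x \<in> V \<Longrightarrow> N x \<le> L \<Longrightarrow> tail l x \<le> e"
proof -
  have "0 < e / L" using assms by simp
  then obtain l where l: "0 \<le> l" "\<And>x. rho x \<le> 1 \<Longrightarrow> (\<integral>\<^sup>+ t. ennreal (\<bar>rep_L0 x t\<bar> - l) \<partial>eta) \<le> ennreal (e / L)"
    by (rule uniformly_integrable) blast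
  have "tail (L * l) x \<le> e" if x: "x \<in> V" "N x \<le> L" for x
  proof -
    have z: "x /\<^sub>R L \<in> V" using x by (intro V_scaleR)
    have "tail l (x /\<^sub>R L) \<le> e / L"
    proof -
      have "ennreal (tail l (x /\<^sub>R L)) = (\<integral>\<^sup>+ t. ennreal (max 0 (\<bar>rep_L0 (x /\<^sub>R L) t\<bar> - l)) \<partial>eta)"
        unfolding tail_def using tail_integrable[OF z l(1)] by (intro nn_integral_eq_integral[symmetric]) auto
      also have "\<dots> = (\<integral>\<^sup>+ t. ennreal (\<bar>rep_L0 (x /\<^sub>R L) t\<bar> - l) \<partial>eta)"
        by (intro nn_integral_cong) (auto simp: max_def ennreal_neg)
      also have "\<dots> \<le> ennreal (e / L)"
        using l(2)[of "x /\<^sub>R L"] N_le_iff[OF x(1) assms(2)] x by simp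
      finally show ?thesis using assms by (simp add: ennreal_le_iff)
    qed
    moreover have "tail (L * l) x = (\<integral>t. L * max 0 (\<bar>rep_L0 (x /\<^sub>R L) t\<bar> - l) \<partial>eta)"
      unfolding tail_def
    proof (rule integral_cong_AE)
      show "AE t in eta. max 0 (\<bar>rep_L0 x t\<bar> - L * l) = L * max 0 (\<bar>rep_L0 (x /\<^sub>R L) t\<bar> - l)"
        using AE_etaI[OF rep_L0_scaleR[of "inverse L" x]]
      proof eventually_elim
        case (elim t)
        have "\<bar>rep_L0 x t\<bar> = L * \<bar>rep_L0 (x /\<^sub>R L) t\<bar>" using assms elim by (simp add: abs_mult)
        then show ?case using assms by (auto simp: max_def algebra_simps)
      qed
    qed measurable
    ultimately show ?thesis using assms by (simp add: tail_def[symmetric] field_simps)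
  qed
  moreover have "0 \<le> L * l" using assms l by simp
  ultimately show ?thesis using that by blast
qed

lemma energy_integrable: "x \<in> V \<Longrightarrow> 0 \<le> T \<Longrightarrow> integrable eta (\<lambda>t. huber T (rep_L0 x t))"
proof (rule Bochner_Integration.integrable_bound)
  assume x: "x \<in> V" and T: "0 \<le> T"
  show "integrable eta (\<lambda>t. 2 * T * rep_L0 x t)" by (intro integrable_mult_right rep_L0_integrable x)
  show "AE t in eta. norm (huber T (rep_L0 x t)) \<le> norm (2 * T * rep_L0 x t)"
  proof (intro AE_I2)
    fix t
    show "norm (huber T (rep_L0 x t)) \<le> norm (2 * T * rep_L0 x t)"
      using huber_bounds[OF T, of "rep_L0 x t"] T by (simp add: abs_mult)
  qed
qed measurable

lemma energy_bounds:
  assumes "x \<in> V" "0 \<le> T" shows "0 \<le> energy T x" "energy T x \<le> 2 * T * pnorm x"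
proof -
  show "0 \<le> energy T x" unfolding energy_def using huber_bounds[OF assms(2)] by (intro Bochner_Integration.integral_nonneg) blast
  have "energy T x \<le> (\<integral>t. 2 * T * \<bar>rep_L0 x t\<bar> \<partial>eta)"
    unfolding energy_def
  proof (rule integral_mono)
    show "integrable eta (\<lambda>t. 2 * T * \<bar>rep_L0 x t\<bar>)"
      by (intro integrable_mult_right integrable_abs rep_L0_integrable assms)
  qed (use huber_bounds[OF assms(2)] energy_integrable[OF assms] in blast)+
  then show "energy T x \<le> 2 * T * pnorm x" by (simp add: pnorm_def)
qed

lemma pairing_integrable: "y \<in> V \<Longrightarrow> 0 \<le> T \<Longrightarrow> integrable eta (\<lambda>t. clamp_to T (rep_L0 x t) * rep_L0 y t)"
proof (rule Bochner_Integration.integrable_bound)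
  assume y: "y \<in> V" and T: "0 \<le> T"
  show "integrable eta (\<lambda>t. T * rep_L0 y t)" by (intro integrable_mult_right rep_L0_integrable y)
  show "AE t in eta. norm (clamp_to T (rep_L0 x t) * rep_L0 y t) \<le> norm (T * rep_L0 y t)"
  proof (intro AE_I2)
    fix t
    show "norm (clamp_to T (rep_L0 x t) * rep_L0 y t) \<le> norm (T * rep_L0 y t)"
      using mult_right_mono[OF abs_clamp_to[OF T, of "rep_L0 x t"], of "\<bar>rep_L0 y t\<bar>"] T by (simp add: abs_mult)
  qed
qed measurable

lemma pairing_add:
  assumes "0 \<le> T" "y \<in> V" "z \<in> V" shows "pairing T x (y + z) = pairing T x y + pairing T x z"
proof -
  have "pairing T x (y + z) = (\<integral>t. clamp_to T (rep_L0 x t) * rep_L0 y t + clamp_to T (rep_L0 x t) * rep_L0 z t \<partial>eta)"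
    unfolding pairing_def
  proof (rule integral_cong_AE)
    show "AE t in eta. clamp_to T (rep_L0 x t) * rep_L0 (y + z) t
        = clamp_to T (rep_L0 x t) * rep_L0 y t + clamp_to T (rep_L0 x t) * rep_L0 z t"
      using AE_etaI[OF rep_L0_add[of y z]] by eventually_elim (simp add: distrib_left)
  qed measurable
  also have "\<dots> = pairing T x y + pairing T x z"
    unfolding pairing_def by (intro Bochner_Integration.integral_add pairing_integrable assms)
  finally show ?thesis .
qed

lemma pairing_scaleR: "pairing T x (c *\<^sub>R y) = c * pairing T x y"
proof -
  have "pairing T x (c *\<^sub>R y) = (\<integral>t. c * (clamp_to T (rep_L0 x t) * rep_L0 y t) \<partial>eta)"
    unfolding pairing_def
  proof (rule integral_cong_AE)
    show "AE t in eta. clamp_to T (rep_L0 x t) * rep_L0 (c *\<^sub>R y) t = c * (clamp_to T (rep_L0 x t) * rep_L0 y t)"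
      using AE_etaI[OF rep_L0_scaleR[of c y]] by eventually_elim simp
  qed measurable
  then show ?thesis by (simp add: pairing_def)
qed

lemma pairing_sum:
  assumes "0 \<le> T" "finite A" "\<And>i. i \<in> A \<Longrightarrow> f i \<in> V"
  shows "pairing T x (sum f A) = (\<Sum>i\<in>A. pairing T x (f i))"
  using assms(2,3)
proof (induction A rule: finite_induct)
  case empty
  then show ?case using pairing_scaleR[of T x 0 0] by simp
next
  case (insert a A)
  then show ?case by (simp add: pairing_add assms(1) space.sum_mem)
qed

text \<open>\<open>huber_bregman\<close> integrated over \<open>eta\<close>, whose total mass is at
  most 1. The numerator is the Bregman divergence of the energy.\<close>

lemma pnorm_bregman:
  assumes V: "x \<in> V" "y \<in> V" and T: "0 \<le> T" and d: "0 < d"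
  shows "pnorm (y - x) \<le> d + (energy T y - energy T x - 2 * (pairing T x y - pairing T x x)) / d + tail T y + tail T x"
proof -
  interpret eta: finite_measure eta by (rule finite_measure_eta)
  note int = energy_integrable[OF V(1) T] energy_integrable[OF V(2) T] pairing_integrable[OF V(1) T]
    pairing_integrable[OF V(2) T] tail_integrable[OF V(1) T] tail_integrable[OF V(2) T]
  have "pnorm (y - x) = (\<integral>t. \<bar>rep_L0 y t - rep_L0 x t\<bar> \<partial>eta)"
    unfolding pnorm_def
  proof (rule integral_cong_AE)
    show "AE t in eta. \<bar>rep_L0 (y - x) t\<bar> = \<bar>rep_L0 y t - rep_L0 x t\<bar>"
      using AE_etaI[OF rep_L0_diff[of y x]] by eventually_elim simp
  qed measurable
  also have "\<dots> \<le> (\<integral>t. d + (huber T (rep_L0 y t) - huber T (rep_L0 x t) - 2 * (clamp_to T (rep_L0 x t) * rep_L0 y t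
       - clamp_to T (rep_L0 x t) * rep_L0 x t)) / d + max 0 (\<bar>rep_L0 y t\<bar> - T) + max 0 (\<bar>rep_L0 x t\<bar> - T) \<partial>eta)"
  proof (rule integral_mono)
    show "integrable eta (\<lambda>t. \<bar>rep_L0 y t - rep_L0 x t\<bar>)"
      using V by (intro integrable_abs Bochner_Integration.integrable_diff rep_L0_integrable)
  qed (use int in simp, rule huber_bregman[OF T d])
  also have "\<dots> = d * measure eta UNIV + (energy T y - energy T x - 2 * (pairing T x y - pairing T x x)) / d + tail T y + tail T x"
    using int unfolding energy_def pairing_def tail_def by simp
  also have "d * measure eta UNIV \<le> d * 1"
    using d measure_eta_le by (intro mult_left_mono) auto
  finally show ?thesis by simp
qed

end

section \<open>Averages of a vector measure over partitions\<close>

locale bv_vector_measure = orlicz_lorentz_space \<gamma> w \<phi> + finite_measure M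
  for \<gamma> w \<phi> and M :: "'b measure" +
  fixes G :: "'b set \<Rightarrow> L0"
  assumes vector_measure_G: "vector_measure V N M G"
    and continuous_G: "continuous_wrt N M G"
    and bounded_variation_G: "bounded_variation N M G"
begin

section \<open>Finite additivity and total variation of the vector measure\<close>

lemma G_mem [simp]: "E \<in> sets M \<Longrightarrow> G E \<in> V"
  using vector_measure_G by (simp add: vector_measure_def)

lemma G_countable:
  "range A \<subseteq> sets M \<Longrightarrow> disjoint_family A \<Longrightarrow> (\<lambda>n::nat. N ((\<Sum>i<n. G (A i)) - G (\<Union>i. A i))) \<longlonglongrightarrow> 0"
  using vector_measure_G by (simp add: vector_measure_def)

text \<open>Countable additivity for the constant sequence of empty sets forces
  \<open>(real n - 1) * N (G {})\<close> to tend to 0.\<close>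

lemma G_empty [simp]: "G {} = 0"
proof (rule space.norm_definite)
  have lim: "(\<lambda>n::nat. N ((\<Sum>i<n. G {}) - G {})) \<longlonglongrightarrow> 0"
    using G_countable[of "\<lambda>_. {}"] by (simp add: disjoint_family_on_def)
  have "N (G {}) \<le> N ((\<Sum>i<n. G {}) - G {})" if "2 \<le> n" for n :: nat
  proof -
    have "(\<Sum>i<n. G {}) - G {} = (real n - 1) *\<^sub>R G {}"
      by (simp add: sum_constant_scaleR scaleR_diff_left)
    then have "N ((\<Sum>i<n. G {}) - G {}) = \<bar>real n - 1\<bar> * N (G {})" by (simp add: N_scaleR)
    moreover have "1 * N (G {}) \<le> \<bar>real n - 1\<bar> * N (G {})"
      using that by (intro mult_right_mono N_nonneg) auto
    ultimately show ?thesis by simp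
  qed
  then have "N (G {}) \<le> 0" by (intro LIMSEQ_le_const[OF lim]) blast
  then show "N (G {}) = 0" using N_nonneg[of "G {}"] by simp
qed simp

lemma G_Un:
  assumes [measurable]: "A \<in> sets M" "B \<in> sets M" and "A \<inter> B = {}"
  shows "G (A \<union> B) = G A + G B"
proof -
  define F where "F i = (if i = 0 then A else if i = Suc 0 then B else {})" for i :: nat
  have "range F \<subseteq> sets M" "disjoint_family F"
    using assms by (auto simp: F_def disjoint_family_on_def)
  then have lim: "(\<lambda>n. N ((\<Sum>i<n. G (F i)) - G (\<Union>i. F i))) \<longlonglongrightarrow> 0"
    by (rule G_countable)
  have U: "(\<Union>i. F i) = A \<union> B" by (auto simp: F_def split: if_splits)
  have S: "(\<Sum>i<n + 2. G (F i)) = G A + G B" for n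
    by (induction n) (auto simp: F_def numeral_2_eq_2)
  have "(\<lambda>n. N ((\<Sum>i<n + 2. G (F i)) - G (\<Union>i. F i))) \<longlonglongrightarrow> 0"
    by (rule LIMSEQ_ignore_initial_segment[OF lim])
  then have "N (G A + G B - G (A \<union> B)) = 0"
    unfolding U S by (simp add: LIMSEQ_const_iff)
  then have "G A + G B - G (A \<union> B) = 0"
    by (intro space.norm_definite) (auto intro!: space.diff_mem space.add_mem)
  then show ?thesis by simp
qed

lemma G_UN:
  assumes "finite K" "\<And>i. i \<in> K \<Longrightarrow> A i \<in> sets M" "disjoint_family_on A K"
  shows "G (\<Union>i\<in>K. A i) = (\<Sum>i\<in>K. G (A i))"
  using assms
proof (induction K rule: finite_induct)
  case (insert k K)
  have "A k \<inter> (\<Union>i\<in>K. A i) = {}"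
    using insert.prems(2) insert.hyps by (auto simp: disjoint_family_on_def)
  moreover have "(\<Union>i\<in>K. A i) \<in> sets M" using insert by (intro sets.finite_UN) auto
  ultimately have "G (A k \<union> (\<Union>i\<in>K. A i)) = G (A k) + G (\<Union>i\<in>K. A i)"
    using insert by (intro G_Un) auto
  also have "G (\<Union>i\<in>K. A i) = (\<Sum>i\<in>K. G (A i))"
    using insert by (intro insert.IH) (auto simp: disjoint_family_on_def)
  finally show ?case using insert.hyps by simp
qed simp

lemma G_null: assumes "E \<in> sets M" "measure M E = 0" shows "G E = 0"
proof (rule space.norm_definite)
  have "N (G E) < e" if e: "0 < e" for e
  proof -
    obtain d where "0 < d" "\<forall>E\<in>sets M. measure M E < d \<longrightarrow> N (G E) < e"
      using continuous_G e unfolding continuous_wrt_def by blast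
    then show ?thesis using assms by auto
  qed
  then show "N (G E) = 0" using N_nonneg[of "G E"] assms(1) by (metis G_mem less_irrefl order_le_less)
qed (simp add: assms)

text \<open>A partition is a set of nonempty sets covering the space. A disjoint family becomes one
  after its empty members are dropped and the complement of its union is added, which does not
  decrease the sum.\<close>

lemma family_variation_bounded:
  "\<exists>C. \<forall>K (A :: nat \<Rightarrow> 'b set). finite K \<and> (\<forall>i\<in>K. A i \<in> sets M) \<and> disjoint_family_on A K \<longrightarrow>
     (\<Sum>i\<in>K. N (G (A i))) \<le> C"
proof -
  obtain C where C: "\<And>P. finite P \<Longrightarrow> P \<subseteq> sets M \<Longrightarrow> partition_on (space M) P \<Longrightarrow> (\<Sum>E\<in>P. N (G E)) \<le> C"
    using bounded_variation_G unfolding bounded_variation_def by blast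
  have "(\<Sum>i\<in>K. N (G (A i))) \<le> C"
    if K: "finite K" "\<forall>i\<in>K. A i \<in> sets M" "disjoint_family_on A K" for K and A :: "nat \<Rightarrow> 'b set"
  proof -
    define K' where "K' = {i \<in> K. A i \<noteq> {}}"
    define P where "P = A ` K'"
    define R where "R = space M - \<Union>P"
    have dK': "disjoint_family_on A K'"
      by (rule disjoint_family_on_mono[OF _ K(3)]) (simp add: K'_def)
    have P: "finite P" "P \<subseteq> sets M" "{} \<notin> P" "disjoint P"
      using K(1,2) disjoint_family_on_disjoint_image[OF dK'] by (auto simp: P_def K'_def)
    have R: "R \<in> sets M" unfolding R_def using P by (intro sets.Diff sets.top sets.finite_Union) auto
    have PM: "\<Union>P \<subseteq> space M" using P sets.sets_into_space by blast
    have inj: "inj_on A K'"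
      using K(3) by (auto simp: inj_on_def disjoint_family_on_def K'_def)
    have "(\<Sum>i\<in>K. N (G (A i))) = (\<Sum>i\<in>K'. N (G (A i)))"
      using K(1) by (intro sum.mono_neutral_right) (auto simp: K'_def)
    also have "\<dots> = (\<Sum>E\<in>P. N (G E))" unfolding P_def using inj by (simp add: sum.reindex)
    also have "\<dots> \<le> C"
    proof (cases "R = {}")
      case True
      then have "partition_on (space M) P" using P PM by (auto simp: partition_on_def R_def)
      then show ?thesis using P by (intro C)
    next
      case False
      have "R \<notin> P" using False by (auto simp: R_def)
      have "partition_on (space M) (insert R P)"
        using P PM False by (auto simp: partition_on_def R_def disjoint_def)
      then have "(\<Sum>E\<in>insert R P. N (G E)) \<le> C" using P R by (intro C) auto
      moreover have "(\<Sum>E\<in>P. N (G E)) \<le> (\<Sum>E\<in>insert R P. N (G E))"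
        using P(1) \<open>R \<notin> P\<close> N_nonneg[of "G R"] R by simp
      ultimately show ?thesis by simp
    qed
    finally show ?thesis .
  qed
  then show ?thesis by blast
qed

definition variation :: real where
  "variation = Sup {\<Sum>i\<in>K. N (G (A i)) | K (A :: nat \<Rightarrow> 'b set).
     finite K \<and> (\<forall>i\<in>K. A i \<in> sets M) \<and> disjoint_family_on A K}"

lemma variation_bdd: "bdd_above {\<Sum>i\<in>K. N (G (A i)) | K (A :: nat \<Rightarrow> 'b set).
     finite K \<and> (\<forall>i\<in>K. A i \<in> sets M) \<and> disjoint_family_on A K}"
proof -
  obtain C where "\<forall>K (A :: nat \<Rightarrow> 'b set). finite K \<and> (\<forall>i\<in>K. A i \<in> sets M) \<and> disjoint_family_on A K \<longrightarrow>
     (\<Sum>i\<in>K. N (G (A i))) \<le> C"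
    using family_variation_bounded by blast
  then show ?thesis by (intro bdd_aboveI[of _ C]) blast
qed

lemma sum_le_variation:
  fixes A :: "nat \<Rightarrow> 'b set"
  assumes "finite K" "\<And>i. i \<in> K \<Longrightarrow> A i \<in> sets M" "disjoint_family_on A K"
  shows "(\<Sum>i\<in>K. N (G (A i))) \<le> variation"
  unfolding variation_def by (rule cSup_upper[OF _ variation_bdd]) (use assms in blast)

lemma variation_nonneg: "0 \<le> variation"
  using sum_le_variation[of "{}" "\<lambda>_. {}"] by (simp add: disjoint_family_on_def)

text \<open>Take a family that nearly exhausts the total variation. Cutting a small set \<open>B\<close> out of its members
  loses little, so no family inside \<open>B\<close> can carry much variation.\<close>
lemma variation_abs_continuous:
  assumes e: "0 < e"
  obtains d where "0 < d" "\<And>K (A :: nat \<Rightarrow> 'b set). finite K \<Longrightarrow> (\<And>i. i \<in> K \<Longrightarrow> A i \<in> sets M) \<Longrightarrow>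
    disjoint_family_on A K \<Longrightarrow> measure M (\<Union>i\<in>K. A i) < d \<Longrightarrow> (\<Sum>i\<in>K. N (G (A i))) \<le> e"
proof -
  have "\<exists>x\<in>{\<Sum>i\<in>K. N (G (A i)) | K (A :: nat \<Rightarrow> 'b set).
     finite K \<and> (\<forall>i\<in>K. A i \<in> sets M) \<and> disjoint_family_on A K}. variation - e / 2 < x"
  proof (rule less_cSupD)
    have "(\<Sum>i\<in>{}. N (G ((\<lambda>_::nat. {}) i))) \<in> {\<Sum>i\<in>K. N (G (A i)) | K (A :: nat \<Rightarrow> 'b set).
     finite K \<and> (\<forall>i\<in>K. A i \<in> sets M) \<and> disjoint_family_on A K}"
      by (intro CollectI exI[of _ "{}"] exI[of _ "\<lambda>_. {}"]) (auto simp: disjoint_family_on_def)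
    then show "{\<Sum>i\<in>K. N (G (A i)) | K (A :: nat \<Rightarrow> 'b set).
     finite K \<and> (\<forall>i\<in>K. A i \<in> sets M) \<and> disjoint_family_on A K} \<noteq> {}" by blast
  qed (use e in \<open>simp add: variation_def\<close>)
  then obtain K0 and A0 :: "nat \<Rightarrow> 'b set" where K0: "finite K0" "\<And>i. i \<in> K0 \<Longrightarrow> A0 i \<in> sets M"
    "disjoint_family_on A0 K0" and big: "variation - e / 2 < (\<Sum>i\<in>K0. N (G (A0 i)))"
    by blast
  \<comment> \<open>Cutting \<open>B\<close> out of the \<open>card K0\<close> members costs less
    than \<open>e'\<close> each, so at most \<open>e / 2\<close> in total; the summand 1 keeps the
    denominator positive.\<close>
  define e' where "e' = e / (2 * (real (card K0) + 1))"
  have e': "0 < e'" using e by (simp add: e'_def add_nonneg_pos)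
  then obtain d where d: "0 < d" "\<forall>E\<in>sets M. measure M E < d \<longrightarrow> N (G E) < e'"
    using continuous_G unfolding continuous_wrt_def by blast
  have "(\<Sum>i\<in>K. N (G (A i))) \<le> e" if K: "finite K" "\<And>i. i \<in> K \<Longrightarrow> A i \<in> sets M"
    "disjoint_family_on A K" and small: "measure M (\<Union>i\<in>K. A i) < d" for K and A :: "nat \<Rightarrow> 'b set"
  proof -
    define B where "B = (\<Union>i\<in>K. A i)"
    have B: "B \<in> sets M" unfolding B_def using K by (intro sets.finite_UN) auto
    \<comment> \<open>Even indices carry the family inside \<open>B\<close>, odd indices the old
      members outside \<open>B\<close>; together they form a single competitor for the total
      variation.\<close>
    define F where "F j = (if even j then A (j div 2) else A0 (j div 2) - B)" for j
    define L where "L = (\<lambda>i. 2 * i) ` K \<union> (\<lambda>i. 2 * i + 1) ` K0"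
    have split: "(\<Sum>j\<in>L. N (G (F j))) = (\<Sum>i\<in>K. N (G (A i))) + (\<Sum>i\<in>K0. N (G (A0 i - B)))"
    proof -
      have "(\<lambda>i::nat. 2 * i) ` K \<inter> (\<lambda>i. 2 * i + 1) ` K0 = {}"
        by (auto, presburger)
      then have "(\<Sum>j\<in>L. N (G (F j))) = (\<Sum>j\<in>(\<lambda>i. 2 * i) ` K. N (G (F j))) + (\<Sum>j\<in>(\<lambda>i. 2 * i + 1) ` K0. N (G (F j)))"
        unfolding L_def using K(1) K0(1) by (intro sum.union_disjoint) auto
      also have "(\<Sum>j\<in>(\<lambda>i. 2 * i) ` K. N (G (F j))) = (\<Sum>i\<in>K. N (G (A i)))"
        by (subst sum.reindex) (auto simp: inj_on_def F_def)
      also have "(\<Sum>j\<in>(\<lambda>i. 2 * i + 1) ` K0. N (G (F j))) = (\<Sum>i\<in>K0. N (G (A0 i - B)))"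
        by (subst sum.reindex) (auto simp: inj_on_def F_def)
      finally show ?thesis .
    qed
    have "(\<Sum>j\<in>L. N (G (F j))) \<le> variation"
    proof (rule sum_le_variation)
      show "finite L" using K K0 by (simp add: L_def)
      show "F j \<in> sets M" if "j \<in> L" for j using that K K0 B by (auto simp: L_def F_def)
      show "disjoint_family_on F L"
        unfolding disjoint_family_on_def
      proof (intro ballI impI)
        fix j k assume jk: "j \<in> L" "k \<in> L" "j \<noteq> k"
        have KE: "j div 2 \<in> K" if "j \<in> L" "even j" for j
          using that by (auto simp: L_def)
        have KO: "j div 2 \<in> K0" if "j \<in> L" "odd j" for j
          using that by (auto simp: L_def)
        have KA: "A (j div 2) \<subseteq> B" if "j \<in> L" "even j" for j
          using that by (auto simp: L_def B_def)
        consider "even j" "even k" | "even j" "odd k" | "odd j" "even k" | "odd j" "odd k" by blast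
        then show "F j \<inter> F k = {}"
        proof cases
          case 1
          have "j div 2 \<noteq> k div 2" using jk(3) 1 by (metis dvd_mult_div_cancel)
          moreover have "j div 2 \<in> K" "k div 2 \<in> K" using jk 1 KE by blast+
          ultimately show ?thesis using K(3) 1 by (auto simp: F_def disjoint_family_on_def)
        next
          case 2
          then show ?thesis using KA[of j] jk by (auto simp: F_def)
        next
          case 3
          then show ?thesis using KA[of k] jk by (auto simp: F_def)
        next
          case 4
          have "j div 2 \<noteq> k div 2" using jk(3) 4 by (metis odd_two_times_div_two_succ)
          moreover have "j div 2 \<in> K0" "k div 2 \<in> K0" using jk 4 KO by blast+
          ultimately show ?thesis using K0(3) 4 by (auto simp: F_def disjoint_family_on_def)
        qed
      qed
    qed
    moreover have "(\<Sum>i\<in>K0. N (G (A0 i))) \<le> (\<Sum>i\<in>K0. N (G (A0 i - B)) + e')"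
    proof (rule sum_mono)
      fix i assume i: "i \<in> K0"
      have m: "A0 i - B \<in> sets M" "A0 i \<inter> B \<in> sets M" using K0(2)[OF i] B by auto
      have "measure M (A0 i \<inter> B) \<le> measure M B" using B by (intro finite_measure_mono) auto
      then have "N (G (A0 i \<inter> B)) < e'" using d m(2) small by (auto simp: B_def)
      moreover have "G (A0 i) = G (A0 i - B) + G (A0 i \<inter> B)"
      proof -
        have "(A0 i - B) \<inter> (A0 i \<inter> B) = {}" "(A0 i - B) \<union> (A0 i \<inter> B) = A0 i" by auto
        then show ?thesis using G_Un[OF m] by simp
      qed
      ultimately show "N (G (A0 i)) \<le> N (G (A0 i - B)) + e'"
        using N_triangle[of "G (A0 i - B)" "G (A0 i \<inter> B)"] m by simp
    qed
    moreover have "(\<Sum>i\<in>K0. N (G (A0 i - B)) + e') = (\<Sum>i\<in>K0. N (G (A0 i - B))) + real (card K0) * e'"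
      by (simp add: sum.distrib)
    moreover have "real (card K0) * e' \<le> e / 2" using e by (simp add: e'_def field_simps)
    ultimately show ?thesis using split big by linarith
  qed
  then show ?thesis using d(1) that by blast
qed

text \<open>Finite measurable partitions are encoded as simple functions into the naturals, with the
  fibres as members: common refinements become pairs, and refinement becomes factorisation.\<close>

definition atom :: "('b \<Rightarrow> nat) \<Rightarrow> nat \<Rightarrow> 'b set" where
  "atom q i = q -` {i} \<inter> space M"

text \<open>On a null atom the inverse of 0 is 0, so the average is 0; as \<open>G\<close> vanishes
  there too, \<open>measure_average\<close> holds for every atom.\<close>

definition average :: "('b \<Rightarrow> nat) \<Rightarrow> nat \<Rightarrow> L0" where
  "average q i = G (atom q i) /\<^sub>R measure M (atom q i)"

text \<open>If a density exists, this is its conditional expectation given the partition.\<close>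

definition step :: "('b \<Rightarrow> nat) \<Rightarrow> 'b \<Rightarrow> L0" where
  "step q \<omega> = average q (q \<omega>)"

lemma atom_measurable [measurable, simp]: "simple_function M q \<Longrightarrow> atom q i \<in> sets M"
  unfolding atom_def by (rule simple_functionD)

lemma atom_disjoint: "disjoint_family_on (atom q) K"
  by (auto simp: disjoint_family_on_def atom_def)

lemma average_mem [simp]: "simple_function M q \<Longrightarrow> average q i \<in> V"
  by (simp add: average_def V_scaleR)

lemma step_mem [simp]: "simple_function M q \<Longrightarrow> step q \<omega> \<in> V"
  by (simp add: step_def)

lemma measure_average: "simple_function M q \<Longrightarrow> measure M (atom q i) *\<^sub>R average q i = G (atom q i)"
  by (cases "measure M (atom q i) = 0") (auto simp: average_def G_null)

lemma step_simple: assumes "simple_function M q" shows "simple_into V M (step q)"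
proof -
  have "simple_function M (\<lambda>\<omega>. average q (q \<omega>))"
    by (rule simple_function_compose1[OF assms])
  then have "simple_function M (step q)" by (simp add: step_def[abs_def])
  then show ?thesis using assms by (auto simp: simple_into_def)
qed

lemma integral_simple_compose:
  assumes q: "simple_function M q"
  shows "integrable M (\<lambda>\<omega>. f (q \<omega>) :: real)"
    and "(\<integral>\<omega>. f (q \<omega>) \<partial>M) = (\<Sum>i\<in>q ` space M. measure M (atom q i) * f i)"
proof -
  have fin: "finite (q ` space M)" using q by (rule simple_functionD)
  have eq: "f (q \<omega>) = (\<Sum>i\<in>q ` space M. indicator (atom q i) \<omega> * f i)" if "\<omega> \<in> space M" for \<omega>
  proof -
    have "(\<Sum>i\<in>q ` space M. indicator (atom q i) \<omega> * f i) = (\<Sum>i\<in>q ` space M. if i = q \<omega> then f i else 0)"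
      using that by (intro sum.cong) (auto simp: atom_def indicator_def)
    then show ?thesis using fin that by (simp add: sum.delta)
  qed
  have int: "integrable M (\<lambda>\<omega>. indicator (atom q i) \<omega> * f i)" for i
    using q by (intro integrable_mult_left integrable_real_indicator) (auto simp: less_top[symmetric])
  have "integrable M (\<lambda>\<omega>. \<Sum>i\<in>q ` space M. indicator (atom q i) \<omega> * f i)"
    by (intro Bochner_Integration.integrable_sum int)
  then show "integrable M (\<lambda>\<omega>. f (q \<omega>) :: real)"
    using eq by (subst Bochner_Integration.integrable_cong[OF refl eq]) auto
  have "(\<integral>\<omega>. f (q \<omega>) \<partial>M) = (\<integral>\<omega>. (\<Sum>i\<in>q ` space M. indicator (atom q i) \<omega> * f i) \<partial>M)"
    by (intro Bochner_Integration.integral_cong refl eq)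
  also have "\<dots> = (\<Sum>i\<in>q ` space M. \<integral>\<omega>. indicator (atom q i) \<omega> * f i \<partial>M)"
    by (intro Bochner_Integration.integral_sum int)
  also have "\<dots> = (\<Sum>i\<in>q ` space M. measure M (atom q i) * f i)"
    using sets.sets_into_space[OF atom_measurable[OF q]] by (simp add: Int_absorb2)
  finally show "(\<integral>\<omega>. f (q \<omega>) \<partial>M) = (\<Sum>i\<in>q ` space M. measure M (atom q i) * f i)" .
qed

lemma measure_times_norm_average:
  "simple_function M q \<Longrightarrow> measure M (atom q i) * N (average q i) = N (G (atom q i))"
  using N_scaleR[of "average q i" "measure M (atom q i)"] by (simp add: measure_average)

lemma integral_norm_step_le:
  assumes q: "simple_function M q"
  shows "integrable M (\<lambda>\<omega>. N (step q \<omega>))" "(\<integral>\<omega>. N (step q \<omega>) \<partial>M) \<le> variation"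
proof -
  show "integrable M (\<lambda>\<omega>. N (step q \<omega>))"
    unfolding step_def by (rule integral_simple_compose[OF q])
  have "(\<integral>\<omega>. N (step q \<omega>) \<partial>M) = (\<Sum>i\<in>q ` space M. N (G (atom q i)))"
    unfolding step_def using integral_simple_compose(2)[OF q, of "\<lambda>i. N (average q i)"]
    by (simp add: measure_times_norm_average[OF q])
  also have "\<dots> \<le> variation"
    using q by (intro sum_le_variation atom_disjoint) (auto intro: simple_functionD)
  finally show "(\<integral>\<omega>. N (step q \<omega>) \<partial>M) \<le> variation" .
qed

text \<open>Atoms whose average has norm above \<open>L\<close> have total measure below
  \<open>d\<close>, so by absolute continuity of the variation they contribute at most
  \<open>e / 2\<close>. On the others the averages stay in a fixed ball, where the excess is
  uniformly small.\<close>

lemma integral_tail_step_le: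
  assumes e: "0 < e"
  obtains l where "0 \<le> l" "\<And>q. simple_function M q \<Longrightarrow> (\<integral>\<omega>. tail l (step q \<omega>) \<partial>M) \<le> e"
proof -
  obtain C where C: "0 < C" "\<forall>x\<in>V. pnorm x \<le> C * N x" using pnorm_le_norm by blast
  have "0 < e / (2 * C)" using e C by simp
  from variation_abs_continuous[OF this] obtain d where d: "0 < d"
    "\<And>K (A :: nat \<Rightarrow> 'b set). finite K \<Longrightarrow> (\<And>i. i \<in> K \<Longrightarrow> A i \<in> sets M) \<Longrightarrow>
    disjoint_family_on A K \<Longrightarrow> measure M (\<Union>i\<in>K. A i) < d \<Longrightarrow> (\<Sum>i\<in>K. N (G (A i))) \<le> e / (2 * C)"
    by blast
  \<comment> \<open>Chebyshev: \<open>L\<close> times the measure of the bad atoms is at most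
    \<open>variation\<close>, which is less than \<open>L * d\<close>.\<close>
  define L where "L = (variation + 1) / d"
  have L: "0 < L" using d variation_nonneg by (simp add: L_def)
  define m where "m = measure M (space M) + 1"
  have m: "0 < m" by (simp add: m_def add_nonneg_pos)
  have "0 < e / (2 * m)" using e m by simp
  from tail_uniform[OF this L] obtain l where l: "0 \<le> l" "\<And>x. x \<in> V \<Longrightarrow> N x \<le> L \<Longrightarrow> tail l x \<le> e / (2 * m)"
    by blast
  have "(\<integral>\<omega>. tail l (step q \<omega>) \<partial>M) \<le> e" if q: "simple_function M q" for q
  proof -
    define Q where "Q = q ` space M"
    have fin: "finite Q" unfolding Q_def using q by (rule simple_functionD)
    define B where "B = {i \<in> Q. L < N (average q i)}"
    have measB: "measure M (\<Union>i\<in>B. atom q i) = (\<Sum>i\<in>B. measure M (atom q i))"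
      using fin q by (intro finite_measure_finite_Union atom_disjoint) (auto simp: B_def)
    have "L * measure M (\<Union>i\<in>B. atom q i) \<le> (\<Sum>i\<in>B. measure M (atom q i) * N (average q i))"
      unfolding measB sum_distrib_left by (intro sum_mono) (auto simp: B_def mult.commute[of L] intro!: mult_left_mono)
    also have "\<dots> = (\<Sum>i\<in>B. N (G (atom q i)))" by (simp add: measure_times_norm_average[OF q])
    also have "\<dots> \<le> variation" using fin q by (intro sum_le_variation atom_disjoint) (auto simp: B_def)
    also have "\<dots> < L * d" using d by (simp add: L_def)
    finally have "measure M (\<Union>i\<in>B. atom q i) < d" using L by simp
    then have bad: "(\<Sum>i\<in>B. N (G (atom q i))) \<le> e / (2 * C)"
      using fin q by (intro d(2) atom_disjoint) (auto simp: B_def)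
    have "(\<integral>\<omega>. tail l (step q \<omega>) \<partial>M) = (\<Sum>i\<in>Q. measure M (atom q i) * tail l (average q i))"
      unfolding step_def Q_def using integral_simple_compose(2)[OF q, of "\<lambda>i. tail l (average q i)"] .
    also have "\<dots> \<le> (\<Sum>i\<in>Q. measure M (atom q i) * (e / (2 * m)) + (if i \<in> B then C * N (G (atom q i)) else 0))"
    proof (rule sum_mono)
      fix i assume i: "i \<in> Q"
      show "measure M (atom q i) * tail l (average q i) \<le>
        measure M (atom q i) * (e / (2 * m)) + (if i \<in> B then C * N (G (atom q i)) else 0)"
      proof (cases "i \<in> B")
        case True
        have "tail l (average q i) \<le> C * N (average q i)"
          using tail_le_pnorm[OF _ l(1), of "average q i"] C(2) q by (meson average_mem order_trans)
        then have "measure M (atom q i) * tail l (average q i) \<le> measure M (atom q i) * (C * N (average q i))"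
          by (intro mult_left_mono) auto
        also have "\<dots> = C * N (G (atom q i))" using measure_times_norm_average[OF q, of i] by (simp add: mult_ac)
        finally show ?thesis using True e m by (simp add: add_increasing)
      next
        case False
        then have "tail l (average q i) \<le> e / (2 * m)" using i q by (intro l(2)) (auto simp: B_def)
        then have "measure M (atom q i) * tail l (average q i) \<le> measure M (atom q i) * (e / (2 * m))"
          by (intro mult_left_mono) auto
        then show ?thesis using False by simp
      qed
    qed
    also have "\<dots> = (\<Sum>i\<in>Q. measure M (atom q i)) * (e / (2 * m)) + C * (\<Sum>i\<in>B. N (G (atom q i)))"
    proof -
      have "(\<Sum>i\<in>Q. if i \<in> B then C * N (G (atom q i)) else 0) = (\<Sum>i\<in>B. C * N (G (atom q i)))"
        using fin by (subst sum.If_cases) (auto simp: B_def Int_def intro!: sum.cong)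
      then show ?thesis by (simp only: sum.distrib sum_distrib_right sum_distrib_left)
    qed
    also have "\<dots> \<le> m * (e / (2 * m)) + C * (e / (2 * C))"
    proof (intro add_mono mult_right_mono mult_left_mono bad)
      have "(\<Sum>i\<in>Q. measure M (atom q i)) = measure M (\<Union>i\<in>Q. atom q i)"
        using fin q by (intro finite_measure_finite_Union[symmetric] atom_disjoint) auto
      also have "\<dots> \<le> m" using bounded_measure[of "\<Union>i\<in>Q. atom q i"] by (simp add: m_def)
      finally show "(\<Sum>i\<in>Q. measure M (atom q i)) \<le> m" .
    qed (use e m C in auto)
    also have "\<dots> = e" using m C by simp
    finally show ?thesis .
  qed
  then show ?thesis using l(1) that by blast
qed

section \<open>Refinement of partitions and Cauchy chains\<close>

definition refines :: "('b \<Rightarrow> nat) \<Rightarrow> ('b \<Rightarrow> nat) \<Rightarrow> bool" where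
  "refines q' q \<longleftrightarrow> (\<exists>h. \<forall>\<omega>\<in>space M. q \<omega> = h (q' \<omega>))"

lemma refines_refl: "refines q q" unfolding refines_def by (intro exI[of _ id]) simp

lemma refines_trans: "refines q'' q' \<Longrightarrow> refines q' q \<Longrightarrow> refines q'' q"
  unfolding refines_def by (metis comp_apply)

lemma G_atom_refine:
  assumes q: "simple_function M q" "simple_function M q'" and h: "\<And>\<omega>. \<omega> \<in> space M \<Longrightarrow> q \<omega> = h (q' \<omega>)"
  shows "G (atom q i) = (\<Sum>j\<in>{j \<in> q' ` space M. h j = i}. G (atom q' j))"
    and "measure M (atom q i) = (\<Sum>j\<in>{j \<in> q' ` space M. h j = i}. measure M (atom q' j))"
proof -
  have eq: "atom q i = (\<Union>j\<in>{j \<in> q' ` space M. h j = i}. atom q' j)"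
    using h by (auto simp: atom_def)
  have fin: "finite {j \<in> q' ` space M. h j = i}" using simple_functionD(1)[OF q(2)] by simp
  show "G (atom q i) = (\<Sum>j\<in>{j \<in> q' ` space M. h j = i}. G (atom q' j))"
    unfolding eq using q by (intro G_UN fin atom_disjoint) auto
  show "measure M (atom q i) = (\<Sum>j\<in>{j \<in> q' ` space M. h j = i}. measure M (atom q' j))"
    unfolding eq using q by (intro finite_measure_finite_Union fin atom_disjoint) auto
qed

text \<open>The martingale property: on an atom of the coarse partition the first argument is
  constant, and the averages over the finer atoms, weighted by measure, add up to the coarse one. It
  removes the first-order term of the Bregman divergence.\<close>

lemma integral_pairing_zero:
  assumes q: "simple_function M q" "simple_function M q'" and r: "refines q' q" and T: "0 \<le> T"
  shows "(\<integral>\<omega>. pairing T (step q \<omega>) (step q' \<omega>) - pairing T (step q \<omega>) (step q \<omega>) \<partial>M) = 0"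
proof -
  obtain h where h: "\<And>\<omega>. \<omega> \<in> space M \<Longrightarrow> q \<omega> = h (q' \<omega>)" using r by (auto simp: refines_def)
  define u where "u i = average q i" for i
  define Q where "Q = q' ` space M"
  have fin: "finite Q" unfolding Q_def using q(2) by (rule simple_functionD)
  have u: "u i \<in> V" for i using q by (simp add: u_def)
  have "(\<integral>\<omega>. pairing T (step q \<omega>) (step q' \<omega>) - pairing T (step q \<omega>) (step q \<omega>) \<partial>M)
    = (\<integral>\<omega>. (\<lambda>j. pairing T (u (h j)) (average q' j) - pairing T (u (h j)) (u (h j))) (q' \<omega>) \<partial>M)"
    by (intro Bochner_Integration.integral_cong refl) (simp add: step_def u_def h)
  also have "\<dots> = (\<Sum>j\<in>Q. measure M (atom q' j) * (pairing T (u (h j)) (average q' j) - pairing T (u (h j)) (u (h j))))"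
    unfolding Q_def by (rule integral_simple_compose[OF q(2)])
  also have "\<dots> = (\<Sum>j\<in>Q. pairing T (u (h j)) (G (atom q' j)) - measure M (atom q' j) * pairing T (u (h j)) (u (h j)))"
    by (intro sum.cong refl)
       (simp add: right_diff_distrib pairing_scaleR[symmetric] measure_average[OF q(2)])
  also have "\<dots> = (\<Sum>i\<in>h ` Q. \<Sum>j\<in>{j \<in> Q. h j = i}. pairing T (u (h j)) (G (atom q' j)) - measure M (atom q' j) * pairing T (u (h j)) (u (h j)))"
    using fin by (rule sum.image_gen)
  also have "\<dots> = (\<Sum>i\<in>h ` Q. 0)"
  proof (intro sum.cong refl)
    fix i
    have g1: "G (atom q i) = (\<Sum>j\<in>{j \<in> Q. h j = i}. G (atom q' j))"
      using G_atom_refine(1)[of q q' h i] q h by (simp add: Q_def)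
    have "(\<Sum>j\<in>{j \<in> Q. h j = i}. pairing T (u (h j)) (G (atom q' j)) - measure M (atom q' j) * pairing T (u (h j)) (u (h j)))
      = (\<Sum>j\<in>{j \<in> Q. h j = i}. pairing T (u i) (G (atom q' j))) - (\<Sum>j\<in>{j \<in> Q. h j = i}. measure M (atom q' j)) * pairing T (u i) (u i)"
      by (simp add: sum_subtractf sum_distrib_right)
    also have "(\<Sum>j\<in>{j \<in> Q. h j = i}. pairing T (u i) (G (atom q' j))) = pairing T (u i) (G (atom q i))"
      unfolding g1 using fin q T by (intro pairing_sum[symmetric]) auto
    also have "(\<Sum>j\<in>{j \<in> Q. h j = i}. measure M (atom q' j)) = measure M (atom q i)"
      using G_atom_refine(2)[of q q' h i] q h by (simp add: Q_def)
    also have "pairing T (u i) (G (atom q i)) = measure M (atom q i) * pairing T (u i) (u i)"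
      using measure_average[OF q(1), of i] pairing_scaleR[of T "u i" "measure M (atom q i)" "u i"] by (simp add: u_def)
    finally show "(\<Sum>j\<in>{j \<in> Q. h j = i}. pairing T (u (h j)) (G (atom q' j)) - measure M (atom q' j) * pairing T (u (h j)) (u (h j))) = 0"
      by simp
  qed
  finally show ?thesis by simp
qed

lemma integrable_simple_compose2:
  fixes q q' :: "'b \<Rightarrow> nat"
  assumes "simple_function M q" "simple_function M q'"
  shows "integrable M (\<lambda>\<omega>. f (q \<omega>) (q' \<omega>) :: real)"
proof -
  have "simple_function M (\<lambda>\<omega>. prod_encode (q \<omega>, q' \<omega>))"
    by (rule simple_function_compose2[OF assms])
  from integral_simple_compose(1)[OF this, of "\<lambda>k. case prod_decode k of (i, j) \<Rightarrow> f i j"]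
  show ?thesis by simp
qed

definition step_dist :: "('b \<Rightarrow> nat) \<Rightarrow> ('b \<Rightarrow> nat) \<Rightarrow> real" where
  "step_dist q' q = (\<integral>\<omega>. pnorm (step q' \<omega> - step q \<omega>) \<partial>M)"

lemma step_dist_integrable:
  "simple_function M q \<Longrightarrow> simple_function M q' \<Longrightarrow> integrable M (\<lambda>\<omega>. pnorm (step q' \<omega> - step q \<omega>))"
  unfolding step_def by (rule integrable_simple_compose2)

lemma step_dist_triangle:
  assumes "simple_function M q" "simple_function M r" "simple_function M s"
  shows "step_dist s r \<le> step_dist s q + step_dist r q"
proof -
  have "step_dist s r \<le> (\<integral>\<omega>. pnorm (step s \<omega> - step q \<omega>) + pnorm (step r \<omega> - step q \<omega>) \<partial>M)"
    unfolding step_dist_def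
  proof (rule integral_mono)
    show "pnorm (step s \<omega> - step r \<omega>) \<le> pnorm (step s \<omega> - step q \<omega>) + pnorm (step r \<omega> - step q \<omega>)" for \<omega>
      using p.norm_diff_triangle[of "step s \<omega>" "step q \<omega>" "step r \<omega>"]
        p.norm_diff_commute[of "step r \<omega>" "step q \<omega>"] assms by simp
  qed (intro Bochner_Integration.integrable_add step_dist_integrable assms)+
  also have "\<dots> = step_dist s q + step_dist r q"
    unfolding step_dist_def by (intro Bochner_Integration.integral_add step_dist_integrable assms)
  finally show ?thesis .
qed

text \<open>By convexity the energy of the averages grows under refinement and it is bounded, so it is nearly
  constant beyond some partition; its growth controls the distance of the averages.\<close>
lemma step_dist_small:
  assumes e: "0 < e"
  obtains q where "simple_function M q" "\<And>q'. simple_function M q' \<Longrightarrow> refines q' q \<Longrightarrow> step_dist q' q \<le> e"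
proof -
  obtain C where C: "0 < C" "\<forall>x\<in>V. pnorm x \<le> C * N x" using pnorm_le_norm by blast
  have "0 < e / 4" using e by simp
  from integral_tail_step_le[OF this] obtain T where T: "0 \<le> T"
    "\<And>q. simple_function M q \<Longrightarrow> (\<integral>\<omega>. tail T (step q \<omega>) \<partial>M) \<le> e / 4" by blast
  define m where "m = measure M (space M) + 1"
  have m: "0 < m" by (simp add: m_def add_nonneg_pos)
  \<comment> \<open>The summand \<open>d\<close> integrates to at most \<open>e / 4\<close> over
    \<open>M\<close>. The gain of energy is divided by \<open>d\<close>, hence the margin
    \<open>e * d / 4\<close> in the choice of \<open>q\<close>.\<close>
  define d where "d = e / (4 * m)"
  have d: "0 < d" using e m by (simp add: d_def)
  define J where "J q = (\<integral>\<omega>. energy T (step q \<omega>) \<partial>M)" for q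
  have J_int: "integrable M (\<lambda>\<omega>. energy T (step q \<omega>))" if "simple_function M q" for q
    unfolding step_def by (rule integral_simple_compose[OF that])
  have J_le: "J q \<le> 2 * T * C * variation" if q: "simple_function M q" for q
  proof -
    have "J q \<le> (\<integral>\<omega>. 2 * T * C * N (step q \<omega>) \<partial>M)"
      unfolding J_def
    proof (rule integral_mono[OF J_int[OF q]])
      show "integrable M (\<lambda>\<omega>. 2 * T * C * N (step q \<omega>))"
        by (intro integrable_mult_right integral_norm_step_le q)
      show "energy T (step q \<omega>) \<le> 2 * T * C * N (step q \<omega>)" for \<omega>
      proof -
        have "energy T (step q \<omega>) \<le> 2 * T * pnorm (step q \<omega>)" by (rule energy_bounds[OF step_mem[OF q] T(1)])
        also have "\<dots> \<le> 2 * T * (C * N (step q \<omega>))"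
          using C(2) step_mem[OF q] T(1) by (intro mult_left_mono) auto
        finally show ?thesis by (simp add: mult.assoc)
      qed
    qed
    also have "\<dots> = 2 * T * C * (\<integral>\<omega>. N (step q \<omega>) \<partial>M)" by simp
    also have "\<dots> \<le> 2 * T * C * variation"
      using T(1) C(1) by (intro mult_left_mono integral_norm_step_le q) auto
    finally show ?thesis .
  qed
  define S where "S = J ` {q. simple_function M q}"
  have S: "S \<noteq> {}" "bdd_above S"
    using J_le by (auto simp: S_def intro!: bdd_aboveI[of _ "2 * T * C * variation"] exI[of _ "\<lambda>_. 0"])
  have "\<exists>x\<in>S. Sup S - e * d / 4 < x"
    using e d by (intro less_cSupD S) simp
  then obtain q where q: "simple_function M q" "Sup S - e * d / 4 < J q" by (auto simp: S_def)
  have "step_dist q' q \<le> e" if q': "simple_function M q'" and r: "refines q' q" for q'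
  proof -
    have "J q' \<le> Sup S" using q' S by (intro cSup_upper) (auto simp: S_def)
    then have "(J q' - J q) / d \<le> e / 4" using q(2) d by (simp add: field_simps)
    have tail_int: "integrable M (\<lambda>\<omega>. tail T (step p \<omega>))" if "simple_function M p" for p
      unfolding step_def by (rule integral_simple_compose[OF that])
    define P where "P \<omega> = pairing T (step q \<omega>) (step q' \<omega>) - pairing T (step q \<omega>) (step q \<omega>)" for \<omega>
    have P_int: "integrable M P"
      using integrable_simple_compose2[OF q(1) q', of "\<lambda>i j. pairing T (average q i) (average q' j) - pairing T (average q i) (average q i)"]
      by (simp add: P_def[abs_def] step_def)
    have P_zero: "(\<integral>\<omega>. P \<omega> \<partial>M) = 0"
      unfolding P_def by (rule integral_pairing_zero[OF q(1) q' r T(1)])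
    note int = J_int[OF q(1)] J_int[OF q'] tail_int[OF q(1)] tail_int[OF q'] P_int
    have "step_dist q' q \<le> (\<integral>\<omega>. d + (energy T (step q' \<omega>) - energy T (step q \<omega>) - 2 * P \<omega>) / d
        + tail T (step q' \<omega>) + tail T (step q \<omega>) \<partial>M)"
      unfolding step_dist_def
    proof (rule integral_mono[OF step_dist_integrable[OF q(1) q']])
      show "pnorm (step q' \<omega> - step q \<omega>) \<le> d + (energy T (step q' \<omega>) - energy T (step q \<omega>) - 2 * P \<omega>) / d
        + tail T (step q' \<omega>) + tail T (step q \<omega>)" for \<omega>
        unfolding P_def using q(1) q' by (intro pnorm_bregman T(1) d) auto
    qed (use int in simp)
    also have "\<dots> = d * measure M (space M) + (J q' - J q) / d
      + (\<integral>\<omega>. tail T (step q' \<omega>) \<partial>M) + (\<integral>\<omega>. tail T (step q \<omega>) \<partial>M)"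
      using int by (simp add: J_def P_zero)
    also have "\<dots> \<le> e / 4 + e / 4 + e / 4 + e / 4"
    proof (intro add_mono T(2) q(1) q')
      have "d * measure M (space M) \<le> d * m" using d by (intro mult_left_mono) (auto simp: m_def)
      then show "d * measure M (space M) \<le> e / 4" using m by (simp add: d_def)
    qed fact
    finally show ?thesis by simp
  qed
  then show ?thesis using q(1) that by blast
qed

definition join :: "('b \<Rightarrow> nat) \<Rightarrow> ('b \<Rightarrow> nat) \<Rightarrow> 'b \<Rightarrow> nat" where
  "join q r \<omega> = prod_encode (q \<omega>, r \<omega>)"

lemma join_simple [simp]: "simple_function M q \<Longrightarrow> simple_function M r \<Longrightarrow> simple_function M (join q r)"
  unfolding join_def[abs_def] by (rule simple_function_compose2)

lemma join_refines: "refines (join q r) q" "refines (join q r) r"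
  unfolding refines_def join_def
  by (rule exI[of _ "\<lambda>k. fst (prod_decode k)"], simp) (rule exI[of _ "\<lambda>k. snd (prod_decode k)"], simp)

text \<open>The partitions \<open>Q n\<close> are unrelated, so they are joined successively. Both
  \<open>q'\<close> and \<open>q n\<close> refine \<open>Q n\<close> and lie within
  \<open>(1/2) ^ n / 2\<close> of it, and the two halves add up. The estimate concerns every
  refinement, not only later members of the chain.\<close>

lemma cauchy_chain:
  obtains q where "\<And>n::nat. simple_function M (q n)" "\<And>n. refines (q (Suc n)) (q n)"
    "\<And>n q'. simple_function M q' \<Longrightarrow> refines q' (q n) \<Longrightarrow> step_dist q' (q n) \<le> (1/2) ^ n"
proof -
  have "\<exists>q. simple_function M q \<and> (\<forall>q'. simple_function M q' \<longrightarrow> refines q' q \<longrightarrow> step_dist q' q \<le> (1/2) ^ n / 2)" for n :: nat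
  proof -
    have "0 < (1/2 :: real) ^ n / 2" by simp
    then show ?thesis by (rule step_dist_small) blast
  qed
  then obtain Q where Q: "\<And>n::nat. simple_function M (Q n)"
    "\<And>n q'. simple_function M q' \<Longrightarrow> refines q' (Q n) \<Longrightarrow> step_dist q' (Q n) \<le> (1/2) ^ n / 2"
    by metis
  define q where "q n = rec_nat (Q 0) (\<lambda>k p. join p (Q (Suc k))) n" for n
  have q0: "q 0 = Q 0" and qS: "q (Suc n) = join (q n) (Q (Suc n))" for n by (simp_all add: q_def)
  have s: "simple_function M (q n)" for n by (induction n) (simp_all add: q0 qS Q)
  have r: "refines (q n) (Q n)" for n by (cases n) (simp_all add: q0 qS refines_refl join_refines)
  show ?thesis
  proof (rule that[of q])
    fix n q' assume q': "simple_function M q'" "refines q' (q n)"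
    have "step_dist q' (q n) \<le> step_dist q' (Q n) + step_dist (q n) (Q n)"
      by (rule step_dist_triangle) (use Q s q' in auto)
    moreover have "step_dist q' (Q n) \<le> (1/2) ^ n / 2" "step_dist (q n) (Q n) \<le> (1/2) ^ n / 2"
      using q' r s refines_trans by (blast intro: Q(2))+
    ultimately show "step_dist q' (q n) \<le> (1/2) ^ n" by simp
  qed (simp_all add: s qS join_refines)
qed

end

section \<open>Existence of densities\<close>

context orlicz_lorentz_space
begin

section \<open>Almost everywhere limits and truncations of elements of the space\<close>

lemma pnorm_Fatou:
  assumes x: "\<And>n::nat. x n \<in> V" and z: "z \<in> V"
    and lim: "AE t in lebesgue. t \<in> I \<longrightarrow> (\<lambda>n. rep_L0 (x n) t) \<longlonglongrightarrow> rep_L0 z t"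
  shows "ennreal (pnorm z) \<le> liminf (\<lambda>n. ennreal (pnorm (x n)))"
proof -
  have "ennreal (pnorm z) = (\<integral>\<^sup>+ t. ennreal \<bar>rep_L0 z t\<bar> \<partial>eta)"
    by (rule nn_integral_rep_eq_pnorm[OF z, symmetric])
  also have "\<dots> \<le> (\<integral>\<^sup>+ t. liminf (\<lambda>n. ennreal \<bar>rep_L0 (x n) t\<bar>) \<partial>eta)"
  proof (rule nn_integral_mono_AE)
    show "AE t in eta. ennreal \<bar>rep_L0 z t\<bar> \<le> liminf (\<lambda>n. ennreal \<bar>rep_L0 (x n) t\<bar>)"
      unfolding AE_eta using lim
    proof eventually_elim
      case (elim t)
      show ?case
      proof
        assume "t \<in> I"
        then have "(\<lambda>n. ennreal \<bar>rep_L0 (x n) t\<bar>) \<longlonglongrightarrow> ennreal \<bar>rep_L0 z t\<bar>"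
          using elim by (intro tendsto_ennrealI tendsto_rabs) auto
        then have "liminf (\<lambda>n. ennreal \<bar>rep_L0 (x n) t\<bar>) = ennreal \<bar>rep_L0 z t\<bar>"
          by (rule lim_imp_Liminf[rotated]) simp
        then show "ennreal \<bar>rep_L0 z t\<bar> \<le> liminf (\<lambda>n. ennreal \<bar>rep_L0 (x n) t\<bar>)"
          by (rule eq_refl[OF sym])
      qed
    qed
  qed
  also have "\<dots> \<le> liminf (\<lambda>n. \<integral>\<^sup>+ t. ennreal \<bar>rep_L0 (x n) t\<bar> \<partial>eta)"
    by (rule nn_integral_liminf) measurable
  finally show ?thesis by (simp add: nn_integral_rep_eq_pnorm[OF x])
qed

text \<open>The argument of Riesz and Fischer in L^1 of \<open>eta\<close>. The limit is placed in
  \<open>L0_on \<gamma>\<close> only; membership in \<open>V\<close> comes from bounds on Luxemburg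
  norms.\<close>

lemma fast_cauchy_converges:
  assumes x: "\<And>n::nat. x n \<in> V" and sum: "summable (\<lambda>n. pnorm (x (Suc n) - x n))"
  shows "\<exists>z\<in>L0_on \<gamma>. AE t in lebesgue. t \<in> I \<longrightarrow> (\<lambda>n. rep_L0 (x n) t) \<longlonglongrightarrow> rep_L0 z t"
proof -
  have d: "x (Suc n) - x n \<in> V" for n by (intro space.diff_mem x)
  have "(\<integral>\<^sup>+ t. (\<Sum>n. ennreal \<bar>rep_L0 (x (Suc n) - x n) t\<bar>) \<partial>eta) = (\<Sum>n. ennreal (pnorm (x (Suc n) - x n)))"
    by (subst nn_integral_suminf) (simp_all add: nn_integral_rep_eq_pnorm[OF d])
  also have "\<dots> = ennreal (\<Sum>n. pnorm (x (Suc n) - x n))"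
    by (rule suminf_ennreal2[OF pnorm_nonneg sum])
  finally have "(\<integral>\<^sup>+ t. (\<Sum>n. ennreal \<bar>rep_L0 (x (Suc n) - x n) t\<bar>) \<partial>eta) \<noteq> \<infinity>" by simp
  then have "AE t in eta. (\<Sum>n. ennreal \<bar>rep_L0 (x (Suc n) - x n) t\<bar>) \<noteq> \<infinity>"
    by (intro nn_integral_noteq_infinite) auto
  then have A: "AE t in lebesgue. t \<in> I \<longrightarrow> (\<Sum>n. ennreal \<bar>rep_L0 (x (Suc n) - x n) t\<bar>) \<noteq> top"
    by (simp only: AE_eta infinity_ennreal_def)
  have B: "AE t in lebesgue. \<forall>n. rep_L0 (x (Suc n) - x n) t = rep_L0 (x (Suc n)) t - rep_L0 (x n) t"
    by (subst AE_all_countable) (auto intro: rep_L0_diff)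
  have conv: "AE t in lebesgue. t \<in> I \<longrightarrow> convergent (\<lambda>n. rep_L0 (x n) t)"
    using A B
  proof eventually_elim
    case (elim t)
    show ?case
    proof
      assume "t \<in> I"
      then have "(\<Sum>n. ennreal \<bar>rep_L0 (x (Suc n) - x n) t\<bar>) \<noteq> top"
        by (rule elim(1)[rule_format])
      moreover have "(\<lambda>n. ennreal \<bar>rep_L0 (x (Suc n) - x n) t\<bar>) = (\<lambda>n. ennreal \<bar>rep_L0 (x (Suc n)) t - rep_L0 (x n) t\<bar>)"
        by (rule ext, subst elim(2)[rule_format], rule refl)
      ultimately have "(\<Sum>n. ennreal \<bar>rep_L0 (x (Suc n)) t - rep_L0 (x n) t\<bar>) \<noteq> top" by argo
      then have "summable (\<lambda>n. \<bar>rep_L0 (x (Suc n)) t - rep_L0 (x n) t\<bar>)"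
        by (rule summable_suminf_not_top[OF abs_ge_zero])
      then have "summable (\<lambda>n. rep_L0 (x (Suc n)) t - rep_L0 (x n) t)" by (rule summable_rabs_cancel)
      then have "convergent (\<lambda>n. \<Sum>k<n. rep_L0 (x (Suc k)) t - rep_L0 (x k) t)"
        by (simp add: summable_iff_convergent)
      then have "convergent (\<lambda>n. (\<Sum>k<n. rep_L0 (x (Suc k)) t - rep_L0 (x k) t) + rep_L0 (x 0) t)"
        by (intro convergent_add convergent_const)
      moreover have "(\<Sum>k<n. rep_L0 (x (Suc k)) t - rep_L0 (x k) t) + rep_L0 (x 0) t = rep_L0 (x n) t" for n
        by (induction n) simp_all
      ultimately show "convergent (\<lambda>n. rep_L0 (x n) t)"
        by (simp only:)
    qed
  qed
  define f where "f t = indicator I t * lim (\<lambda>n. rep_L0 (x n) t)" for t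
  have f [measurable]: "f \<in> borel_measurable lebesgue" unfolding f_def by measurable
  show ?thesis
  proof (intro bexI[of _ "abs_L0 f"])
    show "abs_L0 f \<in> L0_on \<gamma>"
      unfolding L0_on_iff using rep_abs_L0[OF f] by eventually_elim (simp add: f_def)
    show "AE t in lebesgue. t \<in> I \<longrightarrow> (\<lambda>n. rep_L0 (x n) t) \<longlonglongrightarrow> rep_L0 (abs_L0 f) t"
      using rep_abs_L0[OF f] conv by eventually_elim (simp add: f_def convergent_LIMSEQ_iff)
  qed
qed

text \<open>A finite lower limit bounds the norms along a subsequence, and the Fatou property is
  applied to that subsequence.\<close>

lemma N_liminf:
  assumes x: "\<And>n::nat. x n \<in> V" and z: "z \<in> L0_on \<gamma>"
    and lim: "AE t in lebesgue. t \<in> I \<longrightarrow> (\<lambda>n. rep_L0 (x n) t) \<longlonglongrightarrow> rep_L0 z t"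
    and fin: "liminf (\<lambda>n. ennreal (N (x n))) < \<infinity>"
  shows "z \<in> V" "ennreal (N z) \<le> liminf (\<lambda>n. ennreal (N (x n)))"
proof -
  have *: "z \<in> V \<and> N z \<le> e" if e: "liminf (\<lambda>n. ennreal (N (x n))) < ennreal e" for e
  proof -
    have e0: "0 < e" using e by (metis ennreal_neg not_less not_less_zero)
    have "infinite {n. N (x n) \<le> e}"
    proof
      assume "finite {n. N (x n) \<le> e}"
      then obtain k where k: "\<And>n. N (x n) \<le> e \<Longrightarrow> n < k"
        by (meson finite_nat_set_iff_bounded mem_Collect_eq)
      have "\<forall>\<^sub>F n in sequentially. ennreal e \<le> ennreal (N (x n))"
        using eventually_ge_at_top[of k]
      proof eventually_elim
        case (elim n)
        then have "\<not> N (x n) \<le> e" using k[of n] by auto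
        then show ?case by (intro ennreal_leI) simp
      qed
      then have "ennreal e \<le> liminf (\<lambda>n. ennreal (N (x n)))" by (rule Liminf_bounded)
      with e show False by simp
    qed
    then obtain r :: "nat \<Rightarrow> nat" where r: "strict_mono r" "\<forall>n. r n \<in> {n. N (x n) \<le> e}"
      using infinite_enumerate by blast
    have "AE t in lebesgue. t \<in> I \<longrightarrow> (\<lambda>n. rep_L0 (x (r n)) t) \<longlonglongrightarrow> rep_L0 z t"
      using lim by eventually_elim (use LIMSEQ_subseq_LIMSEQ[OF _ r(1)] in \<open>auto simp: comp_def\<close>)
    then show ?thesis
      using N_Fatou[of "\<lambda>n. x (r n)" e z] x r(2) e0 z by auto
  qed
  obtain L where L: "liminf (\<lambda>n. ennreal (N (x n))) = ennreal L" "0 \<le> L"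
    using fin by (cases "liminf (\<lambda>n. ennreal (N (x n)))") auto
  show "z \<in> V" using *[of "L + 1"] L by (simp add: ennreal_less_iff)
  have "N z \<le> L + e" if "0 < e" for e
    using *[of "L + e"] L that by (simp add: ennreal_less_iff)
  then have "N z \<le> L" by (rule field_le_epsilon)
  then show "ennreal (N z) \<le> liminf (\<lambda>n. ennreal (N (x n)))" using L by (simp add: ennreal_leI)
qed

text \<open>Cuts both the values and the support at \<open>m\<close>. The result has finite modular
  at every scale, so almost everywhere convergence of functions gives norm convergence of their
  truncations.\<close>

definition trunc :: "nat \<Rightarrow> L0 \<Rightarrow> L0" where
  "trunc m x = abs_L0 (\<lambda>t. if t \<in> I \<and> t \<le> real m then clamp_to (real m) (rep_L0 x t) else 0)"

lemma id_lebesgue_measurable: "(\<lambda>t::real. t) \<in> borel_measurable lebesgue"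
  by (rule measurable_completion) simp

lemma box_measurable: "{t \<in> space lebesgue. t \<in> I \<and> t \<le> real m} \<in> sets lebesgue"
proof -
  note id_lebesgue_measurable [measurable]
  show ?thesis by measurable
qed

lemma trunc_fun_measurable [measurable]:
  "(\<lambda>t. if t \<in> I \<and> t \<le> real m then clamp_to (real m) (rep_L0 x t) else 0) \<in> borel_measurable lebesgue"
  by (rule measurable_If[OF _ _ box_measurable]) measurable

lemma rep_trunc: "AE t in lebesgue. rep_L0 (trunc m x) t = (if t \<in> I \<and> t \<le> real m then clamp_to (real m) (rep_L0 x t) else 0)"
  unfolding trunc_def by (rule rep_abs_L0[OF trunc_fun_measurable])

lemma trunc_bounds: "trunc m x \<in> L0_on \<gamma>" "rho (l *\<^sub>R trunc m x) < \<infinity>"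
proof -
  let ?f = "\<lambda>t. if t \<in> I \<and> t \<le> real m then clamp_to (real m) (rep_L0 x t) else 0"
  have "\<bar>?f t\<bar> \<le> real m" for t using abs_clamp_to[of "real m"] by simp
  moreover have "?f t = 0" if "t \<notin> I \<or> real m < t" for t using that by auto
  ultimately show "trunc m x \<in> L0_on \<gamma>" "rho (l *\<^sub>R trunc m x) < \<infinity>"
    unfolding trunc_def by (intro bounded_in_V[OF trunc_fun_measurable]; blast)+
qed

lemma trunc_mem: "trunc m x \<in> V"
  using trunc_bounds(1)[of m x] trunc_bounds(2)[of 1 m x] by (auto simp: orlicz_lorentz_def intro!: exI[of _ 1])

lemma clamp_to_continuous: "(f \<longlongrightarrow> a) F \<Longrightarrow> ((\<lambda>n. clamp_to T (f n)) \<longlongrightarrow> clamp_to T a) F"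
  unfolding clamp_to_def by (intro tendsto_max tendsto_min tendsto_const)

lemma L0_on_diff: "x \<in> L0_on \<gamma> \<Longrightarrow> y \<in> L0_on \<gamma> \<Longrightarrow> x - y \<in> L0_on \<gamma>"
  using L0_on_add[of x "- y"] L0_on_scaleR[of y "-1"] by simp

lemma trunc_continuous:
  assumes lim: "AE t in lebesgue. t \<in> I \<longrightarrow> (\<lambda>n. rep_L0 (x n) t) \<longlonglongrightarrow> rep_L0 z t"
  shows "(\<lambda>n. N (trunc m (x n) - trunc m z)) \<longlonglongrightarrow> 0"
proof -
  define f where "f t = (if t \<in> I \<and> t \<le> real m then 2 * real m else 0)" for t :: real
  have f [measurable]: "f \<in> borel_measurable lebesgue"
    unfolding f_def by (rule measurable_If[OF _ _ box_measurable]) measurable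
  have all: "AE t in lebesgue. \<forall>n. rep_L0 (trunc m (x n) - trunc m z) t = (if t \<in> I \<and> t \<le> real m
      then clamp_to (real m) (rep_L0 (x n) t) - clamp_to (real m) (rep_L0 z t) else 0)"
    unfolding AE_all_countable
  proof
    fix n
    show "AE t in lebesgue. rep_L0 (trunc m (x n) - trunc m z) t = (if t \<in> I \<and> t \<le> real m
      then clamp_to (real m) (rep_L0 (x n) t) - clamp_to (real m) (rep_L0 z t) else 0)"
      using rep_L0_diff[of "trunc m (x n)" "trunc m z"] rep_trunc[of m "x n"] rep_trunc[of m z]
      by eventually_elim simp
  qed
  show ?thesis
  proof (rule N_dominated_convergence[where y = "abs_L0 f"])
    show "rho (l *\<^sub>R abs_L0 f) < \<infinity>" for l
      by (rule bounded_in_V(2)[OF f, of "2 * real m" "real m"]) (auto simp: f_def)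
    show "trunc m (x n) - trunc m z \<in> L0_on \<gamma>" for n
      by (intro L0_on_diff trunc_bounds)
    show "AE t in lebesgue. t \<in> I \<longrightarrow> \<bar>rep_L0 (trunc m (x n) - trunc m z) t\<bar> \<le> \<bar>rep_L0 (abs_L0 f) t\<bar>" for n
      using all rep_abs_L0[OF f]
    proof eventually_elim
      case (elim t)
      have "\<bar>clamp_to (real m) (rep_L0 (x n) t) - clamp_to (real m) (rep_L0 z t)\<bar> \<le> 2 * real m"
        using abs_clamp_to[of "real m" "rep_L0 (x n) t"] abs_clamp_to[of "real m" "rep_L0 z t"] by simp
      then show ?case using elim by (simp add: f_def)
    qed
    show "AE t in lebesgue. t \<in> I \<longrightarrow> (\<lambda>n. rep_L0 (trunc m (x n) - trunc m z) t) \<longlonglongrightarrow> 0"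
      using all lim
    proof eventually_elim
      case (elim t)
      show ?case
      proof
        assume "t \<in> I"
        then have "(\<lambda>n. clamp_to (real m) (rep_L0 (x n) t) - clamp_to (real m) (rep_L0 z t)) \<longlonglongrightarrow> 0"
          using LIM_zero[OF clamp_to_continuous[OF elim(2)[rule_format]]] by blast
        then show "(\<lambda>n. rep_L0 (trunc m (x n) - trunc m z) t) \<longlonglongrightarrow> 0"
          using elim(1) \<open>t \<in> I\<close> by (cases "t \<le> real m") auto
      qed
    qed
  qed
qed

text \<open>The error is dominated by \<open>z\<close> itself and vanishes at \<open>t\<close> as
  soon as \<open>m\<close> is at least \<open>t\<close> and the absolute value of \<open>z\<close>
  there.\<close>

lemma trunc_tendsto:
  assumes fin: "\<And>l. rho (l *\<^sub>R z) < \<infinity>" and z: "z \<in> V"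
  shows "(\<lambda>m. N (trunc m z - z)) \<longlonglongrightarrow> 0"
proof -
  have all: "AE t in lebesgue. \<forall>m. rep_L0 (trunc m z - z) t = (if t \<in> I \<and> t \<le> real m
      then clamp_to (real m) (rep_L0 z t) else 0) - rep_L0 z t"
    unfolding AE_all_countable
  proof
    fix m
    show "AE t in lebesgue. rep_L0 (trunc m z - z) t = (if t \<in> I \<and> t \<le> real m
      then clamp_to (real m) (rep_L0 z t) else 0) - rep_L0 z t"
      using rep_L0_diff[of "trunc m z" z] rep_trunc[of m z] by eventually_elim simp
  qed
  show ?thesis
  proof (rule N_dominated_convergence[where y = z])
    show "trunc m z - z \<in> L0_on \<gamma>" for m by (intro L0_on_diff trunc_bounds V_L0_on z)
    show "AE t in lebesgue. t \<in> I \<longrightarrow> \<bar>rep_L0 (trunc m z - z) t\<bar> \<le> \<bar>rep_L0 z t\<bar>" for m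
      using all
    proof eventually_elim
      case (elim t)
      have "\<bar>clamp_to (real m) (rep_L0 z t) - rep_L0 z t\<bar> \<le> \<bar>rep_L0 z t\<bar>" by (auto simp: clamp_to_def)
      then show ?case using elim by simp
    qed
    show "AE t in lebesgue. t \<in> I \<longrightarrow> (\<lambda>m. rep_L0 (trunc m z - z) t) \<longlonglongrightarrow> 0"
      using all
    proof eventually_elim
      case (elim t)
      obtain k :: nat where k: "max t \<bar>rep_L0 z t\<bar> \<le> real k" using real_arch_simple by blast
      show ?case
      proof
        assume t: "t \<in> I"
        have "\<forall>\<^sub>F m in sequentially. rep_L0 (trunc m z - z) t = 0"
          using eventually_ge_at_top[of k]
        proof eventually_elim
          case (elim m)
          then have "real k \<le> real m" by simp
          with k have "t \<le> real m" "\<bar>rep_L0 z t\<bar> \<le> real m" by auto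
          then show ?case using t \<open>\<forall>m. rep_L0 (trunc m z - z) t = _ m\<close> by (simp add: clamp_to_def)
        qed
        then show "(\<lambda>m. rep_L0 (trunc m z - z) t) \<longlonglongrightarrow> 0" by (rule tendsto_eventually)
      qed
    qed
  qed (rule fin)
qed

text \<open>The indices make the L^1 distances summable. They satisfy \<open>k \<le> r k\<close> and
  may repeat; \<open>filterlim\<close> is all that is used of them later.\<close>

lemma pnorm_subsequence_converges:
  assumes y: "\<And>n::nat. y n \<in> V" and z: "z \<in> V" and lim: "(\<lambda>n. pnorm (y n - z)) \<longlonglongrightarrow> 0"
  obtains r :: "nat \<Rightarrow> nat" where "filterlim r at_top sequentially"
    "AE t in lebesgue. t \<in> I \<longrightarrow> (\<lambda>k. rep_L0 (y (r k)) t) \<longlonglongrightarrow> rep_L0 z t"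
proof -
  have "\<exists>n\<ge>k. pnorm (y n - z) \<le> (1/2) ^ k" for k :: nat
  proof -
    have "\<forall>\<^sub>F n in sequentially. pnorm (y n - z) < (1/2) ^ k" by (rule order_tendstoD[OF lim]) simp
    then have "\<forall>\<^sub>F n in sequentially. pnorm (y n - z) < (1/2) ^ k \<and> k \<le> n"
      using eventually_ge_at_top by (rule eventually_conj)
    from eventually_happens'[OF sequentially_bot this] show ?thesis by (auto intro: less_imp_le)
  qed
  then obtain r where r: "\<And>k::nat. k \<le> r k" "\<And>k. pnorm (y (r k) - z) \<le> (1/2) ^ k" by metis
  have flim: "filterlim r at_top sequentially"
    by (rule filterlim_at_top_mono[OF filterlim_ident]) (intro always_eventually allI r(1))
  have d: "y (r k) - z \<in> V" for k by (intro space.diff_mem y z)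
  have "(\<integral>\<^sup>+ t. (\<Sum>k. ennreal \<bar>rep_L0 (y (r k) - z) t\<bar>) \<partial>eta) = (\<Sum>k. ennreal (pnorm (y (r k) - z)))"
    by (subst nn_integral_suminf) (simp_all add: nn_integral_rep_eq_pnorm[OF d])
  also have "\<dots> \<le> (\<Sum>k. ennreal ((1/2) ^ k))"
    by (rule suminf_le[OF ennreal_leI[OF r(2)] summableI summableI])
  also have "\<dots> < \<infinity>" by (subst suminf_ennreal2) auto
  finally have "(\<integral>\<^sup>+ t. (\<Sum>k. ennreal \<bar>rep_L0 (y (r k) - z) t\<bar>) \<partial>eta) \<noteq> \<infinity>" by simp
  then have "AE t in eta. (\<Sum>k. ennreal \<bar>rep_L0 (y (r k) - z) t\<bar>) \<noteq> \<infinity>"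
    by (intro nn_integral_noteq_infinite) auto
  then have A: "AE t in lebesgue. t \<in> I \<longrightarrow> (\<Sum>k. ennreal \<bar>rep_L0 (y (r k) - z) t\<bar>) \<noteq> top"
    by (simp only: AE_eta infinity_ennreal_def)
  have B: "AE t in lebesgue. \<forall>k. rep_L0 (y (r k) - z) t = rep_L0 (y (r k)) t - rep_L0 z t"
    by (subst AE_all_countable) (auto intro: rep_L0_diff)
  have "AE t in lebesgue. t \<in> I \<longrightarrow> (\<lambda>k. rep_L0 (y (r k)) t) \<longlonglongrightarrow> rep_L0 z t"
    using A B
  proof eventually_elim
    case (elim t)
    show ?case
    proof
      assume "t \<in> I"
      then have "(\<Sum>k. ennreal \<bar>rep_L0 (y (r k) - z) t\<bar>) \<noteq> top"
        by (rule elim(1)[rule_format])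
      moreover have "(\<lambda>k. ennreal \<bar>rep_L0 (y (r k) - z) t\<bar>) = (\<lambda>k. ennreal \<bar>rep_L0 (y (r k)) t - rep_L0 z t\<bar>)"
        by (rule ext, subst elim(2)[rule_format], rule refl)
      ultimately have "(\<Sum>k. ennreal \<bar>rep_L0 (y (r k)) t - rep_L0 z t\<bar>) \<noteq> top" by argo
      then have "summable (\<lambda>k. \<bar>rep_L0 (y (r k)) t - rep_L0 z t\<bar>)"
        by (rule summable_suminf_not_top[OF abs_ge_zero])
      then have "(\<lambda>k. \<bar>rep_L0 (y (r k)) t - rep_L0 z t\<bar>) \<longlonglongrightarrow> 0" by (rule summable_LIMSEQ_zero)
      then show "(\<lambda>k. rep_L0 (y (r k)) t) \<longlonglongrightarrow> rep_L0 z t"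
        by (simp add: tendsto_rabs_zero_iff LIM_zero_cancel)
    qed
  qed
  with flim show ?thesis by (rule that)
qed

end

context bv_vector_measure
begin

text \<open>The hypothesis on refinement says that \<open>E\<close> is a union of atoms, and over an
  atom the average integrates to the value of \<open>G\<close>.\<close>

lemma simple_vector_integral_step:
  assumes q: "simple_function M q" and E: "E \<in> sets M" and r: "refines q (\<lambda>\<omega>. if \<omega> \<in> E then 1 else 0)"
  shows "simple_vector_integral M E (step q) = G E"
proof -
  obtain h where h: "\<And>\<omega>. \<omega> \<in> space M \<Longrightarrow> (if \<omega> \<in> E then 1 else 0 :: nat) = h (q \<omega>)"
    using r by (auto simp: refines_def)
  have e: "simple_function M (\<lambda>\<omega>. if \<omega> \<in> E then 1 else 0 :: nat)"
    using E by (intro simple_function_If_set) auto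
  have fin: "finite (q ` space M)" using q by (rule simple_functionD)
  have EM: "E \<subseteq> space M" by (rule sets.sets_into_space[OF E])
  have "simple_vector_integral M E (step q) = (\<Sum>i\<in>q ` space M. measure M (q -` {i} \<inter> E) *\<^sub>R average q i)"
    unfolding step_def[abs_def] by (rule simple_vector_integral_compose[OF q E])
  also have "\<dots> = (\<Sum>i\<in>q ` space M. if h i = 1 then G (atom q i) else 0)"
  proof (intro sum.cong refl)
    fix i
    have "q -` {i} \<inter> E = (if h i = 1 then atom q i else {})"
    proof -
      have "h (q \<omega>) = 1 \<longleftrightarrow> \<omega> \<in> E" if "\<omega> \<in> space M" for \<omega>
        using h[OF that] by (auto split: if_splits)
      then show ?thesis using EM by (auto simp: atom_def)
    qed
    then show "measure M (q -` {i} \<inter> E) *\<^sub>R average q i = (if h i = 1 then G (atom q i) else 0)"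
      by (simp add: measure_average[OF q])
  qed
  also have "\<dots> = (\<Sum>i\<in>{i \<in> q ` space M. h i = 1}. G (atom q i))"
    using fin by (subst sum.inter_filter) auto
  also have "\<dots> = G (atom (\<lambda>\<omega>. if \<omega> \<in> E then 1 else 0) 1)"
    by (rule G_atom_refine(1)[OF e q h, symmetric])
  also have "atom (\<lambda>\<omega>. if \<omega> \<in> E then 1 else 0) 1 = E"
    using EM by (auto simp: atom_def)
  finally show ?thesis .
qed

lemma nn_integral_step_dist:
  assumes "simple_function M q" "simple_function M q'"
  shows "(\<integral>\<^sup>+ \<omega>. ennreal (pnorm (step q' \<omega> - step q \<omega>)) \<partial>M) = ennreal (step_dist q' q)"
  unfolding step_dist_def by (intro nn_integral_eq_integral step_dist_integrable assms) simp

lemma strongly_measurable_pnorm: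
  assumes "strongly_measurable V N M g" shows "strongly_measurable V pnorm M g"
proof -
  from assms obtain s where g: "g ` space M \<subseteq> V" and s: "\<And>n::nat. simple_into V M (s n)"
    and lim: "AE \<omega> in M. (\<lambda>n. N (s n \<omega> - g \<omega>)) \<longlonglongrightarrow> 0"
    unfolding strongly_measurable_def by blast
  obtain C where C: "0 < C" "\<forall>x\<in>V. pnorm x \<le> C * N x" using pnorm_le_norm by blast
  have "AE \<omega> in M. (\<lambda>n. pnorm (s n \<omega> - g \<omega>)) \<longlonglongrightarrow> 0"
    using lim AE_space
  proof eventually_elim
    case (elim \<omega>)
    have mem: "s n \<omega> - g \<omega> \<in> V" for n
      using elim(2) g space.simple_into_mem[OF s[of n] elim(2)] by (intro space.diff_mem) auto
    have "(\<lambda>n. C * N (s n \<omega> - g \<omega>)) \<longlonglongrightarrow> C * 0" by (intro tendsto_mult tendsto_const elim(1))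
    then have lim0: "(\<lambda>n. C * N (s n \<omega> - g \<omega>)) \<longlonglongrightarrow> 0" by simp
    show ?case
    proof (rule tendsto_sandwich[OF _ _ tendsto_const lim0])
      show "\<forall>\<^sub>F n in sequentially. pnorm (s n \<omega> - g \<omega>) \<le> C * N (s n \<omega> - g \<omega>)"
        using C(2) mem by (intro always_eventually allI) blast
    qed simp
  qed
  then show ?thesis using g s unfolding strongly_measurable_def by blast
qed

text \<open>The averages converge in the weak norm \<open>pnorm\<close>, so the integral of the
  limit over \<open>E\<close> is first identified with \<open>G E\<close> in that norm. An almost
  everywhere convergent subsequence and the Fatou property then transfer this to the Luxemburg
  norm.\<close>

lemma has_density:
  assumes fin: "\<And>x l. x \<in> V \<Longrightarrow> rho (l *\<^sub>R x) < \<infinity>"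
  shows "\<exists>g. bochner_integrable V N M g \<and> (\<forall>E\<in>sets M. has_bochner_integral_on V N M g E (G E))"
proof -
  have M: "finite_measure M" by unfold_locales
  obtain C where C: "0 < C" "\<forall>x\<in>V. pnorm x \<le> C * N x" using pnorm_le_norm by blast
  obtain q where q: "\<And>n::nat. simple_function M (q n)" and q_ref: "\<And>n. refines (q (Suc n)) (q n)"
    and q_dist: "\<And>n q'. simple_function M q' \<Longrightarrow> refines q' (q n) \<Longrightarrow> step_dist q' (q n) \<le> (1/2) ^ n"
    by (rule cauchy_chain) blast
  have q_ref': "refines (q (n + k)) (q n)" for n k
    by (induction k) (auto intro: refines_refl refines_trans q_ref)
  define g where "g n = step (q n)" for n
  have g_mem: "g n \<omega> \<in> V" for n \<omega> using q by (simp add: g_def)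
  have g_simple: "simple_into V M (g n)" for n unfolding g_def by (rule step_simple[OF q])
  have N_meas [measurable]: "(\<lambda>\<omega>. N (g n \<omega>)) \<in> borel_measurable M" for n
    by (rule space.simple_into_norm_measurable[OF g_simple])
  have p_meas [measurable]: "(\<lambda>\<omega>. pnorm (g m \<omega> - g n \<omega>)) \<in> borel_measurable M" for m n
    by (rule p.simple_into_norm_measurable[OF p.simple_into_diff[OF g_simple g_simple]])
  \<comment> \<open>For a fixed good \<open>\<omega>\<close> the averages are a single sequence in
    \<open>V\<close> converging almost everywhere in \<open>t\<close>. Limits are chosen for each
    \<open>\<omega>\<close> separately, and their measurability is obtained afterwards from
    truncations.\<close>
  define good where "good \<omega> \<longleftrightarrow> summable (\<lambda>n. pnorm (g (Suc n) \<omega> - g n \<omega>)) \<and>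
    liminf (\<lambda>n. ennreal (N (g n \<omega>))) < \<infinity>" for \<omega>
  have AE1: "AE \<omega> in M. (\<Sum>n. ennreal (pnorm (g (Suc n) \<omega> - g n \<omega>))) \<noteq> \<infinity>"
  proof -
    have "(\<integral>\<^sup>+ \<omega>. (\<Sum>n. ennreal (pnorm (g (Suc n) \<omega> - g n \<omega>))) \<partial>M)
        = (\<Sum>n. \<integral>\<^sup>+ \<omega>. ennreal (pnorm (g (Suc n) \<omega> - g n \<omega>)) \<partial>M)"
      by (rule nn_integral_suminf) measurable
    also have "\<dots> = (\<Sum>n. ennreal (step_dist (q (Suc n)) (q n)))"
      unfolding g_def by (subst nn_integral_step_dist[OF q q]) simp
    also have "\<dots> \<le> (\<Sum>n. ennreal ((1/2) ^ n))"
      by (rule suminf_le[OF ennreal_leI[OF q_dist[OF q q_ref]] summableI summableI])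
    also have "\<dots> < \<infinity>" by (subst suminf_ennreal2) auto
    finally have "(\<integral>\<^sup>+ \<omega>. (\<Sum>n. ennreal (pnorm (g (Suc n) \<omega> - g n \<omega>))) \<partial>M) \<noteq> \<infinity>" by simp
    then show ?thesis by (rule nn_integral_noteq_infinite[rotated]) measurable
  qed
  have liminf_int: "(\<integral>\<^sup>+ \<omega>. liminf (\<lambda>n. ennreal (N (g n \<omega>))) \<partial>M) \<le> ennreal variation"
  proof -
    have "(\<integral>\<^sup>+ \<omega>. liminf (\<lambda>n. ennreal (N (g n \<omega>))) \<partial>M) \<le> liminf (\<lambda>n. \<integral>\<^sup>+ \<omega>. ennreal (N (g n \<omega>)) \<partial>M)"
      by (rule nn_integral_liminf) measurable
    also have "\<dots> \<le> liminf (\<lambda>n::nat. ennreal variation)"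
    proof (intro Liminf_mono always_eventually allI)
      fix n
      have "(\<integral>\<^sup>+ \<omega>. ennreal (N (g n \<omega>)) \<partial>M) = ennreal (\<integral>\<omega>. N (g n \<omega>) \<partial>M)"
        unfolding g_def using N_nonneg[OF step_mem[OF q]] integral_norm_step_le(1)[OF q]
        by (intro nn_integral_eq_integral) auto
      also have "\<dots> \<le> ennreal variation"
        unfolding g_def by (rule ennreal_leI[OF integral_norm_step_le(2)[OF q]])
      finally show "(\<integral>\<^sup>+ \<omega>. ennreal (N (g n \<omega>)) \<partial>M) \<le> ennreal variation" .
    qed
    finally show ?thesis by (simp add: Liminf_const)
  qed
  have AE2: "AE \<omega> in M. liminf (\<lambda>n. ennreal (N (g n \<omega>))) \<noteq> \<infinity>"
  proof (rule nn_integral_noteq_infinite)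
    show "(\<integral>\<^sup>+ \<omega>. liminf (\<lambda>n. ennreal (N (g n \<omega>))) \<partial>M) \<noteq> \<infinity>"
      using le_less_trans[OF liminf_int ennreal_less_top] by simp
  qed measurable
  have AE_good: "AE \<omega> in M. good \<omega>"
    using AE1 AE2
  proof eventually_elim
    case (elim \<omega>)
    have "summable (\<lambda>n. pnorm (g (Suc n) \<omega> - g n \<omega>))"
      using elim(1) unfolding infinity_ennreal_def by (rule summable_suminf_not_top[OF pnorm_nonneg])
    moreover have "liminf (\<lambda>n. ennreal (N (g n \<omega>))) < \<infinity>"
      using elim(2) unfolding infinity_ennreal_def by (simp only: less_top)
    ultimately show ?case unfolding good_def by (rule conjI)
  qed
  \<comment> \<open>Off the good points, which fill almost all of \<open>M\<close>, any element of
    \<open>V\<close> is accepted.\<close>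
  define is_limit where "is_limit \<omega> z \<longleftrightarrow> z \<in> V \<and> (good \<omega> \<longrightarrow> (AE t in lebesgue. t \<in> I \<longrightarrow> (\<lambda>n. rep_L0 (g n \<omega>) t) \<longlonglongrightarrow> rep_L0 z t)
      \<and> ennreal (N z) \<le> liminf (\<lambda>n. ennreal (N (g n \<omega>))))" for \<omega> z
  have "\<forall>\<omega>. \<exists>z. is_limit \<omega> z"
  proof
    fix \<omega>
    have "\<exists>z\<in>V. good \<omega> \<longrightarrow> (AE t in lebesgue. t \<in> I \<longrightarrow> (\<lambda>n. rep_L0 (g n \<omega>) t) \<longlonglongrightarrow> rep_L0 z t)
      \<and> ennreal (N z) \<le> liminf (\<lambda>n. ennreal (N (g n \<omega>)))"
    proof (cases "good \<omega>")
      case True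
      then have sum: "summable (\<lambda>n. pnorm (g (Suc n) \<omega> - g n \<omega>))"
        and lf: "liminf (\<lambda>n. ennreal (N (g n \<omega>))) < \<infinity>" unfolding good_def by blast+
      obtain z where z: "z \<in> L0_on \<gamma>" "AE t in lebesgue. t \<in> I \<longrightarrow> (\<lambda>n. rep_L0 (g n \<omega>) t) \<longlonglongrightarrow> rep_L0 z t"
        using fast_cauchy_converges[OF g_mem sum] by blast
      show ?thesis using N_liminf[OF g_mem z lf] z(2) by blast
    next
      case False
      then show ?thesis using V_zero by blast
    qed
    then show "\<exists>z. is_limit \<omega> z" unfolding is_limit_def by blast
  qed
  from choice[OF this] obtain f where f: "\<And>\<omega>. is_limit \<omega> (f \<omega>)" by blast
  have f_mem: "f \<omega> \<in> V" for \<omega> using f[of \<omega>] by (simp add: is_limit_def)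
  have f_lim: "AE t in lebesgue. t \<in> I \<longrightarrow> (\<lambda>n. rep_L0 (g n \<omega>) t) \<longlonglongrightarrow> rep_L0 (f \<omega>) t" if "good \<omega>" for \<omega>
    using f[of \<omega>] that by (simp add: is_limit_def)
  have f_le: "ennreal (N (f \<omega>)) \<le> liminf (\<lambda>n. ennreal (N (g n \<omega>)))" if "good \<omega>" for \<omega>
    using f[of \<omega>] that by (simp add: is_limit_def)
  have strong_trunc: "strongly_measurable V N M (\<lambda>\<omega>. trunc m (f \<omega>))" for m
    unfolding strongly_measurable_def
  proof (intro conjI exI[of _ "\<lambda>n \<omega>. trunc m (g n \<omega>)"] allI)
    show "simple_into V M (\<lambda>\<omega>. trunc m (g n \<omega>))" for n
    proof -
      have "simple_function M (\<lambda>\<omega>. trunc m (g n \<omega>))"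
        by (rule simple_function_compose1[where g = "trunc m"]) (use g_simple[of n] in \<open>simp add: simple_into_def\<close>)
      then show ?thesis using trunc_mem by (simp add: simple_into_def image_subset_iff)
    qed
    show "AE \<omega> in M. (\<lambda>n. N (trunc m (g n \<omega>) - trunc m (f \<omega>))) \<longlonglongrightarrow> 0"
      using AE_good by eventually_elim (rule trunc_continuous[OF f_lim])
  qed (simp add: image_subset_iff trunc_mem)
  have strong: "strongly_measurable V N M f"
  proof (rule space.strongly_measurable_limit[OF M strong_trunc])
    show "f ` space M \<subseteq> V" using f_mem by blast
    show "AE \<omega> in M. (\<lambda>m. N (trunc m (f \<omega>) - f \<omega>)) \<longlonglongrightarrow> 0"
      by (rule AE_I2) (rule trunc_tendsto[OF fin[OF f_mem] f_mem])
  qed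
  have "(\<integral>\<^sup>+ \<omega>. ennreal (N (f \<omega>)) \<partial>M) \<le> (\<integral>\<^sup>+ \<omega>. liminf (\<lambda>n. ennreal (N (g n \<omega>))) \<partial>M)"
  proof (rule nn_integral_mono_AE)
    show "AE \<omega> in M. ennreal (N (f \<omega>)) \<le> liminf (\<lambda>n. ennreal (N (g n \<omega>)))"
      using AE_good by eventually_elim (rule f_le)
  qed
  also note liminf_int
  also have "ennreal variation < \<infinity>" by simp
  finally have "(\<integral>\<^sup>+ \<omega>. ennreal (N (f \<omega>)) \<partial>M) < \<infinity>" .
  from space.strongly_measurable_bochner_approximation[OF M strong this]
  obtain s where s: "bochner_approximation V N M f s" by blast
  have s_simple: "simple_into V M (s n)" for n using s by (simp add: bochner_approximation_def)
  define a where "a n = (\<integral>\<^sup>+ \<omega>. ennreal (N (s n \<omega> - f \<omega>)) \<partial>M)" for n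
  have a_lim: "a \<longlonglongrightarrow> 0" using s by (simp add: bochner_approximation_def a_def[abs_def])
  have strong_p: "strongly_measurable V pnorm M f" by (rule strongly_measurable_pnorm[OF strong])

  \<comment> \<open>Fatou's lemma along the chain: all later averages are within
    \<open>(1/2) ^ k\<close> of \<open>g k\<close>.\<close>
  have g_close: "(\<integral>\<^sup>+ \<omega>. ennreal (pnorm (g k \<omega> - f \<omega>)) \<partial>M) \<le> ennreal ((1/2) ^ k)" for k
  proof -
    have "(\<integral>\<^sup>+ \<omega>. ennreal (pnorm (g k \<omega> - f \<omega>)) \<partial>M)
      \<le> (\<integral>\<^sup>+ \<omega>. liminf (\<lambda>m. ennreal (pnorm (g (k + m) \<omega> - g k \<omega>))) \<partial>M)"
    proof (rule nn_integral_mono_AE)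
      show "AE \<omega> in M. ennreal (pnorm (g k \<omega> - f \<omega>)) \<le> liminf (\<lambda>m. ennreal (pnorm (g (k + m) \<omega> - g k \<omega>)))"
        using AE_good
      proof eventually_elim
        case (elim \<omega>)
        have "ennreal (pnorm (f \<omega> - g k \<omega>)) \<le> liminf (\<lambda>m. ennreal (pnorm (g (k + m) \<omega> - g k \<omega>)))"
        proof (rule pnorm_Fatou)
          have "AE t in lebesgue. \<forall>m. rep_L0 (g (k + m) \<omega> - g k \<omega>) t = rep_L0 (g (k + m) \<omega>) t - rep_L0 (g k \<omega>) t"
            by (subst AE_all_countable) (auto intro: rep_L0_diff)
          then show "AE t in lebesgue. t \<in> I \<longrightarrow> (\<lambda>m. rep_L0 (g (k + m) \<omega> - g k \<omega>) t) \<longlonglongrightarrow> rep_L0 (f \<omega> - g k \<omega>) t"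
            using f_lim[OF elim] rep_L0_diff[of "f \<omega>" "g k \<omega>"]
          proof eventually_elim
            case (elim t)
            show ?case
            proof
              assume "t \<in> I"
              then have "(\<lambda>n. rep_L0 (g n \<omega>) t) \<longlonglongrightarrow> rep_L0 (f \<omega>) t" using elim(2) by blast
              from LIMSEQ_ignore_initial_segment[OF this, of k]
              have "(\<lambda>m. rep_L0 (g (k + m) \<omega>) t - rep_L0 (g k \<omega>) t) \<longlonglongrightarrow> rep_L0 (f \<omega>) t - rep_L0 (g k \<omega>) t"
                by (intro tendsto_diff tendsto_const) (simp add: add.commute)
              then show "(\<lambda>m. rep_L0 (g (k + m) \<omega> - g k \<omega>) t) \<longlonglongrightarrow> rep_L0 (f \<omega> - g k \<omega>) t"
                using elim(1,3) by simp
            qed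
          qed
        qed (intro space.diff_mem g_mem f_mem)+
        then show ?case using p.norm_diff_commute[OF f_mem g_mem, of \<omega> k \<omega>] by simp
      qed
    qed
    also have "\<dots> \<le> liminf (\<lambda>m. \<integral>\<^sup>+ \<omega>. ennreal (pnorm (g (k + m) \<omega> - g k \<omega>)) \<partial>M)"
      by (rule nn_integral_liminf) measurable
    also have "\<dots> \<le> liminf (\<lambda>m::nat. ennreal ((1/2) ^ k))"
    proof (intro Liminf_mono always_eventually allI)
      fix m
      show "(\<integral>\<^sup>+ \<omega>. ennreal (pnorm (g (k + m) \<omega> - g k \<omega>)) \<partial>M) \<le> ennreal ((1/2) ^ k)"
        unfolding g_def nn_integral_step_dist[OF q q] by (rule ennreal_leI[OF q_dist[OF q q_ref']])
    qed
    finally show ?thesis by (simp add: Liminf_const)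
  qed

  have s_close: "(\<integral>\<^sup>+ \<omega>. ennreal (pnorm (s n \<omega> - f \<omega>)) * indicator E \<omega> \<partial>M) \<le> ennreal C * a n" for n E
  proof -
    from strong obtain u where u: "\<And>n::nat. simple_into V M (u n)"
      "AE \<omega> in M. (\<lambda>n. N (u n \<omega> - f \<omega>)) \<longlonglongrightarrow> 0"
      unfolding strongly_measurable_def by blast
    obtain b :: "'b \<Rightarrow> real" where b [measurable]: "b \<in> borel_measurable M" "AE \<omega> in M. b \<omega> = N (s n \<omega> - f \<omega>)"
      by (rule space.norm_diff_measurable_version[OF u(1) _ u(2) s_simple[of n]]) (use f_mem in blast)+
    have "(\<integral>\<^sup>+ \<omega>. ennreal (pnorm (s n \<omega> - f \<omega>)) * indicator E \<omega> \<partial>M) \<le> (\<integral>\<^sup>+ \<omega>. ennreal C * ennreal (b \<omega>) \<partial>M)"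
    proof (rule nn_integral_mono_AE)
      show "AE \<omega> in M. ennreal (pnorm (s n \<omega> - f \<omega>)) * indicator E \<omega> \<le> ennreal C * ennreal (b \<omega>)"
        using b(2) AE_space
      proof eventually_elim
        case (elim \<omega>)
        have mem: "s n \<omega> - f \<omega> \<in> V"
          using space.simple_into_mem[OF s_simple elim(2)] f_mem by (rule space.diff_mem)
        have "ennreal (pnorm (s n \<omega> - f \<omega>)) \<le> ennreal (C * b \<omega>)"
          using C(2) mem elim(1) by (intro ennreal_leI) simp
        also have "\<dots> = ennreal C * ennreal (b \<omega>)"
          using C(1) N_nonneg[OF mem] elim(1) by (simp add: ennreal_mult)
        finally show ?case by (auto simp: indicator_def)
      qed
    qed
    also have "\<dots> = ennreal C * (\<integral>\<^sup>+ \<omega>. ennreal (b \<omega>) \<partial>M)" by (rule nn_integral_cmult) measurable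
    also have "(\<integral>\<^sup>+ \<omega>. ennreal (b \<omega>) \<partial>M) = a n"
      unfolding a_def
    proof (rule nn_integral_cong_AE)
      show "AE \<omega> in M. ennreal (b \<omega>) = ennreal (N (s n \<omega> - f \<omega>))"
        using b(2) by eventually_elim simp
    qed
    finally show ?thesis .
  qed

  have "has_bochner_integral_on V N M f E (G E)" if E: "E \<in> sets M" for E
  proof -
    define y where "y n = simple_vector_integral M E (s n)" for n
    have y_mem: "y n \<in> V" for n unfolding y_def by (rule space.simple_vector_integral_mem[OF s_simple])
    have GE: "G E \<in> V" by (rule G_mem[OF E])
    \<comment> \<open>\<open>E\<close> need not be a union of atoms of the chain. Joining
      \<open>q k\<close> with \<open>E\<close> gives a refinement whose averages integrate over
      \<open>E\<close> exactly to \<open>G E\<close>, and which is still within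
      \<open>(1/2) ^ k\<close> of \<open>g k\<close>.\<close>
    have g_int: "pnorm (simple_vector_integral M E (g k) - G E) \<le> (1/2) ^ k" for k
    proof -
      define e where "e = (\<lambda>\<omega>. if \<omega> \<in> E then 1 else 0 :: nat)"
      have e: "simple_function M e" unfolding e_def using E by (intro simple_function_If_set) auto
      define r where "r = join (q k) e"
      have r: "simple_function M r" unfolding r_def by (rule join_simple[OF q e])
      have rE: "simple_vector_integral M E (step r) = G E"
        by (rule simple_vector_integral_step[OF r E]) (use join_refines(2)[of "q k" e] in \<open>simp add: r_def e_def\<close>)
      have sf: "simple_function M (step r)" "simple_function M (g k)"
        using step_simple[OF r] g_simple[of k] by (simp_all add: simple_into_def)
      have "ennreal (pnorm (G E - simple_vector_integral M E (g k)))
        = ennreal (pnorm (simple_vector_integral M E (\<lambda>\<omega>. step r \<omega> - g k \<omega>)))"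
        unfolding rE[symmetric] simple_vector_integral_diff[OF sf E] ..
      also have "\<dots> \<le> (\<integral>\<^sup>+ \<omega>. ennreal (pnorm (step r \<omega> - g k \<omega>)) * indicator E \<omega> \<partial>M)"
        by (rule p.norm_simple_vector_integral_le[OF M p.simple_into_diff[OF step_simple[OF r] g_simple] E])
      also have "\<dots> \<le> (\<integral>\<^sup>+ \<omega>. ennreal (pnorm (step r \<omega> - g k \<omega>)) \<partial>M)"
        by (intro nn_integral_mono) (auto simp: indicator_def)
      also have "\<dots> = ennreal (step_dist r (q k))" unfolding g_def by (rule nn_integral_step_dist[OF q r])
      also have "\<dots> \<le> ennreal ((1/2) ^ k)"
        using q_dist[OF r, of k] join_refines(1)[of "q k" e] by (intro ennreal_leI) (simp add: r_def)
      finally have "pnorm (G E - simple_vector_integral M E (g k)) \<le> (1/2) ^ k"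
        by (simp add: ennreal_le_iff)
      then show ?thesis
        using p.norm_diff_commute[OF GE space.simple_vector_integral_mem[OF g_simple[of k], of E]] by simp
    qed
    \<comment> \<open>\<open>g k\<close> serves as intermediary between \<open>y n\<close> and
      \<open>G E\<close>; both errors it causes vanish as \<open>k\<close> grows.\<close>
    have y_close: "ennreal (pnorm (y n - G E)) \<le> ennreal C * a n" for n
    proof (rule LIMSEQ_le_const)
      have "(\<lambda>k. ennreal ((1/2) ^ k + (1/2) ^ k)) \<longlonglongrightarrow> ennreal (0 + 0)"
        by (intro tendsto_ennrealI tendsto_add LIMSEQ_power_zero) simp_all
      then have "(\<lambda>k. ennreal C * a n + ennreal ((1/2) ^ k + (1/2) ^ k)) \<longlonglongrightarrow> ennreal C * a n + ennreal (0 + 0)"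
        by (intro tendsto_add tendsto_const)
      then show "(\<lambda>k. ennreal C * a n + ennreal ((1/2) ^ k + (1/2) ^ k)) \<longlonglongrightarrow> ennreal C * a n" by simp
      have "ennreal (pnorm (y n - G E)) \<le> ennreal C * a n + ennreal ((1/2) ^ k + (1/2) ^ k)" for k
      proof -
        have gk: "simple_vector_integral M E (g k) \<in> V" by (rule space.simple_vector_integral_mem[OF g_simple])
        have "ennreal (pnorm (y n - G E))
          \<le> ennreal (pnorm (y n - simple_vector_integral M E (g k)) + pnorm (simple_vector_integral M E (g k) - G E))"
          by (rule ennreal_leI[OF p.norm_diff_triangle[OF y_mem gk GE]])
        also have "\<dots> = ennreal (pnorm (y n - simple_vector_integral M E (g k))) + ennreal (pnorm (simple_vector_integral M E (g k) - G E))"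
          by (rule ennreal_plus) simp_all
        also have "\<dots> \<le> (ennreal C * a n + ennreal ((1/2) ^ k)) + ennreal ((1/2) ^ k)"
        proof (rule add_mono)
          have "ennreal (pnorm (y n - simple_vector_integral M E (g k))) \<le>
            (\<integral>\<^sup>+ \<omega>. ennreal (pnorm (s n \<omega> - f \<omega>)) * indicator E \<omega> \<partial>M) + (\<integral>\<^sup>+ \<omega>. ennreal (pnorm (g k \<omega> - f \<omega>)) \<partial>M)"
            unfolding y_def by (rule p.norm_integral_diff_le[OF M strong_p s_simple g_simple E])
          also have "\<dots> \<le> ennreal C * a n + ennreal ((1/2) ^ k)"
            by (rule add_mono[OF s_close g_close])
          finally show "ennreal (pnorm (y n - simple_vector_integral M E (g k))) \<le> ennreal C * a n + ennreal ((1/2) ^ k)" .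
          show "ennreal (pnorm (simple_vector_integral M E (g k) - G E)) \<le> ennreal ((1/2) ^ k)"
            by (rule ennreal_leI[OF g_int])
        qed
        also have "\<dots> = ennreal C * a n + ennreal ((1/2) ^ k + (1/2) ^ k)"
          by (subst ennreal_plus) (simp_all add: add.assoc)
        finally show ?thesis .
      qed
      then show "\<exists>N. \<forall>k\<ge>N. ennreal (pnorm (y n - G E)) \<le> ennreal C * a n + ennreal ((1/2) ^ k + (1/2) ^ k)"
        by blast
    qed
    have y_lim: "(\<lambda>n. pnorm (y n - G E)) \<longlonglongrightarrow> 0"
    proof -
      have "(\<lambda>n. ennreal C * a n) \<longlonglongrightarrow> ennreal C * 0"
        by (rule ennreal_tendsto_cmult[OF _ a_lim]) simp
      then have up: "(\<lambda>n. ennreal C * a n) \<longlonglongrightarrow> 0" by simp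
      have "(\<lambda>n. ennreal (pnorm (y n - G E))) \<longlonglongrightarrow> ennreal 0"
        using tendsto_sandwich[OF _ _ tendsto_const up, of "\<lambda>n. ennreal (pnorm (y n - G E))"] y_close
        by simp
      then show ?thesis by (subst (asm) tendsto_ennreal_iff) simp_all
    qed
    obtain r where r: "filterlim r at_top sequentially"
      "AE t in lebesgue. t \<in> I \<longrightarrow> (\<lambda>k. rep_L0 (y (r k)) t) \<longlonglongrightarrow> rep_L0 (G E) t"
      by (rule pnorm_subsequence_converges[OF y_mem GE y_lim])
    have ar: "(\<lambda>k. a (r k)) \<longlonglongrightarrow> 0" by (rule filterlim_compose[OF a_lim r(1)])
    \<comment> \<open>The bound \<open>a n + a (r k)\<close> on the norm of
      \<open>y n - y (r k)\<close> survives the lower limit over \<open>k\<close>, where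
      \<open>y (r k)\<close> becomes \<open>G E\<close> almost everywhere.\<close>
    have N_close: "ennreal (N (y n - G E)) \<le> a n" if an: "a n < \<infinity>" for n
    proof -
      have d: "y n - y (r k) \<in> V" for k by (intro space.diff_mem y_mem)
      have "AE t in lebesgue. \<forall>k. rep_L0 (y n - y (r k)) t = rep_L0 (y n) t - rep_L0 (y (r k)) t"
        by (subst AE_all_countable) (auto intro: rep_L0_diff)
      then have conv: "AE t in lebesgue. t \<in> I \<longrightarrow> (\<lambda>k. rep_L0 (y n - y (r k)) t) \<longlonglongrightarrow> rep_L0 (y n - G E) t"
        using r(2) rep_L0_diff[of "y n" "G E"]
        by eventually_elim (auto intro!: tendsto_intros)
      have "liminf (\<lambda>k. ennreal (N (y n - y (r k)))) \<le> liminf (\<lambda>k. a n + a (r k))"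
      proof (intro Liminf_mono always_eventually allI)
        fix k
        have "ennreal (N (y n - y (r k))) \<le> (\<integral>\<^sup>+ \<omega>. ennreal (N (s n \<omega> - f \<omega>)) * indicator E \<omega> \<partial>M) + a (r k)"
          unfolding y_def a_def by (rule space.norm_integral_diff_le[OF M strong s_simple s_simple E])
        also have "\<dots> \<le> a n + a (r k)"
          unfolding a_def by (intro add_right_mono nn_integral_mono) (auto simp: indicator_def)
        finally show "ennreal (N (y n - y (r k))) \<le> a n + a (r k)" .
      qed
      also have "liminf (\<lambda>k. a n + a (r k)) = a n + 0"
        by (rule lim_imp_Liminf[OF _ tendsto_add[OF tendsto_const ar]]) simp
      finally have le: "liminf (\<lambda>k. ennreal (N (y n - y (r k)))) \<le> a n" by simp
      have "ennreal (N (y n - G E)) \<le> liminf (\<lambda>k. ennreal (N (y n - y (r k))))"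
        by (rule N_liminf(2)[OF d V_L0_on[OF space.diff_mem[OF y_mem GE]] conv le_less_trans[OF le an]])
      then show ?thesis using le by (rule order_trans)
    qed
    have "(\<lambda>n. ennreal (N (y n - G E))) \<longlonglongrightarrow> ennreal 0"
    proof -
      have "\<forall>\<^sub>F n in sequentially. a n < \<infinity>" by (rule order_tendstoD(2)[OF a_lim]) simp
      then have "\<forall>\<^sub>F n in sequentially. ennreal (N (y n - G E)) \<le> a n"
        by (rule eventually_mono) (rule N_close)
      from tendsto_sandwich[OF _ this tendsto_const a_lim] show ?thesis by simp
    qed
    then have "(\<lambda>n. N (y n - G E)) \<longlonglongrightarrow> 0"
      by (subst (asm) tendsto_ennreal_iff) (simp_all add: N_nonneg space.diff_mem[OF y_mem GE])
    then show ?thesis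
      using strong GE s unfolding has_bochner_integral_on_def y_def by blast
  qed
  moreover have "bochner_integrable V N M f"
    using strong s unfolding bochner_integrable_def by blast
  ultimately show ?thesis by blast
qed

end

section \<open>A sequence space in the absence of the doubling condition\<close>

context lorentz_weight
begin

section \<open>Countable subadditivity and doubling of the primitive\<close>

lemma choquet_suminf_le:
  assumes [measurable]: "\<And>n::nat. y n \<in> borel_measurable lebesgue"
  shows "choquet (\<lambda>t. \<Sum>n. y n t) \<le> (\<Sum>n. choquet (y n))"
proof -
  have fin: "choquet (\<lambda>t. \<Sum>i<n. y i t) \<le> (\<Sum>i<n. choquet (y i))" for n
  proof (induction n)
    case 0
    have "choquet (\<lambda>t. 0 * indicator {} t) = 0" by (subst choquet_indicator) auto
    then show ?case by simp
  next
    case (Suc n)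
    have "choquet (\<lambda>t. \<Sum>i<Suc n. y i t) \<le> choquet (\<lambda>t. \<Sum>i<n. y i t) + choquet (y n)"
      unfolding sum.lessThan_Suc by (rule choquet_add_le) measurable
    also have "\<dots> \<le> (\<Sum>i<n. choquet (y i)) + choquet (y n)" by (rule add_right_mono[OF Suc])
    finally show ?case by simp
  qed
  have "choquet (\<lambda>t. \<Sum>n. y n t) = choquet (\<lambda>t. SUP n. \<Sum>i<n. y i t)"
    by (simp add: suminf_eq_SUP)
  also have "\<dots> = (SUP n. choquet (\<lambda>t. \<Sum>i<n. y i t))"
    by (rule choquet_SUP) (auto simp: incseq_def le_fun_def intro!: sum_mono2)
  also have "\<dots> \<le> (SUP n. \<Sum>i<n. choquet (y i))" by (intro SUP_mono') (rule fin)
  finally show ?thesis by (simp add: suminf_eq_SUP)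
qed

text \<open>Concavity, read off from \<open>min c (2 * s) \<le> 2 * min c s\<close> in the
  mixture.\<close>

lemma Wt_double:
  assumes "2 * s \<le> \<gamma>" shows "Wt (2 * s) \<le> 2 * Wt s"
proof -
  have "s \<le> 2 * s" by (simp add: mult_2)
  then have s: "s \<le> \<gamma>" using assms by (rule order_trans)
  have "Wt (2 * s) \<le> (\<integral>\<^sup>+ v. 2 * (min (sv v) s * indicator {0..} v) \<partial>lborel)"
    unfolding Wt_eq_min[OF assms]
  proof (intro nn_integral_mono)
    fix v
    have "min (sv v) (2 * s) \<le> 2 * min (sv v) s"
      by (auto simp: min_def mult_2 intro: add_increasing)
    then show "min (sv v) (2 * s) * indicator {0..} v \<le> 2 * (min (sv v) s * indicator {0..} v)"
      by (auto simp: indicator_def)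
  qed
  also have "\<dots> = 2 * Wt s"
    unfolding Wt_eq_min[OF s] by (rule nn_integral_cmult) measurable
  finally show ?thesis .
qed

lemma Wt_pos: assumes "0 < s" "s \<le> \<gamma>" shows "0 < Wt s"
proof -
  obtain C where C: "0 < C" "\<And>s. s \<le> \<gamma> \<Longrightarrow> min 1 s \<le> ennreal C * Wt s" by (rule Wt_lower) blast
  have "0 < min 1 s" using assms by simp
  also have "\<dots> \<le> ennreal C * Wt s" by (rule C(2)[OF assms(2)])
  finally show ?thesis by (cases "Wt s = 0") (auto simp: zero_less_iff_neq_zero)
qed

text \<open>The length \<open>b\<close> is halved until the primitive first drops to
  \<open>\<tau>\<close>. One step earlier it was above \<open>\<tau>\<close>, and one halving
  divides the primitive by at most 2. If no halving takes place, the hypothesis on \<open>b\<close>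
  applies.\<close>

lemma Wt_intermediate:
  fixes \<tau> b :: real
  assumes t: "0 < \<tau>" and b: "0 < b" "ennreal b \<le> \<gamma>" and le: "ennreal \<tau> \<le> Wt (ennreal b)"
  obtains s where "0 < s" "s \<le> b" "Wt (ennreal s) \<le> ennreal \<tau>" "ennreal \<tau> \<le> 2 * Wt (ennreal s)"
proof -
  have "(\<lambda>k. ennreal (b * (1/2) ^ k)) \<longlonglongrightarrow> ennreal (b * 0)"
    by (intro tendsto_ennrealI tendsto_mult tendsto_const LIMSEQ_power_zero) simp
  then have "(\<lambda>k. Wt (ennreal (b * (1/2) ^ k))) \<longlonglongrightarrow> 0"
    using b by (intro Wt_tendsto_0[of _ "ennreal b"]) (auto intro!: ennreal_leI mult_left_le power_le_one)
  then have "\<forall>\<^sub>F k in sequentially. Wt (ennreal (b * (1/2) ^ k)) < ennreal \<tau>"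
    by (rule order_tendstoD) (use t in simp)
  from eventually_happens'[OF sequentially_bot this] have ex: "\<exists>k. Wt (ennreal (b * (1/2) ^ k)) \<le> ennreal \<tau>"
    by (auto intro: less_imp_le)
  define k where "k = (LEAST k. Wt (ennreal (b * (1/2) ^ k)) \<le> ennreal \<tau>)"
  have k: "Wt (ennreal (b * (1/2) ^ k)) \<le> ennreal \<tau>" unfolding k_def using ex by (rule LeastI_ex)
  define s where "s = b * (1/2) ^ k"
  have s: "0 < s" "s \<le> b" using b by (auto simp: s_def intro!: mult_left_le power_le_one)
  have "ennreal \<tau> \<le> 2 * Wt (ennreal s)"
  proof (cases k)
    case 0
    have "Wt (ennreal s) \<le> 2 * Wt (ennreal s)" by (simp add: mult_2)
    then show ?thesis using le 0 by (simp add: s_def)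
  next
    case (Suc j)
    have "\<not> Wt (ennreal (b * (1/2) ^ j)) \<le> ennreal \<tau>"
      using not_less_Least[of j "\<lambda>k. Wt (ennreal (b * (1/2) ^ k)) \<le> ennreal \<tau>"] Suc by (simp add: k_def)
    moreover have bj: "ennreal (b * (1/2) ^ j) = 2 * ennreal s"
      using b Suc by (simp add: s_def ennreal_mult[symmetric] flip: ennreal_numeral)
    moreover have "ennreal (b * (1/2) ^ j) \<le> \<gamma>"
      by (rule order_trans[OF ennreal_leI b(2)]) (use b in \<open>auto intro!: mult_left_le power_le_one\<close>)
    ultimately show ?thesis using Wt_double[of "ennreal s"] by (simp add: not_le)
  qed
  then show ?thesis using that[OF s] k by (simp add: s_def)
qed

end

context orlicz_lorentz_space
begin

text \<open>\<open>s\<close> is chosen so that the primitive there equals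
  \<open>(1/2) ^ Suc n / \<phi> u\<close> up to a factor 2. This makes the first product small, and
  the failing inequality makes the second exceed 1. Such an \<open>s\<close> fits in: for infinite
  \<gamma> the primitive is unbounded, for finite \<gamma> the point \<open>u\<close> can be taken
  large.\<close>

lemma failing_Delta2_sequence:
  assumes "\<not> ((\<gamma> = \<infinity> \<longrightarrow> Delta2 \<phi>) \<and> (\<gamma> < \<infinity> \<longrightarrow> Delta2_infinity \<phi>))"
  shows "\<exists>u s. 0 < u \<and> 0 < s \<and> ennreal (\<phi> u) * Wt (ennreal s) \<le> ennreal ((1/2) ^ Suc n) \<and>
    1 < ennreal (\<phi> (2 * u)) * Wt (ennreal s) \<and> (\<gamma> < \<infinity> \<longrightarrow> s \<le> enn2real \<gamma> * (1/2) ^ Suc n)"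
proof -
  \<comment> \<open>The power of 2 cancels the smallness of the first product and a factor 2 is lost
    in the choice of \<open>s\<close>, so the second product exceeds 2.\<close>
  define K :: real where "K = 4 * 2 ^ Suc n"
  have K: "0 < K" by (simp add: K_def)
  have "\<exists>u b. 0 < u \<and> K * \<phi> u < \<phi> (2 * u) \<and> 0 < b \<and> ennreal b \<le> \<gamma> \<and>
    ennreal ((1/2) ^ Suc n / \<phi> u) \<le> Wt (ennreal b) \<and> (\<gamma> < \<infinity> \<longrightarrow> b \<le> enn2real \<gamma> * (1/2) ^ Suc n)"
  proof (cases "\<gamma> = \<infinity>")
    case True
    then have "\<not> Delta2 \<phi>" using assms by simp
    then obtain u where u: "0 \<le> u" "K * \<phi> u < \<phi> (2 * u)" using K unfolding Delta2_def by (meson not_le)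
    then have u0: "0 < u" by (cases "u = 0") auto
    have "Wt (SUP n. of_nat n) = (SUP n. Wt (of_nat n))" by (rule Wt_SUP) (auto simp: incseq_def)
    moreover have "Wt top = top"
      using Wt_infinite_imp[of top] True by (metis infinity_ennreal_def less_irrefl less_top order_refl)
    ultimately have sup: "(SUP n. Wt (of_nat n)) = top" by (simp add: ennreal_SUP_of_nat_eq_top)
    have "ennreal ((1/2) ^ Suc n / \<phi> u) < (SUP n. Wt (of_nat n))"
      unfolding sup by (rule ennreal_less_top)
    then obtain m :: nat where m: "ennreal ((1/2) ^ Suc n / \<phi> u) < Wt (of_nat m)" by (auto simp: less_SUP_iff)
    have "m \<noteq> 0" using m by (cases m) auto
    then show ?thesis
      using u u0 m True by (intro exI[of _ u] exI[of _ "real m"]) (auto simp: ennreal_of_nat_eq_real_of_nat less_imp_le)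
  next
    case False
    then have g: "\<gamma> < \<infinity>" by (simp add: less_top)
    obtain c where c: "\<gamma> = ennreal c" "0 < c" using g gamma_pos by (cases \<gamma>) auto
    define b where "b = c * (1/2) ^ Suc n"
    have b: "0 < b" "b \<le> c" using c unfolding b_def by (auto intro!: mult_left_le power_le_one simp del: power_Suc)
    have bg: "ennreal b \<le> \<gamma>" using b c by (simp add: ennreal_leI)
    obtain x where x: "Wt (ennreal b) = ennreal x" "0 \<le> x" using Wt_finite[of "ennreal b"] by (cases "Wt (ennreal b)") auto
    have x0: "0 < x" using Wt_pos[of "ennreal b"] b bg x by simp
    \<comment> \<open>From \<open>v\<close> onwards the required value
      \<open>(1/2) ^ Suc n / \<phi> u\<close> is at most the primitive \<open>x\<close> at
      \<open>b\<close>.\<close>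
    obtain v where v: "0 \<le> v" "\<phi> v = (1/2) ^ Suc n / x" using phi_surj[of "(1/2) ^ Suc n / x"] x0 by auto
    have v0: "0 < v" using v x0 by (cases "v = 0") auto
    have "\<not> Delta2_infinity \<phi>" using assms g False by simp
    then obtain u where u: "v \<le> u" "K * \<phi> u < \<phi> (2 * u)"
      using K v(1) unfolding Delta2_infinity_def by (meson not_le)
    have "(1/2) ^ Suc n / x \<le> \<phi> u" using phi_mono[OF v(1) u(1)] v(2) by simp
    then have "(1/2) ^ Suc n / \<phi> u \<le> x" using x0 phi_pos[of u] u v0 by (simp add: field_simps)
    then show ?thesis
      using u v0 b bg c x by (intro exI[of _ u] exI[of _ b]) (auto simp: b_def ennreal_leI)
  qed
  then obtain u b where u: "0 < u" "K * \<phi> u < \<phi> (2 * u)" and b: "0 < b" "ennreal b \<le> \<gamma>"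
    and le: "ennreal ((1/2) ^ Suc n / \<phi> u) \<le> Wt (ennreal b)" and bs: "\<gamma> < \<infinity> \<longrightarrow> b \<le> enn2real \<gamma> * (1/2) ^ Suc n"
    by blast
  have pu: "0 < \<phi> u" by (rule phi_pos[OF u(1)])
  define \<tau> where "\<tau> = (1/2) ^ Suc n / \<phi> u"
  have t: "0 < \<tau>" using pu by (simp add: \<tau>_def)
  obtain s where s: "0 < s" "s \<le> b" "Wt (ennreal s) \<le> ennreal \<tau>" "ennreal \<tau> \<le> 2 * Wt (ennreal s)"
    by (rule Wt_intermediate[OF t b]) (use le in \<open>auto simp: \<tau>_def\<close>)
  obtain x where x: "Wt (ennreal s) = ennreal x" "0 \<le> x" using Wt_finite[of "ennreal s"] by (cases "Wt (ennreal s)") auto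
  have x1: "x \<le> \<tau>" using s(3) x t by (simp add: ennreal_le_iff)
  have "ennreal \<tau> \<le> ennreal (2 * x)" using s(4) x by (simp add: ennreal_mult)
  then have x2: "\<tau> \<le> 2 * x" using x by (simp add: ennreal_le_iff)
  have "\<phi> u * x \<le> \<phi> u * \<tau>" using x1 pu by (intro mult_left_mono) auto
  also have "\<dots> = (1/2) ^ Suc n" using pu by (simp add: \<tau>_def)
  finally have 1: "\<phi> u * x \<le> (1/2) ^ Suc n" .
  have x0: "0 < x" using x2 t by simp
  have "1 < K * \<phi> u * (\<tau> / 2)"
    using pu by (simp add: K_def \<tau>_def power_divide)
  also have "\<dots> \<le> K * \<phi> u * x" using x2 K pu by (intro mult_left_mono) auto
  also have "\<dots> < \<phi> (2 * u) * x" using u(2) x0 by (intro mult_strict_right_mono) auto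
  finally have 2: "1 < \<phi> (2 * u) * x" .
  have "ennreal (\<phi> u) * Wt (ennreal s) \<le> ennreal ((1/2) ^ Suc n)"
    using 1 pu x by (simp add: ennreal_mult[symmetric] ennreal_leI del: power_Suc)
  moreover have "1 < ennreal (\<phi> (2 * u)) * Wt (ennreal s)"
    using 2 u x by (simp add: ennreal_mult[symmetric] one_less_ennreal)
  ultimately show ?thesis using u s bs by (intro exI[of _ u] exI[of _ s]) auto
qed

text \<open>The intervals are laid end to end from 0. For finite \<gamma> they stay inside
  \<open>I\<close> because their lengths are bounded by the terms of a geometric series with sum
  \<gamma>.\<close>

lemma disjoint_intervals:
  assumes "\<not> ((\<gamma> = \<infinity> \<longrightarrow> Delta2 \<phi>) \<and> (\<gamma> < \<infinity> \<longrightarrow> Delta2_infinity \<phi>))"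
  obtains u :: "nat \<Rightarrow> real" and A :: "nat \<Rightarrow> real set" where
    "\<And>n. 0 < u n" "\<And>n. A n \<in> sets lebesgue" "disjoint_family A" "\<And>n. A n \<subseteq> I"
    "\<And>n. ennreal (\<phi> (u n)) * Wt (emeasure lebesgue (A n)) \<le> ennreal ((1/2) ^ Suc n)"
    "\<And>n. 1 < ennreal (\<phi> (2 * u n)) * Wt (emeasure lebesgue (A n))"
proof -
  have "\<forall>n. \<exists>z. 0 < fst z \<and> 0 < snd z \<and> ennreal (\<phi> (fst z)) * Wt (ennreal (snd z)) \<le> ennreal ((1/2) ^ Suc n) \<and>
    1 < ennreal (\<phi> (2 * fst z)) * Wt (ennreal (snd z)) \<and> (\<gamma> < \<infinity> \<longrightarrow> snd z \<le> enn2real \<gamma> * (1/2) ^ Suc n)"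
    using failing_Delta2_sequence[OF assms] unfolding fst_conv snd_conv split_paired_Ex by blast
  from choice[OF this] obtain z where z: "\<And>n. 0 < fst (z n) \<and> 0 < snd (z n) \<and>
    ennreal (\<phi> (fst (z n))) * Wt (ennreal (snd (z n))) \<le> ennreal ((1/2) ^ Suc n) \<and>
    1 < ennreal (\<phi> (2 * fst (z n))) * Wt (ennreal (snd (z n))) \<and> (\<gamma> < \<infinity> \<longrightarrow> snd (z n) \<le> enn2real \<gamma> * (1/2) ^ Suc n)"
    by blast
  define u s where "u n = fst (z n)" and "s n = snd (z n)" for n
  have us: "0 < u n" "0 < s n" "ennreal (\<phi> (u n)) * Wt (ennreal (s n)) \<le> ennreal ((1/2) ^ Suc n)"
    "1 < ennreal (\<phi> (2 * u n)) * Wt (ennreal (s n))" "\<gamma> < \<infinity> \<Longrightarrow> s n \<le> enn2real \<gamma> * (1/2) ^ Suc n" for n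
    using z[of n] by (auto simp: u_def s_def)
  define S where "S n = (\<Sum>i<n. s i)" for n
  define A where "A n = {S n..<S (Suc n)}" for n
  have S0: "0 \<le> S n" for n unfolding S_def using us(2) by (intro sum_nonneg) (simp add: less_imp_le)
  have S_mono: "S m \<le> S n" if "m \<le> n" for m n
    unfolding S_def using us(2) that by (intro sum_mono2) (auto intro: less_imp_le)
  have S_gamma: "ennreal (S n) \<le> \<gamma>" for n
  proof (cases "\<gamma> < \<infinity>")
    case True
    then obtain c where c: "\<gamma> = ennreal c" "0 \<le> c" by (cases \<gamma>) auto
    have "S n \<le> c * (1 - (1/2) ^ n)"
    proof (induction n)
      case (Suc n)
      have "s n \<le> c * (1/2) ^ Suc n" using us(5)[OF True, of n] c by simp
      then show ?case using Suc by (simp add: S_def algebra_simps)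
    qed (simp add: S_def)
    also have "\<dots> \<le> c" using c by (simp add: mult_left_le)
    finally show ?thesis unfolding c(1) by (rule ennreal_leI)
  qed (simp add: less_top[symmetric])
  have em: "emeasure lebesgue (A n) = ennreal (s n)" for n
    using us(2)[of n] by (simp add: A_def S_def less_imp_le)
  have "A m \<inter> A n = {}" if "m < n" for m n
    using S_mono[of "Suc m" n] that by (auto simp: A_def)
  then have "disjoint_family A"
    unfolding disjoint_family_on_def by (metis Int_commute linorder_neqE_nat)
  moreover have "A n \<subseteq> I" for n
  proof
    fix t assume t: "t \<in> A n"
    then have "0 \<le> t" "t < S (Suc n)" using S0[of n] by (auto simp: A_def)
    then have "ennreal t < ennreal (S (Suc n))" by (simp add: ennreal_less_iff)
    then show "t \<in> I" using \<open>0 \<le> t\<close> S_gamma[of "Suc n"] by (auto simp: interval_I_def)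
  qed
  moreover have "A n \<in> sets lebesgue" for n by (simp add: A_def)
  ultimately show ?thesis using that[of u A] us em by simp
qed

text \<open>\<open>Y a\<close> takes the value \<open>a n * u n\<close> on \<open>A n\<close>. The
  bounds \<open>(1/2) ^ Suc n\<close> on the modulars of the blocks add up to 1, which gives the
  upper estimate. The lower one compares with a single block, whose double has modular above
  1.\<close>

lemma sequence_space_copy:
  assumes "\<not> ((\<gamma> = \<infinity> \<longrightarrow> Delta2 \<phi>) \<and> (\<gamma> < \<infinity> \<longrightarrow> Delta2_infinity \<phi>))"
  obtains Y :: "(nat \<Rightarrow> real) \<Rightarrow> L0" where
    "\<And>a b. Y (\<lambda>n. a n + b n) = Y a + Y b" "\<And>c a. Y (\<lambda>n. c * a n) = c *\<^sub>R Y a"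
    "\<And>C a. 0 \<le> C \<Longrightarrow> (\<And>n. \<bar>a n\<bar> \<le> C) \<Longrightarrow> Y a \<in> V \<and> N (Y a) \<le> C"
    "\<And>C a n. (\<And>n. \<bar>a n\<bar> \<le> C) \<Longrightarrow> 1/2 * \<bar>a n\<bar> \<le> N (Y a)"
proof -
  obtain u :: "nat \<Rightarrow> real" and A :: "nat \<Rightarrow> real set" where u: "\<And>n. 0 < u n"
    and A [measurable]: "\<And>n. A n \<in> sets lebesgue" and disj: "disjoint_family A" and AI: "\<And>n. A n \<subseteq> I"
    and up: "\<And>n. ennreal (\<phi> (u n)) * Wt (emeasure lebesgue (A n)) \<le> ennreal ((1/2) ^ Suc n)"
    and low: "\<And>n. 1 < ennreal (\<phi> (2 * u n)) * Wt (emeasure lebesgue (A n))"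
    by (rule disjoint_intervals[OF assms]) blast
  \<comment> \<open>The index of the interval containing \<open>t\<close>; outside all intervals its
    value is arbitrary and is removed by the indicator in \<open>f\<close>.\<close>
  define k where "k t = (LEAST n. t \<in> A n)" for t
  have k_meas [measurable]: "k \<in> measurable lebesgue (count_space UNIV)"
  proof -
    have "(\<lambda>t. t \<in> A n) \<in> measurable lebesgue (count_space UNIV)" for n by measurable
    then show ?thesis unfolding k_def[abs_def] by (rule measurable_Least)
  qed
  have k: "k t = n" if "t \<in> A n" for t n
  proof -
    have "t \<in> A (k t)" unfolding k_def using that by (rule LeastI)
    then show ?thesis using disj that by (auto simp: disjoint_family_on_def)
  qed
  have seq_meas: "(\<lambda>t. a (k t) :: real) \<in> borel_measurable lebesgue" for a
    by (rule measurable_compose[OF k_meas]) simp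
  define f where "f a t = a (k t) * (u (k t) * indicator (\<Union>n. A n) t)" for a t
  have f_meas: "f a \<in> borel_measurable lebesgue" for a
  proof -
    note seq_meas [measurable]
    show ?thesis unfolding f_def[abs_def] by measurable
  qed
  have f_in: "f a t = a n * u n" if "t \<in> A n" for a t n
    using that k[OF that] by (auto simp: f_def indicator_def)
  have f_out: "f a t = 0" if "t \<notin> (\<Union>n. A n)" for a t
    using that by (simp add: f_def)
  define Y where "Y a = abs_L0 (f a)" for a
  have rep_Y: "AE t in lebesgue. rep_L0 (Y a) t = f a t" for a
    unfolding Y_def by (rule rep_abs_L0[OF f_meas])
  have add: "Y (\<lambda>n. a n + b n) = Y a + Y b" for a b
  proof (rule L0_eqI)
    show "AE t in lebesgue. rep_L0 (Y (\<lambda>n. a n + b n)) t = rep_L0 (Y a + Y b) t"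
      using rep_Y[of a] rep_Y[of b] rep_Y[of "\<lambda>n. a n + b n"] rep_L0_add[of "Y a" "Y b"]
      by eventually_elim (simp add: f_def distrib_right)
  qed
  have scale: "Y (\<lambda>n. c * a n) = c *\<^sub>R Y a" for c a
  proof (rule L0_eqI)
    show "AE t in lebesgue. rep_L0 (Y (\<lambda>n. c * a n)) t = rep_L0 (c *\<^sub>R Y a) t"
      using rep_Y[of a] rep_Y[of "\<lambda>n. c * a n"] rep_L0_scaleR[of c "Y a"]
      by eventually_elim (simp add: f_def)
  qed
  have L0_Y: "Y a \<in> L0_on \<gamma>" for a
    unfolding L0_on_iff using rep_Y[of a]
  proof eventually_elim
    case (elim t)
    then show ?case using AI f_out[of t a] by auto
  qed
  have rho_Y: "rho (Y a) \<le> 1" if a: "\<And>n. \<bar>a n\<bar> \<le> 1" for a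
  proof -
    have "rho (Y a) \<le> choquet (\<lambda>t. \<Sum>n. ennreal (\<phi> (u n)) * indicator (A n) t)"
      unfolding modular_eq_choquet
    proof (rule choquet_mono_AE)
      show "AE t in lebesgue. t \<in> I \<longrightarrow> phi_of (Y a) t \<le> (\<Sum>n. ennreal (\<phi> (u n)) * indicator (A n) t)"
        using rep_Y[of a]
      proof eventually_elim
        case (elim t)
        show ?case
        proof (cases "t \<in> (\<Union>n. A n)")
          case True
          then obtain n where n: "t \<in> A n" by blast
          have "\<bar>a n\<bar> * u n \<le> 1 * u n" using a[of n] u[of n] by (intro mult_right_mono) auto
          then have "phi_of (Y a) t \<le> ennreal (\<phi> (u n)) * indicator (A n) t"
            using n elim f_in[OF n, of a] u[of n]
            by (auto simp: phi_of_def abs_mult intro!: ennreal_leI phi_mono)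
          also have "\<dots> \<le> (\<Sum>i. ennreal (\<phi> (u i)) * indicator (A i) t)"
            using sum_le_suminf[OF summableI, of "{n}" "\<lambda>i. ennreal (\<phi> (u i)) * indicator (A i) t"]
            by (simp del: sum_mult_indicator)
          finally show ?thesis by simp
        next
          case False
          then show ?thesis using elim f_out[of t a] by (simp add: phi_of_def)
        qed
      qed
    qed measurable
    also have "\<dots> \<le> (\<Sum>n. choquet (\<lambda>t. ennreal (\<phi> (u n)) * indicator (A n) t))"
      by (rule choquet_suminf_le) measurable
    also have "\<dots> = (\<Sum>n. ennreal (\<phi> (u n)) * Wt (emeasure lebesgue (A n)))"
      by (subst choquet_indicator[OF A]) (simp add: Int_absorb1[OF AI] del: emeasure_completion)
    also have "\<dots> \<le> (\<Sum>n. ennreal ((1/2) ^ Suc n))"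
      by (rule suminf_le[OF up summableI summableI])
    also have "\<dots> = ennreal (\<Sum>n. (1/2) ^ Suc n)"
      by (rule suminf_ennreal2) (use summable_Suc_iff[of "\<lambda>n. (1/2 :: real) ^ n"] in \<open>auto simp del: power_Suc\<close>)
    also have "(\<Sum>n. (1/2 :: real) ^ Suc n) = 1"
      using power_half_series by (rule sums_unique[symmetric])
    finally show ?thesis by simp
  qed
  have upper: "Y a \<in> V \<and> N (Y a) \<le> C" if C: "0 \<le> C" "\<And>n. \<bar>a n\<bar> \<le> C" for C a
  proof (cases "C = 0")
    case True
    then have "a = (\<lambda>n. 0 * 0)" using C(2) by (auto simp: fun_eq_iff)
    then have "Y a = 0" using scale[of 0 "\<lambda>_. 0"] by simp
    then show ?thesis using C(1) by simp
  next
    case False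
    then have C0: "0 < C" using C(1) by simp
    have "\<bar>inverse C * a n\<bar> \<le> 1" for n using C(2)[of n] C0 by (simp add: abs_mult field_simps)
    then have "rho (Y (\<lambda>n. inverse C * a n)) \<le> 1" by (rule rho_Y)
    then have "rho (Y a /\<^sub>R C) \<le> 1" by (simp only: scale)
    then show ?thesis using C0 L0_Y by (auto simp: V_iff intro: N_leI)
  qed
  have lower: "1/2 * \<bar>a n\<bar> \<le> N (Y a)" if a: "\<And>n. \<bar>a n\<bar> \<le> C" for C a n
  proof -
    define e where "e i = (if i = n then 1 else 0 :: real)" for i
    have eV: "Y e \<in> V" using upper[of 1 e] by (simp add: e_def)
    have "0 \<le> C" using a[of 0] by (meson abs_ge_zero order_trans)
    then have aV: "Y a \<in> V" using upper[of C a] a by blast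
    have "\<not> N (Y e) \<le> 1/2"
    proof
      assume "N (Y e) \<le> 1/2"
      then have "rho (Y e /\<^sub>R (1/2)) \<le> 1" using N_le_iff[OF eV, of "1/2"] by simp
      moreover have "1 < rho (Y e /\<^sub>R (1/2))"
      proof -
        have "choquet (\<lambda>t. ennreal (\<phi> (2 * u n)) * indicator (A n) t) \<le> rho (Y e /\<^sub>R (1/2))"
          unfolding modular_eq_choquet
        proof (rule choquet_mono_AE)
          show "AE t in lebesgue. t \<in> I \<longrightarrow> ennreal (\<phi> (2 * u n)) * indicator (A n) t \<le> phi_of (Y e /\<^sub>R (1/2)) t"
            using rep_Y[of e] rep_L0_scaleR[of "inverse (1/2)" "Y e"]
          proof eventually_elim
            case (elim t)
            show ?case
            proof (cases "t \<in> A n")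
              case True
              then show ?thesis using elim f_in[OF True, of e] u[of n] by (simp add: phi_of_def e_def)
            qed simp
          qed
        qed measurable
        moreover have "choquet (\<lambda>t. ennreal (\<phi> (2 * u n)) * indicator (A n) t) = ennreal (\<phi> (2 * u n)) * Wt (emeasure lebesgue (A n))"
          by (subst choquet_indicator[OF A]) (simp add: Int_absorb1[OF AI] del: emeasure_completion)
        ultimately show ?thesis using low[of n] by (simp del: emeasure_completion)
      qed
      ultimately show False by simp
    qed
    then have "1/2 * \<bar>a n\<bar> \<le> N (Y e) * \<bar>a n\<bar>" by (intro mult_right_mono) auto
    also have "\<dots> = N (a n *\<^sub>R Y e)" by (simp add: N_scaleR[OF eV])
    also have "\<dots> = N (Y (\<lambda>i. a n * e i))" by (simp only: scale)
    also have "\<dots> \<le> N (Y a)"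
    proof (rule V_dominated(2)[OF aV L0_Y])
      show "AE t in lebesgue. t \<in> I \<longrightarrow> \<bar>rep_L0 (Y (\<lambda>i. a n * e i)) t\<bar> \<le> \<bar>rep_L0 (Y a) t\<bar>"
        using rep_Y[of a] rep_Y[of "\<lambda>i. a n * e i"]
      proof eventually_elim
        case (elim t)
        then show ?case by (cases "k t = n") (simp_all add: f_def e_def)
      qed
    qed
    finally show ?thesis .
  qed
  show ?thesis by (rule that[OF add scale upper lower])
qed

end

section \<open>Rademacher functions and the conclusion\<close>

text \<open>The parity of the floor is a binary digit of \<open>t\<close>, so the sign alternates on
  dyadic intervals of length \<open>1 / 2 ^ Suc n\<close>.\<close>

definition rademacher :: "nat \<Rightarrow> real \<Rightarrow> real" where
  "rademacher n t = (if even \<lfloor>2 ^ Suc n * t\<rfloor> then 1 else - 1)"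

lemma rademacher_measurable [measurable]: "rademacher n \<in> borel_measurable borel"
  unfolding rademacher_def by measurable

lemma rademacher_square [simp]: "rademacher n t * rademacher n t = 1"
  by (simp add: rademacher_def)

lemma rademacher_0_half: "0 \<le> t \<Longrightarrow> t < 1 \<Longrightarrow> rademacher 0 (t / 2) = 1"
  "0 \<le> t \<Longrightarrow> t < 1 \<Longrightarrow> rademacher 0 (1 / 2 + t / 2) = - 1"
proof -
  assume t: "0 \<le> t" "t < 1"
  have "\<lfloor>t\<rfloor> = 0" "\<lfloor>1 + t\<rfloor> = 1" using t by linarith+
  then show "rademacher 0 (t / 2) = 1" "rademacher 0 (1 / 2 + t / 2) = - 1"
    by (simp_all add: rademacher_def distrib_left)
qed

lemma rademacher_Suc_half: "rademacher (Suc n) (t / 2) = rademacher n t"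
  "rademacher (Suc n) (1 / 2 + t / 2) = rademacher n t"
proof -
  have "2 ^ Suc (Suc n) * (t / 2) = 2 ^ Suc n * t" by simp
  then show "rademacher (Suc n) (t / 2) = rademacher n t" by (simp only: rademacher_def)
  have "2 ^ Suc (Suc n) * (1 / 2 + t / 2) = 2 ^ Suc n * t + of_int (2 ^ Suc n)"
    by (simp add: distrib_left)
  then have "\<lfloor>2 ^ Suc (Suc n) * (1 / 2 + t / 2)\<rfloor> = \<lfloor>2 ^ Suc n * t\<rfloor> + 2 ^ Suc n"
    by (metis floor_add_int)
  then show "rademacher (Suc n) (1 / 2 + t / 2) = rademacher n t"
    by (simp add: rademacher_def del: power_Suc)
qed

text \<open>Each half of the unit interval is stretched to the whole; this self-similarity drives
  the induction for orthogonality.\<close>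

lemma integral_unit_interval_split:
  fixes f :: "real \<Rightarrow> real"
  assumes [measurable]: "f \<in> borel_measurable borel" and b: "\<And>t. \<bar>f t\<bar> \<le> 1"
  shows "(\<integral>t. indicator {0..<1} t * f t \<partial>lborel) =
    1/2 * (\<integral>t. indicator {0..<1} t * f (t / 2) \<partial>lborel) + 1/2 * (\<integral>t. indicator {0..<1} t * f (1/2 + t / 2) \<partial>lborel)"
proof -
  have int: "integrable lborel (\<lambda>t. indicator {c..<d} t * f t)" for c d
  proof (rule Bochner_Integration.integrable_bound[where f = "indicator {c..<d} :: real \<Rightarrow> real"])
    show "integrable lborel (indicator {c..<d} :: real \<Rightarrow> real)"
    proof (rule integrable_real_indicator)
      show "emeasure lborel {c..<d} < \<infinity>" by (cases "c \<le> d") auto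
    qed simp
    show "AE t in lborel. norm (indicator {c..<d} t * f t) \<le> norm (indicator {c..<d} t :: real)"
      using b by (intro AE_I2) (auto simp: indicator_def)
  qed measurable
  have "(\<integral>t. indicator {0..<1} t * f t \<partial>lborel) = (\<integral>t. indicator {0..<1/2} t * f t + indicator {1/2..<1} t * f t \<partial>lborel)"
    by (intro Bochner_Integration.integral_cong refl) (auto simp: indicator_def)
  also have "\<dots> = (\<integral>t. indicator {0..<1/2} t * f t \<partial>lborel) + (\<integral>t. indicator {1/2..<1} t * f t \<partial>lborel)"
    by (rule Bochner_Integration.integral_add[OF int int])
  also have "(\<integral>t. indicator {0..<1/2} t * f t \<partial>lborel) = \<bar>1/2\<bar> *\<^sub>R (\<integral>t. indicator {0..<1/2} (0 + 1/2 * t) * f (0 + 1/2 * t) \<partial>lborel)"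
    by (rule lborel_integral_real_affine) simp
  also have "(\<integral>t. indicator {0..<1/2} (0 + 1/2 * t) * f (0 + 1/2 * t) \<partial>lborel) = (\<integral>t. indicator {0..<1} t * f (t / 2) \<partial>lborel)"
    by (intro Bochner_Integration.integral_cong refl) (auto simp: indicator_def)
  also have "(\<integral>t. indicator {1/2..<1} t * f t \<partial>lborel) = \<bar>1/2\<bar> *\<^sub>R (\<integral>t. indicator {1/2..<1} (1/2 + 1/2 * t) * f (1/2 + 1/2 * t) \<partial>lborel)"
    by (rule lborel_integral_real_affine) simp
  also have "(\<integral>t. indicator {1/2..<1} (1/2 + 1/2 * t) * f (1/2 + 1/2 * t) \<partial>lborel) = (\<integral>t. indicator {0..<1} t * f (1/2 + t / 2) \<partial>lborel)"
    by (intro Bochner_Integration.integral_cong refl) (auto simp: indicator_def)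
  finally show ?thesis by simp
qed

lemma rademacher_product_split:
  "(\<integral>t. indicator {0..<1} t * (rademacher m t * rademacher (Suc l) t) \<partial>lborel) =
    1/2 * (\<integral>t. indicator {0..<1} t * (rademacher m (t / 2) * rademacher l t) \<partial>lborel) +
    1/2 * (\<integral>t. indicator {0..<1} t * (rademacher m (1/2 + t / 2) * rademacher l t) \<partial>lborel)"
proof -
  have "\<bar>rademacher m t * rademacher (Suc l) t\<bar> \<le> 1" for t by (simp add: rademacher_def)
  from integral_unit_interval_split[OF _ this] show ?thesis by (simp add: rademacher_Suc_half)
qed

text \<open>Induction on the smaller index: restriction to either half lowers both indices by one.
  At index 0 the first factor is 1 on one half and -1 on the other, while the second factor is the
  same on both, so the halves cancel.\<close>

lemma rademacher_orthogonal:
  "m < n \<Longrightarrow> (\<integral>t. indicator {0..<1} t * (rademacher m t * rademacher n t) \<partial>lborel) = 0"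
proof (induction m arbitrary: n)
  case 0
  then obtain l where l: "n = Suc l" by (cases n) auto
  have "(\<integral>t. indicator {0..<1} t * (rademacher 0 (t / 2) * rademacher l t) \<partial>lborel) = (\<integral>t. indicator {0..<1} t * rademacher l t \<partial>lborel)"
    by (intro Bochner_Integration.integral_cong refl) (auto simp: indicator_def rademacher_0_half)
  moreover have "(\<integral>t. indicator {0..<1} t * (rademacher 0 (1/2 + t / 2) * rademacher l t) \<partial>lborel) = (\<integral>t. - (indicator {0..<1} t * rademacher l t) \<partial>lborel)"
    by (intro Bochner_Integration.integral_cong refl) (auto simp: indicator_def rademacher_0_half)
  ultimately show ?case unfolding l rademacher_product_split by simp
next
  case (Suc m)
  then obtain l where l: "n = Suc l" "m < l" by (cases n) auto
  show ?case
    unfolding l(1) rademacher_product_split rademacher_Suc_half by (simp add: Suc.IH[OF l(2)])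
qed

text \<open>Bessel's inequality. \<open>D k\<close> is what remains of the indicator after
  projection on the first \<open>k\<close> functions; each step lowers the integral of its square by
  the square of \<open>c k\<close>, so these squares are summable.\<close>

lemma (in finite_measure) orthonormal_coefficients_null:
  fixes R :: "nat \<Rightarrow> 'a \<Rightarrow> real"
  assumes R [measurable]: "\<And>n. R n \<in> borel_measurable M" and sq: "\<And>n x. x \<in> space M \<Longrightarrow> R n x * R n x = 1"
    and orth: "\<And>m n. m < n \<Longrightarrow> (\<integral>x. R m x * R n x \<partial>M) = 0" and one: "measure M (space M) = 1"
    and A [measurable]: "A \<in> sets M"
  shows "(\<lambda>n. \<integral>x. indicator A x * R n x \<partial>M) \<longlonglongrightarrow> 0"
proof -
  define c where "c n = (\<integral>x. indicator A x * R n x \<partial>M)" for n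
  define D where "D k x = indicator A x - (\<Sum>n<k. c n * R n x)" for k x
  have D_meas [measurable]: "D k \<in> borel_measurable M" for k unfolding D_def[abs_def] by measurable
  have R_abs: "\<bar>R n x\<bar> = 1" if "x \<in> space M" for n x
    using sq[OF that, of n] by (auto simp: square_eq_1_iff)
  have bounded: "integrable M f" if "f \<in> borel_measurable M" "\<And>x. x \<in> space M \<Longrightarrow> \<bar>f x\<bar> \<le> B" for f :: "'a \<Rightarrow> real" and B
    using that by (intro integrable_const_bound[where B = B] AE_I2) auto
  define B where "B k = 1 + (\<Sum>n<k. \<bar>c n\<bar>)" for k
  have D_abs: "\<bar>D k x\<bar> \<le> B k" if x: "x \<in> space M" for k x
  proof -
    have "\<bar>\<Sum>n<k. c n * R n x\<bar> \<le> (\<Sum>n<k. \<bar>c n * R n x\<bar>)" by (rule sum_abs)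
    also have "\<dots> = (\<Sum>n<k. \<bar>c n\<bar>)" by (simp add: abs_mult R_abs[OF x])
    finally have "\<bar>\<Sum>n<k. c n * R n x\<bar> \<le> (\<Sum>n<k. \<bar>c n\<bar>)" .
    moreover have "\<bar>indicator A x :: real\<bar> \<le> 1" by (simp add: indicator_def)
    ultimately show ?thesis unfolding D_def B_def by linarith
  qed
  have int_RD: "integrable M (\<lambda>x. R n x * D k x)" for n k
    by (rule bounded[of _ "B k"]) (use D_abs R_abs in \<open>auto simp: abs_mult\<close>)
  have int_DD: "integrable M (\<lambda>x. D k x * D k x)" for k
  proof (rule bounded)
    show "\<bar>D k x * D k x\<bar> \<le> B k * B k" if "x \<in> space M" for x
      unfolding abs_mult using D_abs[OF that, of k] by (intro mult_mono) auto
  qed measurable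
  have int_RR: "integrable M (\<lambda>x. R m x * R n x)" for m n
    by (rule bounded[of _ 1]) (use R_abs in \<open>auto simp: abs_mult\<close>)
  have int_A: "integrable M (\<lambda>x. indicator A x * R n x)" for n
    by (rule bounded[of _ 1]) (use R_abs in \<open>auto simp: indicator_def\<close>)
  have RD: "(\<integral>x. R k x * D k x \<partial>M) = c k" for k
  proof -
    have "(\<integral>x. R k x * D k x \<partial>M) = (\<integral>x. indicator A x * R k x - (\<Sum>n<k. c n * (R n x * R k x)) \<partial>M)"
      by (intro Bochner_Integration.integral_cong refl) (simp add: D_def right_diff_distrib sum_distrib_left mult_ac)
    also have "\<dots> = c k - (\<Sum>n<k. c n * (\<integral>x. R n x * R k x \<partial>M))"
      using int_A int_RR by (simp add: c_def)
    also have "\<dots> = c k" using orth by simp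
    finally show ?thesis .
  qed
  have step: "(\<integral>x. D (Suc k) x * D (Suc k) x \<partial>M) = (\<integral>x. D k x * D k x \<partial>M) - (c k)\<^sup>2" for k
  proof -
    have "(\<integral>x. D (Suc k) x * D (Suc k) x \<partial>M) = (\<integral>x. D k x * D k x - 2 * c k * (R k x * D k x) + (c k)\<^sup>2 \<partial>M)"
    proof (intro Bochner_Integration.integral_cong refl)
      fix x assume x: "x \<in> space M"
      have eq: "D (Suc k) x = D k x - c k * R k x" by (simp add: D_def)
      have "D (Suc k) x * D (Suc k) x = D k x * D k x - 2 * c k * (R k x * D k x) + (c k)\<^sup>2 * (R k x * R k x)"
        unfolding eq by (simp add: power2_eq_square algebra_simps)
      then show "D (Suc k) x * D (Suc k) x = D k x * D k x - 2 * c k * (R k x * D k x) + (c k)\<^sup>2"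
        using sq[OF x] by simp
    qed
    also have "\<dots> = (\<integral>x. D k x * D k x \<partial>M) - 2 * c k * c k + (c k)\<^sup>2"
      using int_RD int_DD RD[of k] one by simp
    finally show ?thesis by (simp add: power2_eq_square)
  qed
  have "(\<integral>x. D k x * D k x \<partial>M) = (\<integral>x. D 0 x * D 0 x \<partial>M) - (\<Sum>n<k. (c n)\<^sup>2)" for k
    by (induction k) (simp_all add: step)
  moreover have "0 \<le> (\<integral>x. D k x * D k x \<partial>M)" for k by simp
  ultimately have "(\<Sum>n<k. (c n)\<^sup>2) \<le> (\<integral>x. D 0 x * D 0 x \<partial>M)" for k by (metis diff_ge_0_iff_ge)
  then have "summable (\<lambda>n. (c n)\<^sup>2)" by (intro summableI_nonneg_bounded) auto
  then have "(\<lambda>n. (c n)\<^sup>2) \<longlonglongrightarrow> 0" by (rule summable_LIMSEQ_zero)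
  then have "(\<lambda>n. sqrt ((c n)\<^sup>2)) \<longlonglongrightarrow> sqrt 0" by (rule tendsto_real_sqrt)
  then have "c \<longlonglongrightarrow> 0" by (simp add: tendsto_rabs_zero_iff)
  then show ?thesis by (simp add: c_def[abs_def])
qed

text \<open>Lebesgue measure on the unit interval is transported along the injection, so that the
  counterexample lives on the prescribed type \<open>'b\<close>; the Rademacher functions are
  composed with the inverse.\<close>

lemma rademacher_space:
  fixes \<iota> :: "real \<Rightarrow> 'b"
  assumes inj: "inj \<iota>"
  obtains M :: "'b measure" and r :: "nat \<Rightarrow> 'b \<Rightarrow> real" where
    "finite_measure M" "0 < measure M (space M)" "\<And>n. r n \<in> borel_measurable M"
    "\<And>n \<omega>. \<omega> \<in> space M \<Longrightarrow> r n \<omega> = 1 \<or> r n \<omega> = -1"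
    "\<And>A. A \<in> sets M \<Longrightarrow> (\<lambda>n. \<integral>\<omega>. indicator A \<omega> * r n \<omega> \<partial>M) \<longlonglongrightarrow> 0"
proof -
  define U where "U = restrict_space lborel {0..<1::real}"
  define M where "M = embed_measure U \<iota>"
  define r where "r n \<omega> = rademacher n (inv \<iota> \<omega>)" for n \<omega>
  have \<iota> [measurable]: "\<iota> \<in> measurable U M" unfolding M_def by (rule measurable_embed_measure2[OF inj])
  have M_distr: "M = distr U M \<iota>" unfolding M_def by (rule embed_measure_eq_distr[OF inj])
  have rU: "rademacher n \<in> borel_measurable U" for n
    unfolding U_def by (rule measurable_restrict_space1) simp
  have r_meas [measurable]: "r n \<in> borel_measurable M" for n
    unfolding M_def using rU[of n] by (intro measurable_embed_measure1) (simp add: r_def inv_f_f[OF inj])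
  have U1: "emeasure U (space U) = 1"
    by (simp add: U_def space_restrict_space emeasure_restrict_space)
  have M1: "emeasure M (space M) = 1"
    unfolding M_def using U1 in_sets_embed_measure[OF sets.top[of U], of \<iota>]
    by (subst emeasure_embed_measure[OF inj]) (auto simp: space_embed_measure inj_vimage_image_eq[OF inj])
  have fin: "finite_measure M" by (rule finite_measureI) (simp add: M1)
  interpret finite_measure M by (rule fin)
  have one: "measure M (space M) = 1" by (simp add: measure_def M1)
  have orth: "(\<integral>\<omega>. r m \<omega> * r n \<omega> \<partial>M) = 0" if "m < n" for m n
  proof -
    have "(\<integral>\<omega>. r m \<omega> * r n \<omega> \<partial>M) = (\<integral>\<omega>. r m \<omega> * r n \<omega> \<partial>distr U M \<iota>)" using M_distr by simp
    also have "\<dots> = (\<integral>t. r m (\<iota> t) * r n (\<iota> t) \<partial>U)" by (rule integral_distr) measurable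
    also have "\<dots> = (\<integral>t. indicator {0..<1} t * (rademacher m t * rademacher n t) \<partial>lborel)"
      unfolding U_def by (subst integral_restrict_space) (simp_all add: r_def inv_f_f[OF inj])
    also have "\<dots> = 0" by (rule rademacher_orthogonal[OF that])
    finally show ?thesis .
  qed
  show ?thesis
  proof (rule that[OF fin _ r_meas])
    show "0 < measure M (space M)" by (simp add: one)
    show "r n \<omega> = 1 \<or> r n \<omega> = -1" for n \<omega> by (simp add: r_def rademacher_def)
    show "(\<lambda>n. \<integral>\<omega>. indicator A \<omega> * r n \<omega> \<partial>M) \<longlonglongrightarrow> 0" if "A \<in> sets M" for A
      by (rule orthonormal_coefficients_null[OF r_meas _ orth one that]) (simp add: r_def)
  qed
qed

section \<open>The two implications\<close>

context orlicz_lorentz_space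
begin

lemma radon_nikodym_if:
  assumes "(\<gamma> = \<infinity> \<longrightarrow> Delta2 \<phi>) \<and> (\<gamma> < \<infinity> \<longrightarrow> Delta2_infinity \<phi>)"
  shows "radon_nikodym_property TYPE('b) V N"
  unfolding radon_nikodym_property_def
proof (intro allI impI)
  fix M :: "'b measure" and G
  assume "finite_measure M" and G: "vector_measure V N M G \<and> continuous_wrt N M G \<and> bounded_variation N M G"
  then interpret finite_measure M by simp
  interpret bv_vector_measure \<gamma> w \<phi> M G by unfold_locales (use G in auto)
  show "\<exists>g. bochner_integrable V N M g \<and> (\<forall>E\<in>sets M. has_bochner_integral_on V N M g E (G E))"
    by (rule has_density[OF Delta2_rho_finite[OF assms]])
qed

lemma radon_nikodym_only_if:
  fixes \<iota> :: "real \<Rightarrow> 'b"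
  assumes inj: "inj \<iota>" and "\<not> ((\<gamma> = \<infinity> \<longrightarrow> Delta2 \<phi>) \<and> (\<gamma> < \<infinity> \<longrightarrow> Delta2_infinity \<phi>))"
  shows "\<not> radon_nikodym_property TYPE('b) V N"
proof -
  show ?thesis
  proof (rule sequence_space_copy[OF assms(2)])
    have half: "0 < (1 / 2 :: real)" by simp
    fix Y :: "(nat \<Rightarrow> real) \<Rightarrow> L0"
    assume Y: "\<And>a b. Y (\<lambda>n. a n + b n) = Y a + Y b" "\<And>c a. Y (\<lambda>n. c * a n) = c *\<^sub>R Y a"
      "\<And>C a. 0 \<le> C \<Longrightarrow> (\<And>n. \<bar>a n\<bar> \<le> C) \<Longrightarrow> Y a \<in> V \<and> N (Y a) \<le> C"
      "\<And>C a n. (\<And>n. \<bar>a n\<bar> \<le> C) \<Longrightarrow> 1/2 * \<bar>a n\<bar> \<le> N (Y a)"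
    show ?thesis
    proof (rule rademacher_space[OF inj])
      fix M :: "'b measure" and r :: "nat \<Rightarrow> 'b \<Rightarrow> real"
      assume M: "finite_measure M" "0 < measure M (space M)" "\<And>n. r n \<in> borel_measurable M"
        "\<And>n \<omega>. \<omega> \<in> space M \<Longrightarrow> r n \<omega> = 1 \<or> r n \<omega> = -1"
        "\<And>A. A \<in> sets M \<Longrightarrow> (\<lambda>n. \<integral>\<omega>. indicator A \<omega> * r n \<omega> \<partial>M) \<longlonglongrightarrow> 0"
      show ?thesis
        by (rule space.no_radon_nikodym_property[OF M Y(1-3) half Y(4)])
    qed
  qed
qed

end

theorem corollary2p8:
  fixes \<gamma> :: ennreal and \<phi> w :: "real \<Rightarrow> real"
  assumes "\<exists>\<iota> :: real \<Rightarrow> 'b. inj \<iota>"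
    and "0 < \<gamma>"
    and "orlicz_N_function \<phi>"
    and "decreasing_weight \<gamma> w"
    and "\<gamma> = \<infinity> \<Longrightarrow> weight_primitive w \<infinity> = \<infinity>"
  shows "radon_nikodym_property TYPE('b) (orlicz_lorentz \<gamma> \<phi> w) (luxemburg_norm \<gamma> \<phi> w) \<longleftrightarrow>
    (\<gamma> = \<infinity> \<longrightarrow> Delta2 \<phi>) \<and> (\<gamma> < \<infinity> \<longrightarrow> Delta2_infinity \<phi>)"
proof -
  interpret orlicz_lorentz_space \<gamma> w \<phi>
    by unfold_locales (use assms in auto)
  obtain \<iota> :: "real \<Rightarrow> 'b" where "inj \<iota>"
    using assms(1) by blast
  then show ?thesis
    using radon_nikodym_if radon_nikodym_only_if by blast
qed

end
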